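(* Let $\Gamma\subset\mathrm{PSL}(2,\mathbb R)$ be a discrete subgroup of finite covolume, and let $\mathcal M_*\ne\mathbb C$ be a ring generated (as a $\mathbb C$-algebra) by a finite set of holomorphic or meromorphic modular forms of positive weight over $\Gamma$. Let $\epsilon=\dim_{\mathbb C}I_{\mathcal M}/(I_{\mathcal M}\cap J_{\mathcal M}^2)$ and let $f_1,\dots,f_\epsilon$ be homogeneous elements of $I_{\mathcal M}$, linearly independent modulo $J_{\mathcal M}^2$, of weights $l_1,\dots,l_\epsilon$ respectively. Then for every even $k$, $$(J_{\mathcal M}/J_{\mathcal M}^2)_k=\bigoplus_{1\le i\le\epsilon,\ l_i\le k}\mathbb C\,D^{(k-l_i)/2}(f_i),$$ i.e. the classes of the $D^{(k-l_i)/2}(f_i)$ with $l_i\le k$ form a basis of $(J_{\mathcal M}/J_{\mathcal M}^2)_k$. In particular, $\dim_{\mathbb C}(J_{\mathcal M}/J_{\mathcal M}^2)_k=\epsilon$ for all even $k\ge\max\{l_1,\dots,l_\epsilon\}$, and the ring $\mathrm{CL}(\mathcal M)_*$ is not finitely generated as a $\mathbb C$-algebra.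
   Context: A meromorphic modular form of weight $k$ over $\Gamma$ is a meromorphic function $f$ on the upper half plane $\mathcal H$ (meromorphic at the cusps, if any) with $(cz+d)^{-k}f(\frac{az+b}{cz+d})=f(z)$ for all $\begin{pmatrix}a&b\\c&d\end{pmatrix}\in\Gamma$; weights are even since $\Gamma\subset\mathrm{PSL}(2,\mathbb R)$. $D=d/dz$. For a graded subring $\mathcal M_*$ of the ring of meromorphic modular forms over $\Gamma$, the differential closure $\mathrm{CL}(\mathcal M)_*$ is the smallest ring containing $\mathcal M_*$ and closed under $D$, graded so that $D^j\mathcal M_k\subset\mathrm{CL}(\mathcal M)_{k+2j}$. $J_{\mathcal M}$ is the ideal of elements of positive weight in $\mathrm{CL}(\mathcal M)_*$, $I_{\mathcal M}$ is the ideal of elements of positive weight in $\mathcal M_*$, and $J_{\mathcal M}^2$ is the square of the ideal $J_{\mathcal M}$ in $\mathrm{CL}(\mathcal M)_*$ (the decomposable forms). The subscript $k$ denotes the weight-$k$ part. *)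

theory Defs
  imports "HOL-Complex_Analysis.Complex_Analysis"
begin

section \<open>Discrete subgroups of PSL(2,R) of finite covolume\<close>

definition uhp :: "complex set" where
  "uhp = {z. Im z > 0}"

definition moebius_action :: "real^2^2 \<Rightarrow> complex \<Rightarrow> complex" where
  "moebius_action A z = (of_real (A$1$1) * z + of_real (A$1$2)) / (of_real (A$2$1) * z + of_real (A$2$2))"

definition automorphy :: "real^2^2 \<Rightarrow> complex \<Rightarrow> complex" where
  "automorphy A z = of_real (A$2$1) * z + of_real (A$2$2)"

text \<open>A subgroup of PSL(2,R) is represented by its preimage in SL(2,R), that is, by a
  subgroup of SL(2,R) containing \<open>-1\<close>. Since SL(2,R) \<open>\<rightarrow>\<close> PSL(2,R) is a two-sheeted covering,
  the subgroup is discrete if and only if its preimage is.\<close>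

definition discrete_subgroup_PSL2R :: "(real^2^2) set \<Rightarrow> bool" where
  "discrete_subgroup_PSL2R \<Gamma> \<longleftrightarrow>
     (\<forall>A\<in>\<Gamma>. det A = 1) \<and> mat 1 \<in> \<Gamma> \<and> - mat 1 \<in> \<Gamma> \<and>
     (\<forall>A\<in>\<Gamma>. \<forall>B\<in>\<Gamma>. A ** B \<in> \<Gamma>) \<and> (\<forall>A\<in>\<Gamma>. matrix_inv A \<in> \<Gamma>) \<and>
     discrete \<Gamma>"

definition hyperbolic_area :: "complex set \<Rightarrow> ennreal" where
  "hyperbolic_area F = (\<integral>\<^sup>+z. ennreal (1 / (Im z)\<^sup>2) * indicator F z \<partial>lborel)"

definition fundamental_domain :: "(real^2^2) set \<Rightarrow> complex set \<Rightarrow> bool" where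
  "fundamental_domain \<Gamma> F \<longleftrightarrow>
     F \<in> sets borel \<and> F \<subseteq> uhp \<and> (\<Union>A\<in>\<Gamma>. moebius_action A ` F) = uhp \<and>
     (\<forall>A\<in>\<Gamma> - {mat 1, - mat 1}. F \<inter> moebius_action A ` F \<in> null_sets lborel)"

text \<open>All fundamental domains have the same hyperbolic area, the covolume.\<close>

definition finite_covolume :: "(real^2^2) set \<Rightarrow> bool" where
  "finite_covolume \<Gamma> \<longleftrightarrow> (\<exists>F. fundamental_domain \<Gamma> F \<and> hyperbolic_area F < \<infinity>)"


section \<open>The differential algebra of meromorphic functions on the upper half plane\<close>

text \<open>Functions in the library are total, so a meromorphic function is a class of functions
  that agree outside a set without accumulation points in the upper half plane; this makes
  the values at poles irrelevant.\<close>

definition mero_rel :: "(complex \<Rightarrow> complex) \<Rightarrow> (complex \<Rightarrow> complex) \<Rightarrow> bool" where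
  "mero_rel f g \<longleftrightarrow> f meromorphic_on uhp \<and> g meromorphic_on uhp \<and> (\<forall>\<^sub>\<approx>z\<in>uhp. f z = g z)"

lemma open_uhp: "open uhp"
  unfolding uhp_def by (rule open_halfspace_Im_gt)

lemma part_equivp_mero_rel: "part_equivp mero_rel"
proof (rule part_equivpI)
  show "\<exists>f. mero_rel f f"
    by (rule exI[of _ "\<lambda>_. 0"]) (auto simp: mero_rel_def)
  show "symp mero_rel"
    by (auto simp: symp_def mero_rel_def elim: eventually_mono)
  show "transp mero_rel"
    by (auto simp: transp_def mero_rel_def elim: eventually_elim2)
qed

quotient_type mero = "complex \<Rightarrow> complex" / partial: mero_rel
  morphisms rep_mero mero_of
  by (rule part_equivp_mero_rel)

instantiation mero :: comm_ring_1
begin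

lift_definition zero_mero :: mero is "\<lambda>_. 0"
  by (auto simp: mero_rel_def)

lift_definition one_mero :: mero is "\<lambda>_. 1"
  by (auto simp: mero_rel_def)

lift_definition plus_mero :: "mero \<Rightarrow> mero \<Rightarrow> mero" is "\<lambda>f g z. f z + g z"
  by (auto simp: mero_rel_def intro!: meromorphic_intros elim: eventually_elim2)

lift_definition uminus_mero :: "mero \<Rightarrow> mero" is "\<lambda>f z. - f z"
  by (auto simp: mero_rel_def intro!: meromorphic_intros elim: eventually_mono)

lift_definition minus_mero :: "mero \<Rightarrow> mero \<Rightarrow> mero" is "\<lambda>f g z. f z - g z"
  by (auto simp: mero_rel_def intro!: meromorphic_intros elim: eventually_elim2)

lift_definition times_mero :: "mero \<Rightarrow> mero \<Rightarrow> mero" is "\<lambda>f g z. f z * g z"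
  by (auto simp: mero_rel_def intro!: meromorphic_intros elim: eventually_elim2)

instance
proof
  fix a b c :: mero
  show "a + b + c = a + (b + c)"
    by transfer (auto simp: mero_rel_def algebra_simps intro!: meromorphic_intros)
  show "a + b = b + a"
    by transfer (auto simp: mero_rel_def algebra_simps intro!: meromorphic_intros)
  show "0 + a = a"
    by transfer (auto simp: mero_rel_def)
  show "- a + a = 0"
    by transfer (auto simp: mero_rel_def)
  show "a - b = a + - b"
    by transfer (auto simp: mero_rel_def intro!: meromorphic_intros)
  show "a * b * c = a * (b * c)"
    by transfer (auto simp: mero_rel_def algebra_simps intro!: meromorphic_intros)
  show "a * b = b * a"
    by transfer (auto simp: mero_rel_def algebra_simps intro!: meromorphic_intros)
  show "1 * a = a"
    by transfer (auto simp: mero_rel_def)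
  show "(a + b) * c = a * c + b * c"
    by transfer (auto simp: mero_rel_def algebra_simps intro!: meromorphic_intros)
  show "(0 :: mero) \<noteq> 1"
  proof (transfer, goal_cases)
    case 1
    have "\<i> \<in> uhp"
      by (simp add: uhp_def)
    then have "cosparse uhp \<noteq> bot"
      by auto
    then show ?case
      by (simp add: mero_rel_def trivial_limit_def)
  qed
qed

end

lift_definition scale_mero :: "complex \<Rightarrow> mero \<Rightarrow> mero"  (infixr \<open>*\<^sub>m\<close> 75)
  is "\<lambda>c f z. c * f z"
  by (auto simp: mero_rel_def intro!: meromorphic_intros elim: eventually_mono)

interpretation mero: vector_space scale_mero
proof
  fix a b :: complex and x y :: mero
  show "a *\<^sub>m (x + y) = a *\<^sub>m x + a *\<^sub>m y"
    by transfer (auto simp: mero_rel_def algebra_simps intro!: meromorphic_intros)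
  show "(a + b) *\<^sub>m x = a *\<^sub>m x + b *\<^sub>m x"
    by transfer (auto simp: mero_rel_def algebra_simps intro!: meromorphic_intros)
  show "a *\<^sub>m (b *\<^sub>m x) = (a * b) *\<^sub>m x"
    by transfer (auto simp: mero_rel_def algebra_simps intro!: meromorphic_intros)
  show "1 *\<^sub>m x = x"
    by transfer (auto simp: mero_rel_def)
qed

lemma eventually_cosparse_uhp_nhds:
  assumes "\<forall>\<^sub>\<approx>z\<in>uhp. P z"
  shows "\<forall>\<^sub>\<approx>z\<in>uhp. \<forall>\<^sub>F w in nhds z. P w"
  unfolding eventually_cosparse_open_eq[OF open_uhp]
proof
  fix z assume "z \<in> uhp"
  with assms have "\<forall>\<^sub>F w in at z. P w"
    by (simp add: eventually_cosparse_open_eq[OF open_uhp])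
  then obtain S where S: "open S" "z \<in> S" "\<forall>w\<in>S. w \<noteq> z \<longrightarrow> P w"
    by (auto simp: eventually_at_topological)
  have "\<forall>\<^sub>F w in nhds v. P w" if "v \<in> S - {z}" for v
    using S that by (intro eventually_nhds[THEN iffD2] exI[of _ "S - {z}"]) (auto intro: open_delete)
  then show "\<forall>\<^sub>F v in at z. \<forall>\<^sub>F w in nhds v. P w"
    using S by (auto simp: eventually_at_topological)
qed

lift_definition D_mero :: "mero \<Rightarrow> mero" is deriv
proof -
  fix f g assume "mero_rel f g"
  then have fg: "f meromorphic_on uhp" "g meromorphic_on uhp" "\<forall>\<^sub>\<approx>z\<in>uhp. f z = g z"
    by (auto simp: mero_rel_def)
  have "\<forall>\<^sub>\<approx>z\<in>uhp. deriv f z = deriv g z"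
    using eventually_cosparse_uhp_nhds[OF fg(3)]
    by (rule eventually_mono) (rule deriv_cong_ev, auto)
  with fg show "mero_rel (deriv f) (deriv g)"
    by (auto simp: mero_rel_def intro: meromorphic_on_deriv)
qed


section \<open>Meromorphic modular forms\<close>

definition slash :: "int \<Rightarrow> real^2^2 \<Rightarrow> (complex \<Rightarrow> complex) \<Rightarrow> complex \<Rightarrow> complex" where
  "slash k A f z = automorphy A z powi (- k) * f (moebius_action A z)"

definition translation_matrix :: "real \<Rightarrow> real^2^2" where
  "translation_matrix h = vector [vector [1, h], vector [0, 1]]"

text \<open>The cusps of \<open>\<Gamma>\<close> are the points \<open>\<sigma> \<infinity>\<close> fixed by a parabolic element \<open>\<sigma> T\<^sup>h \<sigma>\<inverse>\<close> of \<open>\<Gamma>\<close>;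
  meromorphy there is meromorphy at 0 of the transformed function in the local parameter
  \<open>q = exp (2 \<pi> i z / h)\<close>.\<close>

definition meromorphic_at_cusps :: "(real^2^2) set \<Rightarrow> int \<Rightarrow> (complex \<Rightarrow> complex) \<Rightarrow> bool" where
  "meromorphic_at_cusps \<Gamma> k f \<longleftrightarrow>
     (\<forall>\<sigma> h. det \<sigma> = 1 \<and> h > 0 \<and> \<sigma> ** translation_matrix h ** matrix_inv \<sigma> \<in> \<Gamma> \<longrightarrow>
        (\<exists>F Y. F meromorphic_on {0} \<and> Y > 0 \<and>
           (\<forall>\<^sub>\<approx>z\<in>{z. Im z > Y}. slash k \<sigma> f z = F (exp (2 * of_real pi * \<i> * z / of_real h)))))"

definition meromorphic_modular_form :: "(real^2^2) set \<Rightarrow> int \<Rightarrow> (complex \<Rightarrow> complex) \<Rightarrow> bool" where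
  "meromorphic_modular_form \<Gamma> k f \<longleftrightarrow>
     f meromorphic_on uhp \<and> (\<forall>A\<in>\<Gamma>. \<forall>\<^sub>\<approx>z\<in>uhp. slash k A f z = f z) \<and> meromorphic_at_cusps \<Gamma> k f"

definition modular_forms :: "(real^2^2) set \<Rightarrow> int \<Rightarrow> mero set" where
  "modular_forms \<Gamma> k = mero_of ` {f. meromorphic_modular_form \<Gamma> k f}"


section \<open>Differential closure and decomposable forms\<close>

definition constants :: "mero set" where
  "constants = range (\<lambda>c. c *\<^sub>m 1)"

definition subring_mero :: "mero set \<Rightarrow> bool" where
  "subring_mero R \<longleftrightarrow> 1 \<in> R \<and> (\<forall>f\<in>R. \<forall>g\<in>R. f - g \<in> R \<and> f * g \<in> R)"

definition generated_algebra :: "mero set \<Rightarrow> mero set" where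
  "generated_algebra S = (\<lambda>R. subring_mero R \<and> constants \<subseteq> R) hull S"

definition finitely_generated_algebra :: "mero set \<Rightarrow> bool" where
  "finitely_generated_algebra R \<longleftrightarrow> (\<exists>S. finite S \<and> R = generated_algebra S)"

definition differential_closure :: "mero set \<Rightarrow> mero set" where
  "differential_closure M = (\<lambda>R. subring_mero R \<and> D_mero ` R \<subseteq> R) hull M"

definition weight_part :: "(real^2^2) set \<Rightarrow> mero set \<Rightarrow> int \<Rightarrow> mero set" where
  "weight_part \<Gamma> M k = M \<inter> modular_forms \<Gamma> k"

text \<open>The grading of the differential closure is the one generated by that of \<open>M\<close> and the rule
  that \<open>D\<close> raises the weight by 2. Each weight part is a subspace, since the constants belong
  to weight 0.\<close>

inductive closure_homogeneous :: "(real^2^2) set \<Rightarrow> mero set \<Rightarrow> int \<Rightarrow> mero \<Rightarrow> bool" for \<Gamma> M where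
  base: "f \<in> weight_part \<Gamma> M k \<Longrightarrow> closure_homogeneous \<Gamma> M k f"
| add: "closure_homogeneous \<Gamma> M k f \<Longrightarrow> closure_homogeneous \<Gamma> M k g \<Longrightarrow>
    closure_homogeneous \<Gamma> M k (f + g)"
| mult: "closure_homogeneous \<Gamma> M k f \<Longrightarrow> closure_homogeneous \<Gamma> M l g \<Longrightarrow>
    closure_homogeneous \<Gamma> M (k + l) (f * g)"
| D: "closure_homogeneous \<Gamma> M k f \<Longrightarrow> closure_homogeneous \<Gamma> M (k + 2) (D_mero f)"

definition closure_weight_part :: "(real^2^2) set \<Rightarrow> mero set \<Rightarrow> int \<Rightarrow> mero set" where
  "closure_weight_part \<Gamma> M k = {f. closure_homogeneous \<Gamma> M k f}"

definition positive_ideal :: "(real^2^2) set \<Rightarrow> mero set \<Rightarrow> mero set" where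
  "positive_ideal \<Gamma> M = mero.span (\<Union>k\<in>{0<..}. weight_part \<Gamma> M k)"

definition closure_positive_ideal :: "(real^2^2) set \<Rightarrow> mero set \<Rightarrow> mero set" where
  "closure_positive_ideal \<Gamma> M = mero.span (\<Union>k\<in>{0<..}. closure_weight_part \<Gamma> M k)"

definition ideal_square :: "mero set \<Rightarrow> mero set" where
  "ideal_square J = mero.span {f * g | f g. f \<in> J \<and> g \<in> J}"


section \<open>Bases and dimension of quotient spaces\<close>

text \<open>The following notions describe finite families of classes \<open>b i + W\<close> in a quotient of
  vector spaces by \<open>W\<close>.\<close>

definition independent_modulo :: "mero set \<Rightarrow> 'i set \<Rightarrow> ('i \<Rightarrow> mero) \<Rightarrow> bool" where
  "independent_modulo W I b \<longleftrightarrow> (\<forall>c. (\<Sum>i\<in>I. c i *\<^sub>m b i) \<in> W \<longrightarrow> (\<forall>i\<in>I. c i = 0))"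

definition quotient_basis :: "mero set \<Rightarrow> mero set \<Rightarrow> 'i set \<Rightarrow> ('i \<Rightarrow> mero) \<Rightarrow> bool" where
  "quotient_basis V W I b \<longleftrightarrow> finite I \<and> b ` I \<subseteq> V \<and> independent_modulo W I b \<and>
     (\<forall>v\<in>V. \<exists>c. v - (\<Sum>i\<in>I. c i *\<^sub>m b i) \<in> W)"

text \<open>As for the library's \<^const>\<open>mero.dim\<close>, the value is 0 if there is no finite basis.\<close>

definition quotient_dim :: "mero set \<Rightarrow> mero set \<Rightarrow> nat" where
  "quotient_dim V W =
     (if \<exists>n b. quotient_basis V W {..<n::nat} b then SOME n. \<exists>b. quotient_basis V W {..<n} b else 0)"

end

theory Submission
  imports Defs
begin

text \<open>The elements of the differential closure are quasimodular. If \<open>f\<close> has weight \<open>k\<close> and \<open>A \<in> \<Gamma>\<close> has the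
  bottom row \<open>(c, d)\<close>, then \<open>f (A z)\<close> is a homogeneous polynomial \<open>\<Sum>s. G\<^sub>s(z) c\<^sup>s d\<^sup>k\<^sup>-\<^sup>s\<close> of degree \<open>k\<close> in
  \<open>c\<close> and \<open>d\<close> with meromorphic coefficients: for \<open>f\<close> in the ring itself it is \<open>(c z + d)\<^sup>k f(z)\<close>, products
  of functions give products of polynomials, and by the chain rule \<open>D\<close> acts on polynomials as
  \<open>G \<mapsto> (c z + d)\<^sup>2 \<partial>G/\<partial>z\<close>.

  The bottom rows of a lattice are Zariski dense in the plane (\<open>bottom_rows_Zariski_dense\<close>), so \<open>f\<close>
  determines its polynomial. This has two consequences. The grading by weight is direct
  (\<open>transforms_sum_zero\<close>), and there is a well-defined derivation \<open>\<delta> f = G\<^sub>1 - k z G\<^sub>0\<close> of weight \<open>-2\<close>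
  (\<open>lowering\<close>). It kills modular forms and satisfies \<open>\<delta> D - D \<delta> = k\<close> in weight \<open>k\<close>; this is the action
  of the lowering operator of \<open>sl\<^sub>2\<close>. It maps the differential closure to itself, and it
  maps \<open>J\<^sup>2\<close> to itself because it kills everything of weight 2.

  Modulo \<open>J\<^sup>2\<close> the differential closure is spanned in positive weight by the derivatives of
  generators, hence by the derivatives of the \<open>f\<^sub>i\<close> (\<open>derivatives_span\<close>). For \<open>f\<close> modular of weight \<open>l\<close>,
  \<open>\<delta> D\<^sup>n f = n (l + n - 1) D\<^sup>n\<^sup>-\<^sup>1 f\<close>, and the factor vanishes only for \<open>n = 0\<close>: every \<open>f\<^sub>i\<close> generates a free
  lowest weight module. Applying \<open>\<delta>\<close> to a linear relation modulo \<open>J\<^sup>2\<close> therefore gives a relation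
  of weight lower by 2 that loses only the terms \<open>f\<^sub>i\<close> themselves, and those are independent modulo \<open>J\<^sup>2\<close>
  by hypothesis (\<open>derivatives_independent\<close>). Finite generation would make \<open>J/J\<^sup>2\<close> finite-dimensional,
  while a nonzero \<open>f\<^sub>i\<close> has an independent sequence of derivatives; and \<open>J = J\<^sup>2\<close> is impossible, since a
  nonzero form of least positive weight is not decomposable.

  The density of the bottom rows is where finite covolume enters, through one recurrence
  statement: a set of infinite area meets infinitely many of its translates
  (\<open>finite_covolume_returns\<close>). Together with the finiteness of bounded subsets of a discrete group it
  excludes groups of translations and groups preserving a geodesic, and it makes \<open>\<Gamma>\<close> infinite. Trace
  computations then give a hyperbolic element (\<open>exists_hyperbolic\<close>). In its eigenbasis a polynomial
  that vanishes on an orbit of row vectors vanishes on the hyperbola \<open>x y = const\<close> through each of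
  them, and infinitely many such hyperbolas occur (\<open>infinite_hyperbolic_invariant\<close>).\<close>

text \<open>Matrix entries and coefficients of power series share the infix dollar sign; only the former
  occur below.\<close>

no_notation fps_nth (infixl "$" 75)

section \<open>Hyperbolic area and recurrence\<close>

text \<open>The change of variables formula is about Jacobian matrices, hence about \<open>real^2\<close>,
  while hyperbolic area is an integral over the complex plane; \<open>plane\<close> and
  \<open>coords\<close> pass between the two.\<close>

definition plane :: "real^2 \<Rightarrow> complex" where
  "plane v = Complex (v $ 1) (v $ 2)"

definition coords :: "complex \<Rightarrow> real^2" where
  "coords z = vector [Re z, Im z]"

lemma plane_coords [simp]: "plane (coords z) = z"
  by (simp add: plane_def coords_def)

lemma coords_plane [simp]: "coords (plane v) = v"
  by (simp add: plane_def coords_def vec_eq_iff forall_2)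

lemma linear_plane: "linear plane"
  by (auto intro!: linearI simp: plane_def complex_eq_iff)

lemma linear_coords: "linear coords"
  by (auto intro!: linearI simp: coords_def vec_eq_iff forall_2)

lemma continuous_on_plane [continuous_intros]: "continuous_on A plane"
  by (simp add: linear_plane linear_continuous_on linear_linear)

lemma plane_measurable [measurable]: "plane \<in> borel_measurable borel"
  by (intro borel_measurable_continuous_onI continuous_intros)

lemma lborel_distr_plane: "distr lborel borel plane = lborel"
proof (rule lborel_eqI[symmetric])
  fix l u :: complex assume le: "\<And>b. b \<in> Basis \<Longrightarrow> l \<bullet> b \<le> u \<bullet> b"
  have lu: "Re l \<le> Re u" "Im l \<le> Im u"
    using le[of 1] le[of \<i>] by (auto simp: Basis_complex_def)
  have "plane -` box l u = box (coords l) (coords u)"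
    by (auto simp: plane_def coords_def in_box_complex_iff mem_box_cart forall_2)
  then have "emeasure (distr lborel borel plane) (box l u) = emeasure lborel (box (coords l) (coords u))"
    by (subst emeasure_distr) auto
  also have "\<dots> = (\<Prod>b\<in>Basis. (coords u - coords l) \<bullet> b)"
  proof (rule emeasure_lborel_box)
    fix b :: "real^2" assume "b \<in> Basis"
    then obtain i where "b = axis i 1" by (auto simp: Basis_vec_def)
    then show "coords l \<bullet> b \<le> coords u \<bullet> b"
      using lu exhaust_2[of i] by (auto simp: coords_def inner_axis)
  qed
  also have "(\<Prod>b\<in>Basis. (coords u - coords l) \<bullet> b) = (\<Prod>i\<in>UNIV. (coords u - coords l) $ i)"
  proof -
    have "(\<Prod>b\<in>Basis. (coords u - coords l) \<bullet> b) = (\<Prod>b\<in>(\<lambda>i. axis i 1)`UNIV. (coords u - coords l) \<bullet> b)"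
      by (rule arg_cong[where f="prod _"]) (auto simp: Basis_vec_def)
    also have "\<dots> = (\<Prod>i\<in>UNIV. (coords u - coords l) $ i)"
      by (subst prod.reindex) (auto simp: inj_on_def axis_eq_axis inner_axis)
    finally show ?thesis .
  qed
  also have "\<dots> = (\<Prod>b\<in>Basis. (u - l) \<bullet> b)"
    by (simp add: UNIV_2 coords_def Basis_complex_def)
  finally show "emeasure (distr lborel borel plane) (box l u) = (\<Prod>b\<in>Basis. (u - l) \<bullet> b)" .
qed simp

lemma det_complex_mult:
  "det (matrix (coords \<circ> (*) w \<circ> plane)) = (norm w)\<^sup>2"
  by (simp add: det_2 matrix_def coords_def plane_def axis_def cmod_power2 flip: power2_eq_square)

text \<open>The Jacobian of a holomorphic map is the square of the absolute value of its derivative.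
  Finiteness of the integral on the source side is what makes the change of variables for absolutely
  integrable functions applicable; it is harmless here, since it is used inside a set of finite
  area.\<close>

theorem nn_integral_injective_holomorphic_image:
  fixes f :: "complex \<Rightarrow> real"
  assumes S: "S \<in> sets borel" and gS: "g ` S \<in> sets borel"
    and f: "f \<in> borel_measurable borel" "\<And>z. f z \<ge> 0"
    and h: "h \<in> borel_measurable borel" "\<And>z. h z \<ge> 0"
    and der: "\<And>z. z \<in> S \<Longrightarrow> (g has_field_derivative g' z) (at z)"
    and inj: "inj_on g S"
    and eq: "\<And>z. z \<in> S \<Longrightarrow> (norm (g' z))\<^sup>2 * f (g z) = h z"
    and fin: "(\<integral>\<^sup>+z. ennreal (h z) * indicator S z \<partial>lborel) < \<infinity>"
  shows "(\<integral>\<^sup>+z. ennreal (f z) * indicator (g ` S) z \<partial>lborel)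
       = (\<integral>\<^sup>+z. ennreal (h z) * indicator S z \<partial>lborel)"
proof -
  define S2 where "S2 = coords ` S"
  define G where "G = coords \<circ> g \<circ> plane"
  define G' where "G' v = coords \<circ> (*) (g' (plane v)) \<circ> plane" for v
  define f2 where "f2 v = (vec (f (plane v)) :: real^1)" for v
  have S2_vimage: "S2 = plane -` S"
    unfolding S2_def by (auto simp: image_iff) (metis coords_plane)
  have GS2: "G ` S2 = plane -` (g ` S)"
    unfolding S2_def G_def by (auto simp: image_iff) (metis coords_plane)
  have S2: "S2 \<in> sets borel"
    unfolding S2_vimage using measurable_sets[OF plane_measurable S] by simp
  have GS2m: "G ` S2 \<in> sets borel"
    unfolding GS2 using measurable_sets[OF plane_measurable gS] by simp
  have pull: "(\<integral>\<^sup>+z. ennreal (k z) * indicator T z \<partial>lborel)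
       = (\<integral>\<^sup>+v. ennreal (k (plane v) * indicator (plane -` T) v) \<partial>lborel)"
    if "k \<in> borel_measurable borel" "T \<in> sets borel" for k T
    using that by (subst lborel_distr_plane[symmetric], subst nn_integral_distr)
      (auto intro!: nn_integral_cong simp: indicator_def)
  have int_h: "integrable lborel (\<lambda>v. h (plane v) * indicator S2 v)"
  proof (rule integrableI_nonneg)
    show "(\<lambda>v. h (plane v) * indicator S2 v) \<in> borel_measurable lborel"
      using S2 h by measurable
    show "(\<integral>\<^sup>+v. ennreal (h (plane v) * indicator S2 v) \<partial>lborel) < \<infinity>"
      using fin pull[OF h(1) S] by (simp add: S2_vimage)
  qed (use h in auto)
  have eqv: "\<bar>det (matrix (G' v))\<bar> *\<^sub>R f2 (G v) = vec (h (plane v))" if "v \<in> S2" for v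
    using that eq[of "plane v"] unfolding S2_vimage G'_def f2_def G_def det_complex_mult
    by (simp add: vec_eq_iff)
  have integrable_vec: "(\<lambda>v. vec (k v) :: real^1) absolutely_integrable_on T \<longleftrightarrow> k absolutely_integrable_on T"
    for k :: "real^2 \<Rightarrow> real" and T
    by (subst absolutely_integrable_componentwise_iff)
       (simp add: Basis_vec_def inner_axis)
  have abs_h: "(\<lambda>v. h (plane v)) absolutely_integrable_on S2"
  proof -
    have "integrable lebesgue (\<lambda>v. h (plane v) * indicator S2 v)"
      using int_h S2 h by (subst integrable_completion) auto
    then show ?thesis
      by (simp add: set_integrable_def mult.commute)
  qed
  have "((\<lambda>x. \<bar>det (matrix (G' x))\<bar> *\<^sub>R f2 (G x)) absolutely_integrable_on S2 \<and>
         integral S2 (\<lambda>x. \<bar>det (matrix (G' x))\<bar> *\<^sub>R f2 (G x)) = b)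
     \<longleftrightarrow> f2 absolutely_integrable_on (G ` S2) \<and> integral (G ` S2) f2 = b" for b
  proof (rule has_absolute_integral_change_of_variables)
    show "S2 \<in> sets lebesgue" using S2 by auto
    show "inj_on G S2"
      using inj unfolding S2_def G_def inj_on_def by (auto) (metis plane_coords)
    fix v assume "v \<in> S2"
    then have "(g has_derivative (*) (g' (plane v))) (at (plane v))"
      using der[of "plane v"] by (auto simp: S2_vimage has_field_derivative_def)
    then have "(G has_derivative G' v) (at v)"
      unfolding G_def G'_def
      by (intro diff_chain_at linear_imp_has_derivative linear_plane linear_coords)
    then show "(G has_derivative G' v) (at v within S2)"
      by (rule has_derivative_at_withinI)
  qed
  note transformed = this[of "integral S2 (\<lambda>x. \<bar>det (matrix (G' x))\<bar> *\<^sub>R f2 (G x))"]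
  have "f2 absolutely_integrable_on (G ` S2) \<and> integral (G ` S2) f2 = integral S2 (\<lambda>v. vec (h (plane v)) :: real^1)"
  proof -
    have "(\<lambda>x. \<bar>det (matrix (G' x))\<bar> *\<^sub>R f2 (G x)) absolutely_integrable_on S2
         \<longleftrightarrow> (\<lambda>v. vec (h (plane v)) :: real^1) absolutely_integrable_on S2"
      by (rule set_integrable_cong) (use eqv in auto)
    moreover have "integral S2 (\<lambda>x. \<bar>det (matrix (G' x))\<bar> *\<^sub>R f2 (G x)) = integral S2 (\<lambda>v. vec (h (plane v)) :: real^1)"
      by (rule integral_cong) (use eqv in auto)
    ultimately show ?thesis
      using transformed abs_h integrable_vec by auto
  qed
  then have f2: "f2 absolutely_integrable_on (G ` S2)" 
    and int: "integral (G ` S2) f2 = integral S2 (\<lambda>v. vec (h (plane v)) :: real^1)"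
    by auto
  have abs_f: "(\<lambda>v. f (plane v)) absolutely_integrable_on (G ` S2)"
    using f2 unfolding f2_def by (simp add: integrable_vec)
  have vec_integral: "integral T (\<lambda>v. vec (k v) :: real^1) $ 1 = integral T k"
    if "k absolutely_integrable_on T" for k :: "real^2 \<Rightarrow> real" and T
  proof -
    have "(\<lambda>v. vec (k v) :: real^1) integrable_on T"
      using that integrable_vec[of T k] set_lebesgue_integral_eq_integral(1) by blast
    from integral_linear[OF this, of "\<lambda>x. vec_nth x 1"] show ?thesis
      by (simp add: bounded_linear_vec_nth o_def)
  qed
  have integrals: "integral (G ` S2) (\<lambda>v. f (plane v)) = integral S2 (\<lambda>v. h (plane v))"
    using int[unfolded f2_def[abs_def]] vec_integral[OF abs_f] vec_integral[OF abs_h] by simp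
  have nn: "(\<integral>\<^sup>+v. ennreal (k v * indicator T v) \<partial>lborel) = ennreal (integral T k)"
    if k: "k absolutely_integrable_on T" "k \<in> borel_measurable borel" "T \<in> sets borel" "\<And>v. k v \<ge> 0"
    for k :: "real^2 \<Rightarrow> real" and T
  proof -
    have "(k has_integral integral T k) T"
      using k(1) set_lebesgue_integral_eq_integral(1) by blast
    then have "((\<lambda>v. k v * indicator T v) has_integral integral T k) UNIV"
      by (subst (asm) has_integral_restrict_UNIV[symmetric]) (simp add: indicator_def of_bool_def if_distrib cong: if_cong)
    then show ?thesis
      using k by (intro nn_integral_has_integral_lborel) auto
  qed
  show ?thesis
    unfolding pull[OF f(1) gS] pull[OF h(1) S] GS2[symmetric] S2_vimage[symmetric]
    using nn[OF abs_f _ GS2m] nn[OF abs_h _ S2] f h integrals by simp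
qed

lemma mat2_mult_nth:
  fixes A B :: "real^2^2"
  shows "(A ** B) $ i $ j = A $ i $ 1 * B $ 1 $ j + A $ i $ 2 * B $ 2 $ j"
  by (simp add: matrix_matrix_mult_def sum_2)

lemma mat2_eq_iff:
  fixes A B :: "real^2^2"
  shows "A = B \<longleftrightarrow> A$1$1 = B$1$1 \<and> A$1$2 = B$1$2 \<and> A$2$1 = B$2$1 \<and> A$2$2 = B$2$2"
  by (simp only: vec_eq_iff forall_2 conj_assoc)

lemma mat2_one_nth [simp]:
  "(mat 1 :: real^2^2) $ 1 $ 1 = 1" "(mat 1 :: real^2^2) $ 1 $ 2 = 0"
  "(mat 1 :: real^2^2) $ 2 $ 1 = 0" "(mat 1 :: real^2^2) $ 2 $ 2 = 1"
  by (simp_all add: mat_def)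

text \<open>For determinant 1 this is the inverse, but it is polynomial in the entries, so the simplifier can
  compute with it.\<close>

definition adjugate :: "real^2^2 \<Rightarrow> real^2^2" where
  "adjugate A = vector [vector [A$2$2, - A$1$2], vector [- A$2$1, A$1$1]]"

lemma adjugate_nth [simp]:
  "adjugate A $ 1 $ 1 = A$2$2" "adjugate A $ 1 $ 2 = - A$1$2"
  "adjugate A $ 2 $ 1 = - A$2$1" "adjugate A $ 2 $ 2 = A$1$1"
  by (simp_all add: adjugate_def)

lemma adjugate_mult: "det A = 1 \<Longrightarrow> adjugate A ** A = mat 1" "det A = 1 \<Longrightarrow> A ** adjugate A = mat 1"
  by (simp_all add: mat2_eq_iff mat2_mult_nth det_2 algebra_simps)

lemma det_adjugate [simp]: "det (adjugate A) = det A"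
  by (simp add: det_2 algebra_simps)

lemma matrix_inv_eq_adjugate:
  assumes "det A = 1"
  shows "matrix_inv A = adjugate A"
proof -
  have "A ** matrix_inv A = mat 1 \<and> matrix_inv A ** A = mat 1"
    unfolding matrix_inv_def by (rule someI_ex) (use adjugate_mult[OF assms] in blast)
  then show ?thesis
    using adjugate_mult(1)[OF assms] by (metis matrix_mul_assoc matrix_mul_lid matrix_mul_rid)
qed

lemma automorphy_nonzero:
  assumes "det A = 1" "z \<in> uhp" shows "automorphy A z \<noteq> 0"
proof
  assume *: "automorphy A z = 0"
  then have "A$2$1 * Im z = 0" by (simp add: automorphy_def complex_eq_iff)
  with assms(2) have "A$2$1 = 0" by (simp add: uhp_def)
  moreover from this * have "A$2$2 = 0" by (simp add: automorphy_def)
  ultimately show False using assms(1) by (simp add: det_2)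
qed

lemma Im_moebius_action:
  assumes "det A = 1"
  shows "Im (moebius_action A z) = Im z / (norm (automorphy A z))\<^sup>2"
proof -
  have "Im (moebius_action A z) = det A * Im z / (norm (automorphy A z))\<^sup>2"
    by (simp add: moebius_action_def automorphy_def Im_divide cmod_power2 det_2 algebra_simps)
  then show ?thesis using assms by simp
qed

lemma moebius_action_in_uhp [intro]:
  assumes "det A = 1" "z \<in> uhp" shows "moebius_action A z \<in> uhp"
  using assms automorphy_nonzero[OF assms] by (simp add: uhp_def Im_moebius_action)

lemma automorphy_mult:
  assumes "det B = 1" "z \<in> uhp"
  shows "automorphy (A ** B) z = automorphy A (moebius_action B z) * automorphy B z"
proof -
  have "of_real (B$2$1) * z + of_real (B$2$2) \<noteq> 0"
    using automorphy_nonzero[OF assms] by (simp add: automorphy_def)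
  then show ?thesis
    by (simp add: automorphy_def moebius_action_def mat2_mult_nth divide_simps) (simp add: algebra_simps)
qed

lemma moebius_action_mult:
  assumes "det A = 1" "det B = 1" "z \<in> uhp"
  shows "moebius_action (A ** B) z = moebius_action A (moebius_action B z)"
proof -
  define w where "w = moebius_action B z"
  have j: "automorphy B z \<noteq> 0" "automorphy A w \<noteq> 0"
    using assms by (auto simp: w_def automorphy_nonzero moebius_action_in_uhp)
  have w: "w * automorphy B z = of_real (B$1$1) * z + of_real (B$1$2)"
    using j by (simp add: w_def moebius_action_def automorphy_def)
  have num: "of_real ((A ** B)$1$1) * z + of_real ((A ** B)$1$2)
     = (of_real (A$1$1) * w + of_real (A$1$2)) * automorphy B z"
    unfolding distrib_right mult.assoc w
    by (simp add: automorphy_def mat2_mult_nth algebra_simps)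
  have "moebius_action (A ** B) z = (of_real ((A ** B)$1$1) * z + of_real ((A ** B)$1$2)) / automorphy (A ** B) z"
    by (simp add: moebius_action_def automorphy_def)
  also have "\<dots> = (of_real (A$1$1) * w + of_real (A$1$2)) / automorphy A w"
    unfolding num automorphy_mult[OF assms(2,3)] w_def[symmetric] using j by simp
  finally show ?thesis by (simp add: moebius_action_def automorphy_def w_def)
qed

lemma moebius_action_one [simp]: "moebius_action (mat 1) z = z"
  by (simp add: moebius_action_def)

lemma moebius_action_adjugate:
  assumes "det A = 1" "z \<in> uhp"
  shows "moebius_action (adjugate A) (moebius_action A z) = z"
    and "moebius_action A (moebius_action (adjugate A) z) = z"
  using assms by (simp_all flip: moebius_action_mult add: adjugate_mult)

lemma inj_on_moebius_action: "det A = 1 \<Longrightarrow> inj_on (moebius_action A) uhp"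
  by (metis inj_on_def moebius_action_adjugate(1))

lemma moebius_action_has_field_derivative:
  assumes "det A = 1" "z \<in> uhp"
  shows "(moebius_action A has_field_derivative 1 / (automorphy A z)\<^sup>2) (at z)"
proof -
  have j: "of_real (A$2$1) * z + of_real (A$2$2) \<noteq> 0"
    using automorphy_nonzero[OF assms] by (simp add: automorphy_def)
  have "of_real (A$1$1 * A$2$2 - A$1$2 * A$2$1) = (1::complex)"
    using assms(1) by (simp add: det_2)
  then have d: "of_real (A$1$1) * of_real (A$2$2) = 1 + of_real (A$1$2) * of_real (A$2$1) + (0::complex)"
    by (simp add: algebra_simps)
  let ?a = "of_real (A$1$1) :: complex" and ?b = "of_real (A$1$2) :: complex"
    and ?c = "of_real (A$2$1) :: complex" and ?d = "of_real (A$2$2) :: complex"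
  have num: "?a * (?c * z + ?d) - (?a * z + ?b) * ?c = 1"
    using d by (simp add: algebra_simps)
  have "((\<lambda>z. (?a * z + ?b) / (?c * z + ?d)) has_field_derivative
      (?a * (?c * z + ?d) - (?a * z + ?b) * ?c) / ((?c * z + ?d) * (?c * z + ?d))) (at z)"
    by (rule DERIV_divide) (use j in \<open>auto intro!: derivative_eq_intros\<close>)
  then show ?thesis
    unfolding num by (simp add: moebius_action_def[abs_def] automorphy_def power2_eq_square)
qed

lemma moebius_action_holomorphic: "det A = 1 \<Longrightarrow> moebius_action A holomorphic_on uhp"
  unfolding holomorphic_on_open[OF open_uhp] using moebius_action_has_field_derivative by blast

lemma moebius_image_eq_vimage:
  assumes "det A = 1" "E \<subseteq> uhp"
  shows "moebius_action A ` E = uhp \<inter> moebius_action (adjugate A) -` E"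
proof (intro subset_antisym subsetI)
  fix w assume "w \<in> moebius_action A ` E"
  then obtain z where z: "z \<in> E" "w = moebius_action A z" by blast
  with assms have "z \<in> uhp" by blast
  with z assms show "w \<in> uhp \<inter> moebius_action (adjugate A) -` E"
    by (simp add: moebius_action_adjugate moebius_action_in_uhp)
next
  fix w assume "w \<in> uhp \<inter> moebius_action (adjugate A) -` E"
  then show "w \<in> moebius_action A ` E"
    using assms moebius_action_adjugate(2)[of A w] by (metis IntE imageI vimageE)
qed

lemma moebius_action_measurable [measurable]: "moebius_action A \<in> borel_measurable borel"
  unfolding moebius_action_def[abs_def] by measurable

lemma uhp_borel [measurable]: "uhp \<in> sets borel"
  by (simp add: open_uhp)

lemma moebius_image_borel:
  assumes "det A = 1" "E \<subseteq> uhp" "E \<in> sets borel"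
  shows "moebius_action A ` E \<in> sets borel"
  unfolding moebius_image_eq_vimage[OF assms(1,2)]
  using measurable_sets[OF moebius_action_measurable assms(3), of "adjugate A"] by auto

text \<open>The factor \<open>1 / (Im z)\<^sup>2\<close> of the area element compensates the Jacobian \<open>1
  / \<bar>c z + d\<bar>\<^sup>4\<close> by the formula for the imaginary part of the image.\<close>

lemma hyperbolic_area_moebius_image:
  assumes A: "det A = 1" and E: "E \<subseteq> uhp" "E \<in> sets borel" and fin: "hyperbolic_area E < \<infinity>"
  shows "hyperbolic_area (moebius_action A ` E) = hyperbolic_area E"
  unfolding hyperbolic_area_def
proof (rule nn_integral_injective_holomorphic_image)
  show "(moebius_action A has_field_derivative 1 / (automorphy A z)\<^sup>2) (at z)" if "z \<in> E" for z
    using that E A by (intro moebius_action_has_field_derivative) auto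
  show "(cmod (1 / (automorphy A z)\<^sup>2))\<^sup>2 * (1 / (Im (moebius_action A z))\<^sup>2) = 1 / (Im z)\<^sup>2"
    if "z \<in> E" for z
    using that E A automorphy_nonzero[of A z]
    by (subst Im_moebius_action) (auto simp: norm_divide norm_power field_simps)
  show "inj_on (moebius_action A) E"
    using inj_on_moebius_action[OF A] E inj_on_subset by blast
qed (use assms moebius_image_borel in \<open>auto simp: hyperbolic_area_def\<close>)

text \<open>Along a sequence of distinct elements with a limit, the quotients of consecutive elements tend to
  the identity, which is isolated in the group; so the sequence is eventually constant. Discreteness
  as a subspace thus already implies that there are no accumulation points outside the group.\<close>

lemma discrete_subgroup_bounded_finite:
  assumes "discrete_subgroup_PSL2R \<Gamma>" "bounded X" "X \<subseteq> \<Gamma>"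
  shows "finite X"
proof (rule ccontr)
  assume "infinite X"
  note \<Gamma> = assms(1)[unfolded discrete_subgroup_PSL2R_def]
  obtain x where x: "x islimpt X"
    using bounded_infinite_imp_islimpt[OF order.refl assms(2) \<open>infinite X\<close>] by blast
  obtain f where f: "\<And>n. f n \<in> X" "\<And>n. f n \<noteq> x" "f \<longlonglongrightarrow> x"
    using x unfolding islimpt_sequential by auto
  have lim: "(\<lambda>n. f n $ i $ j) \<longlonglongrightarrow> x $ i $ j" for i j
    by (intro tendsto_vec_nth f(3))
  have det_f: "det (f n) = 1" for n
    using f(1)[of n] assms(3) \<Gamma> by auto
  have "(\<lambda>n. det (f n)) \<longlonglongrightarrow> det x"
    unfolding det_2 by (intro tendsto_intros lim)
  then have det_x: "det x = 1"
    unfolding det_f by (simp add: LIMSEQ_const_iff)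
  \<comment> \<open>quotients of consecutive elements tend to the identity\<close>
  define B where "B n = adjugate (f n) ** f (Suc n)" for n
  have lim_Suc: "(\<lambda>n. f (Suc n) $ i $ j) \<longlonglongrightarrow> x $ i $ j" for i j
    by (rule LIMSEQ_Suc[OF lim])
  have lim_adj: "(\<lambda>n. adjugate (f n) $ i $ j) \<longlonglongrightarrow> adjugate x $ i $ j" for i j
    using exhaust_2[of i] exhaust_2[of j] by (elim disjE) (auto intro!: tendsto_minus lim)
  have entries: "(\<lambda>n. B n $ i $ j) \<longlonglongrightarrow> (adjugate x ** x) $ i $ j" for i j
    unfolding B_def mat2_mult_nth by (intro tendsto_intros lim_adj lim_Suc)
  have "B \<longlonglongrightarrow> mat 1"
    using entries by (intro vec_tendstoI) (simp add: adjugate_mult det_x)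
  moreover have "mat 1 isolated_in \<Gamma>"
    using \<Gamma> unfolding discrete_def by blast
  then obtain e where e: "e > 0" "\<forall>C\<in>\<Gamma>. dist (mat 1) C < e \<longrightarrow> C = mat 1"
    unfolding isolated_in_dist_Ex_iff by blast
  ultimately obtain N where N: "\<forall>n\<ge>N. dist (B n) (mat 1) < e"
    unfolding lim_sequentially by blast
  have B_in: "B n \<in> \<Gamma>" for n
    using \<Gamma> f(1)[of n] f(1)[of "Suc n"] assms(3) det_f[of n] unfolding B_def
    by (metis matrix_inv_eq_adjugate subsetD)
  then have B1: "B n = mat 1" if "n \<ge> N" for n
    using e(2) N that B_in[of n] by (simp add: dist_commute)
  have step: "f (Suc n) = f n" if "n \<ge> N" for n
  proof -
    have "f (Suc n) = f n ** B n"
      unfolding B_def by (simp add: matrix_mul_assoc adjugate_mult det_f)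
    then show ?thesis using B1[OF that] by simp
  qed
  have const: "f n = f N" if "n \<ge> N" for n
    using that by (induction rule: dec_induct) (simp_all add: step)
  have "f \<longlonglongrightarrow> f N"
    using const by (intro tendsto_eventually) (unfold eventually_sequentially, blast)
  then show False
    using f LIMSEQ_unique by blast
qed

lemma discrete_subgroup_countable:
  assumes "discrete_subgroup_PSL2R \<Gamma>" shows "countable \<Gamma>"
proof -
  have union: "\<Gamma> = (\<Union>n. \<Gamma> \<inter> cball 0 (real n))"
  proof (intro subset_antisym subsetI)
    fix A assume "A \<in> \<Gamma>"
    moreover obtain n where "norm A \<le> real n" using real_arch_simple by blast
    ultimately show "A \<in> (\<Union>n. \<Gamma> \<inter> cball 0 (real n))" by auto
  qed blast
  have "countable (\<Union>n. \<Gamma> \<inter> cball 0 (real n))"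
    by (rule countable_UN[OF countableI_type])
       (intro countable_finite discrete_subgroup_bounded_finite[OF assms], auto)
  then show ?thesis by (subst union)
qed

text \<open>If only \<open>N\<close> elements of the group moved \<open>E\<close> to a set that meets
  \<open>E\<close>, an orbit would visit \<open>E\<close> at most \<open>N\<close> times. Unfolding
  \<open>E\<close> along the translates of a fundamental domain \<open>F\<close> and moving the
  pieces back to \<open>F\<close> would bound the area of \<open>E\<close> by \<open>N\<close> times
  that of \<open>F\<close>.\<close>

lemma finite_covolume_returns:
  assumes \<Gamma>: "discrete_subgroup_PSL2R \<Gamma>" and cov: "finite_covolume \<Gamma>"
    and E: "E \<in> sets borel" "E \<subseteq> uhp" and inf: "hyperbolic_area E = \<infinity>"
  shows "infinite {A\<in>\<Gamma>. moebius_action A ` E \<inter> E \<noteq> {}}"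
proof
  define R where "R = {A\<in>\<Gamma>. moebius_action A ` E \<inter> E \<noteq> {}}"
  assume "finite {A\<in>\<Gamma>. moebius_action A ` E \<inter> E \<noteq> {}}"
  then have fin: "finite R" by (simp add: R_def)
  note G = \<Gamma>[unfolded discrete_subgroup_PSL2R_def]
  have det: "det A = 1" if "A \<in> \<Gamma>" for A using G that by auto
  have adj: "adjugate A \<in> \<Gamma>" if "A \<in> \<Gamma>" for A
    using G that by (metis matrix_inv_eq_adjugate)
  obtain F where F: "F \<in> sets borel" "F \<subseteq> uhp" "(\<Union>A\<in>\<Gamma>. moebius_action A ` F) = uhp"
      "hyperbolic_area F < \<infinity>"
    using cov by (auto simp: finite_covolume_def fundamental_domain_def)
  define w where "w z = ennreal (1 / (Im z)\<^sup>2)" for z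
  have area: "hyperbolic_area T = (\<integral>\<^sup>+z. w z * indicator T z \<partial>lborel)" for T
    by (simp add: hyperbolic_area_def w_def)
  have [measurable]: "w \<in> borel_measurable borel"
    unfolding w_def by measurable
  define T where "T A = F \<inter> moebius_action A -` E" for A
  have T: "T A \<in> sets borel" "T A \<subseteq> F" for A
    using F(1) measurable_sets[OF moebius_action_measurable E(1), of A] by (auto simp: T_def)
  have [measurable]: "T A \<in> sets borel" "moebius_action A ` T A \<in> sets borel" if "A \<in> \<Gamma>" for A
    using T F det[OF that] by (auto intro!: moebius_image_borel)
  have finT: "hyperbolic_area (T A) < \<infinity>" for A
  proof -
    have "hyperbolic_area (T A) \<le> hyperbolic_area F"
      unfolding hyperbolic_area_def using T(2)[of A]
      by (intro nn_integral_mono) (auto simp: indicator_def)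
    from this F(4) show ?thesis by (rule le_less_trans)
  qed
  have image: "hyperbolic_area (moebius_action A ` T A) = hyperbolic_area (T A)" if "A \<in> \<Gamma>" for A
    by (rule hyperbolic_area_moebius_image) (use T F det[OF that] finT in auto)
  have cover: "indicator E z \<le> (\<integral>\<^sup>+A. indicator (moebius_action A ` T A) z \<partial>count_space \<Gamma>)" for z
  proof (cases "z \<in> E")
    case True
    then obtain A where A: "A \<in> \<Gamma>" "z \<in> moebius_action A ` F" using F(3) E(2) by blast
    then have "z \<in> moebius_action A ` T A" using True by (auto simp: T_def)
    then have "(1::ennreal) \<le> indicator (moebius_action A ` T A) z" by simp
    also have "\<dots> \<le> (\<integral>\<^sup>+A. indicator (moebius_action A ` T A) z \<partial>count_space \<Gamma>)"
      by (rule nn_integral_ge_point) (rule A)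
    finally show ?thesis using True by simp
  qed simp
  have few: "(\<integral>\<^sup>+A. indicator (T A) z \<partial>count_space \<Gamma>) \<le> of_nat (card R) * indicator F z" for z
  proof (cases "z \<in> F \<and> (\<exists>B\<in>\<Gamma>. moebius_action B z \<in> E)")
    case True
    then obtain B where B: "B \<in> \<Gamma>" "moebius_action B z \<in> E" and z: "z \<in> F" by auto
    have zu: "z \<in> uhp" using z F by auto
    define Y where "Y = {A\<in>\<Gamma>. moebius_action A z \<in> E}"
    have inj: "inj_on (\<lambda>A. A ** adjugate B) Y"
    proof (rule inj_on_inverseI)
      show "(A ** adjugate B) ** B = A" for A
        using det[OF B(1)] by (simp flip: matrix_mul_assoc add: adjugate_mult)
    qed
    have sub: "(\<lambda>A. A ** adjugate B) ` Y \<subseteq> R"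
    proof safe
      fix A assume "A \<in> Y"
      then have A: "A \<in> \<Gamma>" "moebius_action A z \<in> E" by (auto simp: Y_def)
      have "moebius_action (A ** adjugate B) (moebius_action B z) = moebius_action A z"
        using A B det zu by (simp add: moebius_action_mult moebius_action_adjugate moebius_action_in_uhp)
      with A B have "moebius_action A z \<in> moebius_action (A ** adjugate B) ` E \<inter> E"
        by (metis IntI imageI)
      moreover have "A ** adjugate B \<in> \<Gamma>" using A B adj G by auto
      ultimately show "A ** adjugate B \<in> R" by (auto simp: R_def)
    qed
    have finY: "finite Y" using inj sub fin by (meson finite_imageD finite_subset)
    have "card Y \<le> card R" using inj sub fin by (metis card_image card_mono)
    have "(\<integral>\<^sup>+A. indicator (T A) z \<partial>count_space \<Gamma>) = (\<integral>\<^sup>+A. indicator Y A \<partial>count_space \<Gamma>)"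
      using z by (intro nn_integral_cong) (auto simp: T_def Y_def indicator_def)
    also have "\<dots> = emeasure (count_space \<Gamma>) Y"
      by (rule nn_integral_indicator) (auto simp: Y_def)
    also have "\<dots> = of_nat (card Y)"
      using finY by (subst emeasure_count_space_finite) (auto simp: Y_def)
    also have "\<dots> \<le> of_nat (card R)" using \<open>card Y \<le> card R\<close> by simp
    finally show ?thesis using z by simp
  next
    case False
    then have "(\<integral>\<^sup>+A. indicator (T A) z \<partial>count_space \<Gamma>) = (\<integral>\<^sup>+A. 0 \<partial>count_space \<Gamma>)"
      by (intro nn_integral_cong) (auto simp: T_def indicator_def)
    then show ?thesis by simp
  qed
  have "hyperbolic_area E \<le> (\<integral>\<^sup>+z. w z * (\<integral>\<^sup>+A. indicator (moebius_action A ` T A) z \<partial>count_space \<Gamma>) \<partial>lborel)"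
    unfolding area by (intro nn_integral_mono mult_left_mono cover) auto
  also have "\<dots> = (\<integral>\<^sup>+z. (\<integral>\<^sup>+A. w z * indicator (moebius_action A ` T A) z \<partial>count_space \<Gamma>) \<partial>lborel)"
    by (simp add: nn_integral_cmult)
  also have "\<dots> = (\<integral>\<^sup>+A. hyperbolic_area (moebius_action A ` T A) \<partial>count_space \<Gamma>)"
    unfolding area
    by (rule nn_integral_count_space_nn_integral) (auto intro: discrete_subgroup_countable[OF \<Gamma>])
  also have "\<dots> = (\<integral>\<^sup>+A. hyperbolic_area (T A) \<partial>count_space \<Gamma>)"
    by (intro nn_integral_cong) (simp add: image)
  also have "\<dots> = (\<integral>\<^sup>+z. (\<integral>\<^sup>+A. w z * indicator (T A) z \<partial>count_space \<Gamma>) \<partial>lborel)"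
    unfolding area
    by (rule nn_integral_count_space_nn_integral[symmetric]) (auto intro: discrete_subgroup_countable[OF \<Gamma>])
  also have "\<dots> = (\<integral>\<^sup>+z. w z * (\<integral>\<^sup>+A. indicator (T A) z \<partial>count_space \<Gamma>) \<partial>lborel)"
    by (simp add: nn_integral_cmult)
  also have "\<dots> \<le> (\<integral>\<^sup>+z. w z * (of_nat (card R) * indicator F z) \<partial>lborel)"
    by (intro nn_integral_mono mult_left_mono few) auto
  also have "\<dots> = of_nat (card R) * hyperbolic_area F"
  proof -
    have "w z * (of_nat (card R) * indicator F z) = of_nat (card R) * (w z * indicator F z)" for z
      by (rule mult.left_commute)
    then show ?thesis
      unfolding area using F(1) by (simp only:) (rule nn_integral_cmult, simp)
  qed
  also have "\<dots> < \<infinity>"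
    using F(4) by (simp add: ennreal_mult_less_top of_nat_less_top)
  finally show False using inf by simp
qed

text \<open>Applied with matrices \<open>g\<close> that bring an element of the group into normal form.\<close>

lemma finite_covolume_returns_conjugate:
  assumes \<Gamma>: "discrete_subgroup_PSL2R \<Gamma>" and cov: "finite_covolume \<Gamma>" and g: "det g = 1"
    and E: "E \<in> sets borel" "E \<subseteq> uhp" and inf: "hyperbolic_area E = \<infinity>"
  shows "infinite {A\<in>\<Gamma>. \<exists>z\<in>E. moebius_action (adjugate g ** A ** g) z \<in> E}"
proof -
  define E' where "E' = moebius_action g ` E"
  have E': "E' \<in> sets borel" "E' \<subseteq> uhp"
    using E g by (auto simp: E'_def intro: moebius_image_borel)
  have unmove: "moebius_action (adjugate g) (moebius_action g z) = z" if "z \<in> E" for z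
    using that E g by (intro moebius_action_adjugate) auto
  then have unmove_image: "moebius_action (adjugate g) ` E' = E"
    by (simp add: E'_def image_image)
  have "hyperbolic_area E' = \<infinity>"
  proof (rule ccontr)
    assume "\<not> ?thesis"
    then have "hyperbolic_area E' < \<infinity>" by (simp add: less_top)
    with hyperbolic_area_moebius_image[of "adjugate g" E'] E' g inf unmove_image show False by simp
  qed
  from finite_covolume_returns[OF \<Gamma> cov E' this]
  have "infinite {A\<in>\<Gamma>. moebius_action A ` E' \<inter> E' \<noteq> {}}" .
  moreover have "{A\<in>\<Gamma>. moebius_action A ` E' \<inter> E' \<noteq> {}}
     \<subseteq> {A\<in>\<Gamma>. \<exists>z\<in>E. moebius_action (adjugate g ** A ** g) z \<in> E}"
  proof safe
    fix A v w assume A: "A \<in> \<Gamma>" and w: "w \<in> E'" "moebius_action A w \<in> E'"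
    have dA: "det A = 1" using A \<Gamma> by (auto simp: discrete_subgroup_PSL2R_def)
    from w obtain z where z: "z \<in> E" "w = moebius_action g z" by (auto simp: E'_def)
    have "moebius_action (adjugate g ** A ** g) z = moebius_action (adjugate g) (moebius_action A w)"
    proof -
      have zu: "z \<in> uhp" using z E by blast
      have "moebius_action (adjugate g ** A ** g) z = moebius_action (adjugate g ** A) w"
        unfolding z(2) by (rule moebius_action_mult) (simp_all add: det_mul g dA zu)
      also have "\<dots> = moebius_action (adjugate g) (moebius_action A w)"
        unfolding z(2) by (rule moebius_action_mult) (simp_all add: g dA zu moebius_action_in_uhp)
      finally show ?thesis .
    qed
    also have "\<dots> \<in> E" using w(2) unmove_image by blast
    finally show "\<exists>z\<in>E. moebius_action (adjugate g ** A ** g) z \<in> E" using z by blast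
  qed
  ultimately show ?thesis using finite_subset by blast
qed

text \<open>The area element is not integrable at the real axis: a rectangle at height about \<open>t\<close>
  of width \<open>b - a\<close> and height \<open>t/2\<close> already has area at least \<open>(b -
  a) / (2 t)\<close>.\<close>

lemma hyperbolic_area_infinite:
  assumes ab: "a < b" and h: "h > 0"
    and sub: "\<And>x y. a < x \<Longrightarrow> x < b \<Longrightarrow> 0 < y \<Longrightarrow> y < h \<Longrightarrow> Complex x y \<in> E"
  shows "hyperbolic_area E = \<infinity>"
proof (rule ccontr)
  assume "hyperbolic_area E \<noteq> \<infinity>"
  then obtain r where r: "hyperbolic_area E = ennreal r" "r \<ge> 0"
    by (cases "hyperbolic_area E") auto
  have bound: "(b - a) / (2 * t) \<le> r" if t: "0 < t" "t < h" for t
  proof -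
    define Q where "Q = box (Complex a (t/2)) (Complex b t)"
    have "ennreal ((b - a) / (2 * t)) = ennreal (1 / t\<^sup>2) * ennreal ((b - a) * (t - t/2))"
      using ab t by (subst ennreal_mult[symmetric]) (auto simp: power2_eq_square field_simps)
    also have "\<dots> = ennreal (1 / t\<^sup>2) * emeasure lborel Q"
      unfolding Q_def using ab t by (subst emeasure_lborel_box) (auto simp: Basis_complex_def)
    also have "\<dots> = (\<integral>\<^sup>+z. ennreal (1 / t\<^sup>2) * indicator Q z \<partial>lborel)"
      by (rule nn_integral_cmult_indicator[symmetric]) (simp add: Q_def)
    also have "\<dots> \<le> hyperbolic_area E"
      unfolding hyperbolic_area_def
    proof (rule nn_integral_mono)
      fix z
      show "ennreal (1 / t\<^sup>2) * indicator Q z \<le> ennreal (1 / (Im z)\<^sup>2) * indicator E z"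
      proof (cases "z \<in> Q")
        case True
        then have z: "a < Re z" "Re z < b" "t/2 < Im z" "Im z < t"
          by (auto simp: Q_def in_box_complex_iff)
        then have "z \<in> E" using sub[of "Re z" "Im z"] t by simp
        moreover have "1 / t\<^sup>2 \<le> 1 / (Im z)\<^sup>2"
          using z t by (intro divide_left_mono power_mono) auto
        ultimately show ?thesis using True by (simp add: ennreal_leI)
      qed simp
    qed
    finally show ?thesis using r by (simp add: ennreal_le_iff)
  qed
  \<comment> \<open>a height at which the rectangle has area at least \<open>2 (r + 1)\<close>\<close>
  define t where "t = min (h / 2) ((b - a) / (4 * (r + 1)))"
  have t: "0 < t" "t < h" using ab h r by (auto simp: t_def)
  have "t \<le> (b - a) / (4 * (r + 1))" by (simp add: t_def)
  then have "2 * (r + 1) \<le> (b - a) / (2 * t)" using t r by (simp add: field_simps)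
  with bound[OF t] r show False by simp
qed

section \<open>Discrete groups with the recurrence property\<close>

lemma bounded_mat2I:
  fixes X :: "(real^2^2) set"
  assumes "\<And>A i j. A \<in> X \<Longrightarrow> \<bar>A $ i $ j\<bar> \<le> C"
  shows "bounded X"
proof (rule boundedI)
  fix A assume A: "A \<in> X"
  have "norm A \<le> (\<Sum>i\<in>UNIV. norm (A $ i))"
    by (simp add: norm_vec_def L2_set_le_sum)
  also have "\<dots> \<le> (\<Sum>i\<in>UNIV. \<Sum>j\<in>UNIV. \<bar>A $ i $ j\<bar>)"
    by (intro sum_mono norm_le_l1_cart)
  also have "\<dots> \<le> (\<Sum>i\<in>(UNIV::2 set). \<Sum>j\<in>(UNIV::2 set). C)"
    by (intro sum_mono assms A)
  finally show "norm A \<le> (\<Sum>i\<in>(UNIV::2 set). \<Sum>j\<in>(UNIV::2 set). C)" .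
qed

text \<open>All that is needed about a lattice, in a form that is stable under conjugation, so that a chosen
  element may be assumed to be in normal form.\<close>

locale recurrent_group =
  fixes G :: "(real^2^2) set"
  assumes det_one: "A \<in> G \<Longrightarrow> det A = 1"
    and one_closed: "mat 1 \<in> G"
    and mult_closed: "A \<in> G \<Longrightarrow> B \<in> G \<Longrightarrow> A ** B \<in> G"
    and adjugate_closed: "A \<in> G \<Longrightarrow> adjugate A \<in> G"
    and bounded_finite: "X \<subseteq> G \<Longrightarrow> bounded X \<Longrightarrow> finite X"
    and returns: "E \<in> sets borel \<Longrightarrow> E \<subseteq> uhp \<Longrightarrow> hyperbolic_area E = \<infinity> \<Longrightarrow>
      infinite {A\<in>G. \<exists>z\<in>E. moebius_action A z \<in> E}"
begin

lemma det_one': "A \<in> G \<Longrightarrow> A$1$1 * A$2$2 - A$1$2 * A$2$1 = 1"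
  using det_one[of A] by (simp add: det_2)

text \<open>The form in which recurrence is used: a set of infinite area whose returns are forced to have
  bounded entries cannot exist.\<close>

lemma returns_unbounded:
  assumes "E \<in> sets borel" "E \<subseteq> uhp" "hyperbolic_area E = \<infinity>"
  shows "\<exists>A\<in>G. \<exists>z\<in>E. moebius_action A z \<in> E \<and> (\<exists>i j. \<bar>A $ i $ j\<bar> > C)"
proof (rule ccontr)
  assume "\<not> ?thesis"
  then have "\<bar>A $ i $ j\<bar> \<le> C" if "A \<in> {A\<in>G. \<exists>z\<in>E. moebius_action A z \<in> E}" for A i j
    using that not_le by blast
  then have "bounded {A\<in>G. \<exists>z\<in>E. moebius_action A z \<in> E}"
    by (rule bounded_mat2I)
  then have "finite {A\<in>G. \<exists>z\<in>E. moebius_action A z \<in> E}"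
    by (intro bounded_finite) auto
  with returns[OF assms] show False by simp
qed

lemma infinite: "infinite G"
proof
  assume fin: "finite G"
  have "hyperbolic_area uhp = \<infinity>"
    by (rule hyperbolic_area_infinite[of 0 1 1]) (auto simp: uhp_def)
  from returns[OF uhp_borel order.refl this] fin show False by simp
qed

text \<open>Translations act on the strip \<open>0 \<le> Re z \<le> 1\<close>, which has infinite area near
  the real axis, and only translations by at most 1 bring a point back.\<close>

lemma exists_nontranslation: "\<exists>A\<in>G. \<not> (A$2$1 = 0 \<and> \<bar>A$1$1\<bar> = 1)"
proof (rule ccontr)
  assume "\<not> ?thesis"
  then have tr: "A$2$1 = 0" "\<bar>A$1$1\<bar> = 1" if "A \<in> G" for A using that by auto
  define E where "E = {z. 0 \<le> Re z \<and> Re z \<le> 1} \<inter> uhp"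
  have "{z. 0 \<le> Re z \<and> Re z \<le> 1} \<in> sets borel" by measurable
  then have 1: "E \<in> sets borel" "E \<subseteq> uhp" by (auto simp: E_def)
  have 2: "hyperbolic_area E = \<infinity>"
    by (rule hyperbolic_area_infinite[of 0 1 1]) (auto simp: E_def uhp_def)
  obtain A z i j where A: "A \<in> G" "z \<in> E" "moebius_action A z \<in> E" "\<bar>A $ i $ j\<bar> > 1"
    using returns_unbounded[OF 1 2, of 1] by blast
  have ad: "A$1$1 * A$2$2 = 1" using det_one'[OF A(1)] tr[OF A(1)] by simp
  have a: "A$1$1 = 1 \<or> A$1$1 = -1" using tr[OF A(1)] by linarith
  then have d: "A$2$2 = A$1$1" using ad by auto
  have "Re (moebius_action A z) = Re z + A$1$1 * A$1$2"
    using a d tr[OF A(1)] by (auto simp: moebius_action_def)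
  then have "\<bar>A$1$1 * A$1$2\<bar> \<le> 1" using A(2,3) by (auto simp: E_def)
  then have "\<bar>A$1$2\<bar> \<le> 1" using tr[OF A(1)] by (simp add: abs_mult)
  moreover have "\<bar>A$1$1\<bar> \<le> 1" "\<bar>A$2$2\<bar> \<le> 1" "\<bar>A$2$1\<bar> \<le> 1" using tr[OF A(1)] d by auto
  ultimately show False using A(4) exhaust_2[of i] exhaust_2[of j] by auto
qed

lemma parabolic_power:
  assumes A: "A \<in> G" "A$2$1 = 0" "A$2$2 = A$1$1"
  shows "\<exists>B\<in>G. B$2$1 = 0 \<and> B$1$1 = (A$1$1)^n \<and> B$2$2 = (A$1$1)^n \<and> B$1$2 * A$1$1 = real n * A$1$2 * (A$1$1)^n"
proof (induction n)
  case 0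
  show ?case by (rule bexI[OF _ one_closed]) simp
next
  case (Suc n)
  then obtain B where B: "B \<in> G" "B$2$1 = 0" "B$1$1 = (A$1$1)^n" "B$2$2 = (A$1$1)^n"
     "B$1$2 * A$1$1 = real n * A$1$2 * (A$1$1)^n" by blast
  show ?case
    by (rule bexI[OF _ mult_closed[OF A(1) B(1)]])
       (use A B in \<open>simp add: mat2_mult_nth algebra_simps\<close>)
qed

text \<open>Multiplying \<open>C\<close> by the powers of a translation changes its trace by multiples of the
  lower left entry of \<open>C\<close>. Bounded traces therefore force all elements to be upper
  triangular with eigenvalues \<open>\<plusminus>1\<close>, that is, translations.\<close>

lemma hyperbolic_if_translation:
  assumes A: "A \<in> G" "A$2$1 = 0" "\<bar>A$1$1\<bar> = 1" "A$1$2 \<noteq> 0"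
  shows "\<exists>B\<in>G. \<bar>trace B\<bar> > 2"
proof (rule ccontr)
  assume "\<not> ?thesis"
  then have small: "\<bar>trace B\<bar> \<le> 2" if "B \<in> G" for B using that by force
  have a: "A$1$1 = 1 \<or> A$1$1 = -1" using A(3) by linarith
  have d: "A$2$2 = A$1$1" using det_one'[OF A(1)] A a by auto
  obtain C where C: "C \<in> G" "\<not> (C$2$1 = 0 \<and> \<bar>C$1$1\<bar> = 1)"
    using exists_nontranslation by blast
  have c0: "C$2$1 = 0"
  proof (rule ccontr)
    assume c: "C$2$1 \<noteq> 0"
    define t where "t = \<bar>A$1$2 * C$2$1\<bar>"
    have t: "t > 0" using c A by (simp add: t_def)
    obtain n :: nat where n: "real n * t > 4"
      using reals_Archimedean3[OF t] by blast
    obtain B where B: "B \<in> G" "B$2$1 = 0" "B$1$1 = (A$1$1)^n" "B$2$2 = (A$1$1)^n"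
       "B$1$2 * A$1$1 = real n * A$1$2 * (A$1$1)^n"
      using parabolic_power[OF A(1,2) d, of n] by blast
    have pow: "\<bar>(A$1$1)^n\<bar> = 1" using A(3) by (simp add: power_abs)
    have "trace (B ** C) = (A$1$1)^n * trace C + B$1$2 * C$2$1"
      using B by (simp add: trace_def sum_2 mat2_mult_nth algebra_simps)
    moreover have "\<bar>(A$1$1)^n * trace C\<bar> \<le> 2"
      using small[OF C(1)] pow by (simp add: abs_mult)
    moreover have "\<bar>trace (B ** C)\<bar> \<le> 2" using B C by (intro small mult_closed)
    moreover have "\<bar>B$1$2 * C$2$1\<bar> = real n * t"
    proof -
      have "\<bar>B$1$2\<bar> = \<bar>B$1$2 * A$1$1\<bar>" using A(3) by (simp add: abs_mult)
      also have "\<dots> = real n * \<bar>A$1$2\<bar>" unfolding B(5) using pow by (simp add: abs_mult)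
      finally show ?thesis by (simp add: t_def abs_mult)
    qed
    ultimately show False using n by linarith
  qed
  have ad: "C$1$1 * C$2$2 = 1" using det_one'[OF C(1)] c0 by simp
  have "\<bar>C$1$1 + C$2$2\<bar> \<le> 2" using small[OF C(1)] by (simp add: trace_def sum_2)
  then have "(C$1$1 + C$2$2)\<^sup>2 \<le> 2\<^sup>2" by (metis abs_ge_zero power2_abs power_mono)
  then have "(C$1$1 - C$2$2)\<^sup>2 \<le> 0" using ad by (simp add: power2_eq_square algebra_simps)
  then have "C$1$1 = C$2$2" by simp
  with ad have "C$1$1 * C$1$1 = 1" by simp
  then have "\<bar>C$1$1\<bar> = 1" by (metis abs_1 abs_mult abs_mult_self_eq real_sqrt_abs2 real_sqrt_one)
  with C(2) c0 show False by simp
qed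

text \<open>For a rotation \<open>A\<close> by an angle with sine \<open>s\<close>, the commutator of
  \<open>A\<close> and \<open>C\<close> has trace \<open>2 + s\<^sup>2 (\<bar>C\<bar>\<^sup>2 -
  2)\<close>, where \<open>\<bar>C\<bar>\<^sup>2\<close> is the sum of the squares of the entries.
  If traces are bounded by 2 in absolute value, the group is bounded, hence finite.\<close>

lemma hyperbolic_if_rotation:
  assumes A: "A \<in> G" "A$2$2 = A$1$1" "A$1$2 = - A$2$1" "A$2$1 \<noteq> 0"
  shows "\<exists>B\<in>G. \<bar>trace B\<bar> > 2"
proof (rule ccontr)
  assume "\<not> ?thesis"
  then have small: "\<bar>trace B\<bar> \<le> 2" if "B \<in> G" for B using that by force
  have detA: "(A$1$1)\<^sup>2 + (A$2$1)\<^sup>2 = 1"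
    using det_one'[OF A(1)] A by (simp add: power2_eq_square)
  have entries: "\<bar>C $ i $ j\<bar> \<le> 2" if C: "C \<in> G" for C i j
  proof -
    define N where "N = (C$1$1)\<^sup>2 + (C$1$2)\<^sup>2 + (C$2$1)\<^sup>2 + (C$2$2)\<^sup>2"
    have dC: "C$1$1 * C$2$2 - C$1$2 * C$2$1 = 1" using det_one'[OF C] .
    have "trace (A ** C ** adjugate A ** adjugate C)
      = 2 * (A$1$1)\<^sup>2 * (C$1$1 * C$2$2 - C$1$2 * C$2$1) + (A$2$1)\<^sup>2 * N"
      using A(2,3) by (simp add: trace_def sum_2 mat2_mult_nth N_def power2_eq_square algebra_simps)
    also have "\<dots> = 2 + (A$2$1)\<^sup>2 * (N - 2)"
      unfolding dC using detA by (simp add: algebra_simps)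
    finally have commutator_trace: "trace (A ** C ** adjugate A ** adjugate C) = 2 + (A$2$1)\<^sup>2 * (N - 2)" .
    have mem: "A ** C ** adjugate A ** adjugate C \<in> G"
      by (intro mult_closed adjugate_closed A(1) C)
    have "2 + (A$2$1)\<^sup>2 * (N - 2) \<le> 2"
      using small[OF mem] commutator_trace by linarith
    then have "(A$2$1)\<^sup>2 * (N - 2) \<le> 0" by simp
    then have "N \<le> 2" using A(4) by (simp add: mult_le_0_iff)
    moreover have "(C $ i $ j)\<^sup>2 \<le> N"
      using exhaust_2[of i] exhaust_2[of j] unfolding N_def by auto
    ultimately have "(C $ i $ j)\<^sup>2 \<le> 2\<^sup>2" by simp
    then show ?thesis by (metis abs_le_square_iff abs_numeral)
  qed
  have "finite G" by (rule bounded_finite) (auto intro: bounded_mat2I entries)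
  with infinite show False by simp
qed

lemma diagonal_powers:
  assumes h: "h \<in> G" "h$1$2 = 0" "h$2$1 = 0"
  shows "\<exists>H\<in>G. H$1$1 = (h$1$1)^n \<and> H$2$2 = (h$2$2)^n \<and> H$1$2 = 0 \<and> H$2$1 = 0"
proof (induction n)
  case 0
  show ?case by (rule bexI[OF _ one_closed]) simp
next
  case (Suc n)
  then obtain H where "H \<in> G" "H$1$1 = (h$1$1)^n" "H$2$2 = (h$2$2)^n" "H$1$2 = 0" "H$2$1 = 0"
    by blast
  then show ?case
    by (intro bexI[of _ "h ** H"] mult_closed h) (use h in \<open>simp_all add: mat2_mult_nth\<close>)
qed

text \<open>Conjugation by powers of a diagonal element contracts the off-diagonal entry of a triangular
  element to 0 and keeps the diagonal. If that entry did not vanish, this would give infinitely many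
  elements in a bounded set.\<close>

lemma triangular_diagonal_contracting:
  fixes i j :: 2
  assumes h: "h \<in> G" "h$1$2 = 0" "h$2$1 = 0" and small: "\<bar>h$i$i\<bar> < 1"
    and ij: "i \<noteq> j" and A: "A \<in> G" "A$j$i = 0"
  shows "A$i$j = 0"
proof (rule ccontr)
  assume c: "A$i$j \<noteq> 0"
  define k where "k = h$i$i"
  have cases: "(i = 1 \<and> j = 2) \<or> (i = 2 \<and> j = 1)"
    using ij exhaust_2[of i] exhaust_2[of j] by auto
  have k: "\<bar>k\<bar> < 1" "k \<noteq> 0"
    using small det_one'[OF h(1)] h cases by (auto simp: k_def)
  have "\<exists>B\<in>G. B$i$i = A$i$i \<and> B$j$i = 0 \<and> B$i$j = A$i$j * (k ^ n)\<^sup>2 \<and> B$j$j = A$j$j" for n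
  proof -
    obtain H where H: "H \<in> G" "H$1$1 = (h$1$1)^n" "H$2$2 = (h$2$2)^n" "H$1$2 = 0" "H$2$1 = 0"
      using diagonal_powers[OF h, of n] by blast
    have one: "(h$1$1)^n * (h$2$2)^n = 1"
      using det_one'[OF h(1)] h by (simp flip: power_mult_distrib)
    then have one': "(h$1$1)^n * ((h$2$2)^n * t) = t" for t
      by (metis mult.assoc mult_1)
    show ?thesis
      using H A cases one one'
      by (intro bexI[of _ "H ** A ** adjugate H"] mult_closed adjugate_closed)
         (auto simp: mat2_mult_nth k_def power2_eq_square mult.commute mult.left_commute)
  qed
  then obtain B where B: "\<And>n. B n \<in> G" "\<And>n. B n$i$i = A$i$i" "\<And>n. B n$j$i = 0"
     "\<And>n. B n$i$j = A$i$j * (k ^ n)\<^sup>2" "\<And>n. B n$j$j = A$j$j"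
    by metis
  have "inj B"
  proof (rule injI)
    fix m n assume "B m = B n"
    then have "\<bar>k ^ m\<bar> = \<bar>k ^ n\<bar>"
      using B(4)[of m] B(4)[of n] c by (auto simp: power2_eq_iff abs_eq_iff)
    then show "m = n"
      using k by (simp add: power_abs power_inject_exp')
  qed
  then have "infinite (range B)" by (simp add: finite_image_iff)
  moreover have "bounded (range B)"
  proof (rule bounded_mat2I)
    fix X r s assume "X \<in> range B"
    then obtain n where X: "X = B n" by blast
    have "\<bar>k ^ n\<bar>\<^sup>2 \<le> 1"
      using k by (simp add: power_abs power_le_one)
    then have "\<bar>A$i$j * (k ^ n)\<^sup>2\<bar> \<le> \<bar>A$i$j\<bar>"
      by (simp add: abs_mult mult_left_le)
    then show "\<bar>X $ r $ s\<bar> \<le> \<bar>A$i$i\<bar> + \<bar>A$i$j\<bar> + \<bar>A$j$j\<bar>"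
      using exhaust_2[of r] exhaust_2[of s] cases X B(2-5)[of n] by auto
  qed
  ultimately show False using bounded_finite B(1) by blast
qed

lemma triangular_diagonal:
  assumes h: "h \<in> G" "h$1$2 = 0" "h$2$1 = 0" and hyp: "\<bar>h$1$1\<bar> \<noteq> 1"
    and A: "A \<in> G"
  shows "A$1$2 = 0 \<longleftrightarrow> A$2$1 = 0"
proof -
  have one: "\<bar>h$1$1\<bar> * \<bar>h$2$2\<bar> = 1"
    using det_one'[OF h(1)] h by (simp flip: abs_mult)
  have small: "\<bar>h$1$1\<bar> < 1 \<or> \<bar>h$2$2\<bar> < 1"
  proof (rule ccontr)
    assume "\<not> ?thesis"
    then have "1 < \<bar>h$1$1\<bar>" "1 \<le> \<bar>h$2$2\<bar>" using hyp by auto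
    then have "1 * 1 < \<bar>h$1$1\<bar> * \<bar>h$2$2\<bar>" by (intro mult_less_le_imp_less) auto
    with one show False by simp
  qed
  note h' = adjugate_closed[OF h(1)]
  have "A$i$j = 0" if "A$j$i = 0" "i \<noteq> j" for i j :: 2
  proof -
    have "\<bar>h$i$i\<bar> < 1 \<or> \<bar>adjugate h$i$i\<bar> < 1"
      using small exhaust_2[of i] by auto
    then show ?thesis
      using triangular_diagonal_contracting[OF h _ that(2) A that(1)]
        triangular_diagonal_contracting[OF h' _ _ _ that(2) A that(1)] h by auto
  qed
  then show ?thesis by (metis zero_neq_one)
qed

text \<open>Diagonal and antidiagonal matrices act on absolute values by \<open>r \<mapsto> a\<^sup>2
  r\<close> and \<open>r \<mapsto> b\<^sup>2 / r\<close>. The half annulus \<open>1 \<le>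
  \<bar>z\<bar> \<le> 2\<close> has infinite area, and its returns bound the entries.\<close>

lemma exists_not_monomial:
  "\<exists>A\<in>G. \<not> (A$1$2 = 0 \<and> A$2$1 = 0) \<and> \<not> (A$1$1 = 0 \<and> A$2$2 = 0)"
proof (rule ccontr)
  assume "\<not> ?thesis"
  then have mono: "(A$1$2 = 0 \<and> A$2$1 = 0) \<or> (A$1$1 = 0 \<and> A$2$2 = 0)" if "A \<in> G" for A
    using that by blast
  define E where "E = {z. 1 \<le> norm z \<and> norm z \<le> 2} \<inter> uhp"
  have "{z::complex. 1 \<le> norm z \<and> norm z \<le> 2} \<in> sets borel" by measurable
  then have 1: "E \<in> sets borel" "E \<subseteq> uhp" by (auto simp: E_def)
  have 2: "hyperbolic_area E = \<infinity>"
  proof (rule hyperbolic_area_infinite[of "6/5" "3/2" 1])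
    fix x y :: real assume *: "6/5 < x" "x < 3/2" "0 < y" "y < 1"
    have "1\<^sup>2 \<le> x\<^sup>2" "x\<^sup>2 \<le> (3/2)\<^sup>2" "y\<^sup>2 \<le> 1\<^sup>2" using * by (intro power_mono; simp)+
    moreover have "0 \<le> y\<^sup>2" "(3/2)\<^sup>2 = (9/4::real)" by (simp_all add: power2_eq_square)
    ultimately have "1 \<le> x\<^sup>2 + y\<^sup>2" "x\<^sup>2 + y\<^sup>2 \<le> 4" unfolding one_power2 by linarith+
    then have "1 \<le> sqrt (x\<^sup>2 + y\<^sup>2)" "sqrt (x\<^sup>2 + y\<^sup>2) \<le> 2"
      by (simp_all add: real_le_lsqrt)
    then show "Complex x y \<in> E" using * by (simp add: E_def uhp_def cmod_def)
  qed auto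
  obtain A z i j where A: "A \<in> G" "z \<in> E" "moebius_action A z \<in> E" "\<bar>A $ i $ j\<bar> > 2"
    using returns_unbounded[OF 1 2, of 2] by blast
  have z: "1 \<le> norm z" "norm z \<le> 2" "1 \<le> norm (moebius_action A z)" "norm (moebius_action A z) \<le> 2"
    using A by (auto simp: E_def)
  have bound: "\<bar>r\<bar> \<le> 2 \<and> \<bar>s\<bar> \<le> 2" if "\<bar>r\<bar> * \<bar>s\<bar> = 1" "\<bar>r\<bar> * u = \<bar>s\<bar> * v" "1 \<le> u" "u \<le> 2" "1 \<le> v" "v \<le> 2"
    for r s u v :: real
  proof -
    have "\<bar>r\<bar>\<^sup>2 * u = \<bar>r\<bar> * (\<bar>r\<bar> * u)" by (simp add: power2_eq_square)
    also have "\<dots> = (\<bar>r\<bar> * \<bar>s\<bar>) * v" unfolding that(2) by simp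
    finally have r: "\<bar>r\<bar>\<^sup>2 * u = v" using that(1) by simp
    have "\<bar>s\<bar>\<^sup>2 * v = \<bar>s\<bar> * (\<bar>s\<bar> * v)" by (simp add: power2_eq_square)
    also have "\<dots> = (\<bar>r\<bar> * \<bar>s\<bar>) * u" unfolding that(2)[symmetric] by simp
    finally have s: "\<bar>s\<bar>\<^sup>2 * v = u" using that(1) by simp
    have "\<bar>r\<bar>\<^sup>2 * 1 \<le> \<bar>r\<bar>\<^sup>2 * u" "\<bar>s\<bar>\<^sup>2 * 1 \<le> \<bar>s\<bar>\<^sup>2 * v"
      using that by (intro mult_left_mono; simp)+
    then have "\<bar>r\<bar>\<^sup>2 \<le> 2\<^sup>2" "\<bar>s\<bar>\<^sup>2 \<le> 2\<^sup>2" unfolding r s using that by simp_all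
    then show ?thesis using power2_le_imp_le[of "\<bar>r\<bar>" 2] power2_le_imp_le[of "\<bar>s\<bar>" 2] by simp
  qed
  from mono[OF A(1)] show False
  proof
    assume d: "A$1$2 = 0 \<and> A$2$1 = 0"
    then have one: "A$1$1 * A$2$2 = 1" using det_one'[OF A(1)] by simp
    have "norm (moebius_action A z) = \<bar>A$1$1\<bar> * norm z / \<bar>A$2$2\<bar>"
      using d by (simp add: moebius_action_def norm_divide norm_mult)
    then have "\<bar>A$1$1\<bar> * norm z = \<bar>A$2$2\<bar> * norm (moebius_action A z)"
      using one by auto
    with bound[OF _ this z] one have "\<bar>A$1$1\<bar> \<le> 2 \<and> \<bar>A$2$2\<bar> \<le> 2" by (simp flip: abs_mult)
    then show False using A(4) d exhaust_2[of i] exhaust_2[of j] by auto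
  next
    assume d: "A$1$1 = 0 \<and> A$2$2 = 0"
    then have one: "- (A$1$2 * A$2$1) = 1" using det_one'[OF A(1)] by simp
    then have "\<bar>- (A$1$2 * A$2$1)\<bar> = 1" by simp
    then have one': "\<bar>A$1$2\<bar> * \<bar>A$2$1\<bar> = 1" unfolding abs_minus abs_mult .
    have nz: "A$2$1 \<noteq> 0" "z \<noteq> 0" using one z by auto
    have nm: "norm (moebius_action A z) = \<bar>A$1$2\<bar> / (\<bar>A$2$1\<bar> * norm z)"
      using d by (simp add: moebius_action_def norm_divide norm_mult)
    have sq: "\<bar>A$1$2\<bar>\<^sup>2 = norm (moebius_action A z) * norm z"
    proof -
      have "norm (moebius_action A z) * norm z = \<bar>A$1$2\<bar> / \<bar>A$2$1\<bar>"
        unfolding nm using nz by simp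
      also have "\<dots> = \<bar>A$1$2\<bar> * (\<bar>A$1$2\<bar> * \<bar>A$2$1\<bar>) / \<bar>A$2$1\<bar>"
        unfolding one' by simp
      also have "\<dots> = \<bar>A$1$2\<bar>\<^sup>2" using nz by (simp add: power2_eq_square)
      finally show ?thesis by (rule sym)
    qed
    also have "norm (moebius_action A z) * norm z \<le> 2 * 2" using z by (intro mult_mono) auto
    finally have "\<bar>A$1$2\<bar>\<^sup>2 \<le> 2\<^sup>2" by simp
    then have b: "\<bar>A$1$2\<bar> \<le> 2" by (rule power2_le_imp_le) simp
    have "1 * 1 \<le> norm (moebius_action A z) * norm z" using z by (intro mult_mono) auto
    then have "1\<^sup>2 \<le> \<bar>A$1$2\<bar>\<^sup>2" unfolding sq by simp
    then have "1 \<le> \<bar>A$1$2\<bar>" by (rule power2_le_imp_le) simp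
    then have "1 * \<bar>A$2$1\<bar> \<le> \<bar>A$1$2\<bar> * \<bar>A$2$1\<bar>" by (rule mult_right_mono) simp
    then have "\<bar>A$2$1\<bar> \<le> 1" using one' by simp
    then show False using A(4) d b exhaust_2[of i] exhaust_2[of j] by auto
  qed
qed

text \<open>The product of the coordinates is invariant under the diagonal element \<open>h\<close>, so its
  values on the orbit of \<open>(p, q)\<close> label hyperbolas. On \<open>(p, q) h\<^sup>n
  A\<close> it is a Laurent polynomial in \<open>t = k\<^sup>2\<^sup>n\<close>, where
  \<open>k\<close> is an eigenvalue of \<open>h\<close>; with finitely many values it would be
  constant in \<open>t\<close>. The vanishing of its extreme coefficients for all \<open>A\<close>
  makes the group monomial.\<close>

lemma infinite_hyperbolic_invariant:
  assumes h: "h \<in> G" "h$1$2 = 0" "h$2$1 = 0" and hyp: "\<bar>h$1$1\<bar> \<noteq> 1"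
    and v: "p \<noteq> 0 \<or> q \<noteq> 0"
  shows "infinite ((\<lambda>A. (p * A$1$1 + q * A$2$1) * (p * A$1$2 + q * A$2$2)) ` G)"
    (is "infinite (?w ` G)")
proof
  assume fin: "finite (?w ` G)"
  define k where "k = h$1$1"
  have kk: "k * h$2$2 = 1" using det_one'[OF h(1)] h by (simp add: k_def)
  then have k0: "k \<noteq> 0" by auto
  have "k\<^sup>2 \<noteq> 1" using hyp by (simp add: k_def abs_square_eq_1)
  then have inj: "inj (\<lambda>n. (k\<^sup>2)^n)"
    using k0
    by (intro injI) (simp add: power_inject_exp')
  have key: "p\<^sup>2 * (A$1$1 * A$1$2) = 0 \<and> q\<^sup>2 * (A$2$1 * A$2$2) = 0" if A: "A \<in> G" for A
  proof -
    \<comment> \<open>the equation \<open>product of coordinates = w\<close> for the vector \<open>(p, q) H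
      A\<close>, multiplied by \<open>t = (k\<^sup>2)\<^sup>n\<close>\<close>
    define R where "R w = [: q\<^sup>2 * (A$2$1 * A$2$2), p * q * (A$1$1 * A$2$2 + A$2$1 * A$1$2) - w, p\<^sup>2 * (A$1$1 * A$1$2) :]" for w
    have "range (\<lambda>n. (k\<^sup>2)^n) \<subseteq> (\<Union>w\<in>?w ` G. {t. poly (R w) t = 0})"
    proof safe
      fix n
      obtain H where "H \<in> G" "H$1$1 = k^n" "H$2$2 = (h$2$2)^n" "H$1$2 = 0" "H$2$1 = 0"
        using diagonal_powers[OF h, of n] unfolding k_def by blast
      moreover have "k^n * (h$2$2)^n = 1" using kk by (simp flip: power_mult_distrib)
      moreover have "(k\<^sup>2)^n = k^n * k^n" by (simp add: power2_eq_square power_mult_distrib)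
      ultimately obtain s s' where H: "H \<in> G" "H$1$1 = s" "H$2$2 = s'" "H$1$2 = 0" "H$2$1 = 0"
        and s1: "s * s' = 1" and s2: "(k\<^sup>2)^n = s * s" by blast
      have "poly (R (?w (H ** A))) ((k\<^sup>2)^n) = 0"
      proof -
        define T where "T = s * s"
        have "T * ?w (H ** A) = p\<^sup>2 * (A$1$1*A$1$2) * T * T
           + p*q*(A$1$1 * A$2$2 + A$2$1 * A$1$2) * T * (s * s') + q\<^sup>2 * (A$2$1*A$2$2) * (s * s') * (s * s')"
          by (simp add: T_def mat2_mult_nth H(2-5) algebra_simps power2_eq_square)
        then show ?thesis
          unfolding s1 s2 T_def[symmetric] R_def by (simp add: algebra_simps)
      qed
      then show "(k\<^sup>2)^n \<in> (\<Union>w\<in>?w ` G. {t. poly (R w) t = 0})"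
        using mult_closed[OF H(1) A] by blast
    qed
    moreover have "infinite (range (\<lambda>n. (k\<^sup>2)^n))" using inj by (simp add: finite_image_iff)
    ultimately have "infinite (\<Union>w\<in>?w ` G. {t. poly (R w) t = 0})" using finite_subset by blast
    with fin obtain w where "infinite {t. poly (R w) t = 0}" by blast
    then have "R w = 0" using poly_roots_finite by blast
    then show ?thesis by (simp add: R_def)
  qed
  have "(A$1$2 = 0 \<and> A$2$1 = 0) \<or> (A$1$1 = 0 \<and> A$2$2 = 0)" if A: "A \<in> G" for A
  proof -
    note tri = triangular_diagonal[OF h hyp A] and dA = det_one'[OF A]
    have AA: "A ** A \<in> G" using A by (intro mult_closed)
    from v show ?thesis
    proof
      assume "p \<noteq> 0"
      then have "A$1$1 = 0 \<or> A$1$2 = 0" "(A ** A)$1$1 = 0 \<or> (A ** A)$1$2 = 0"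
        using key[OF A] key[OF AA] by auto
      then show ?thesis using tri dA by (auto simp: mat2_mult_nth)
    next
      assume "q \<noteq> 0"
      then have "A$2$1 = 0 \<or> A$2$2 = 0" "(A ** A)$2$1 = 0 \<or> (A ** A)$2$2 = 0"
        using key[OF A] key[OF AA] by auto
      then show ?thesis using tri dA by (auto simp: mat2_mult_nth)
    qed
  qed
  with exists_not_monomial show False by blast
qed

end

section \<open>Zariski density of the bottom rows of a lattice\<close>

lemma recurrent_group_conjugate:
  assumes \<Gamma>: "discrete_subgroup_PSL2R \<Gamma>" and cov: "finite_covolume \<Gamma>" and g: "det g = 1"
  shows "recurrent_group ((\<lambda>A. adjugate g ** A ** g) ` \<Gamma>)"
proof
  note G = \<Gamma>[unfolded discrete_subgroup_PSL2R_def]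
  define c where "c = (\<lambda>A. adjugate g ** A ** g)"
  have c_mult: "c A ** c B = c (A ** B)" for A B
  proof -
    have "c A ** c B = adjugate g ** A ** (g ** adjugate g) ** B ** g"
      unfolding c_def by (simp add: matrix_mul_assoc)
    then show ?thesis using g by (simp add: adjugate_mult c_def matrix_mul_assoc)
  qed
  have c_inv: "g ** c A ** adjugate g = A" for A
  proof -
    have "g ** c A ** adjugate g = (g ** adjugate g) ** A ** (g ** adjugate g)"
      unfolding c_def by (simp add: matrix_mul_assoc)
    then show ?thesis using g by (simp add: adjugate_mult)
  qed
  show "det A = 1" if "A \<in> c ` \<Gamma>" for A
    using that G g by (auto simp: c_def det_mul)
  show "mat 1 \<in> c ` \<Gamma>"
    using G g by (intro image_eqI[of _ _ "mat 1"]) (auto simp: c_def adjugate_mult)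
  show "A ** B \<in> c ` \<Gamma>" if "A \<in> c ` \<Gamma>" "B \<in> c ` \<Gamma>" for A B
    using that G by (auto simp: c_mult)
  show "adjugate A \<in> c ` \<Gamma>" if "A \<in> c ` \<Gamma>" for A
  proof -
    from that obtain B where B: "B \<in> \<Gamma>" "A = c B" by blast
    have "adjugate A = c (adjugate B)"
      unfolding B c_def by (simp add: mat2_eq_iff mat2_mult_nth algebra_simps)
    moreover have "adjugate B \<in> \<Gamma>" using B G by (metis matrix_inv_eq_adjugate)
    ultimately show ?thesis by blast
  qed
  show "finite X" if X: "X \<subseteq> c ` \<Gamma>" "bounded X" for X
  proof -
    have "linear (\<lambda>A::real^2^2. g ** A ** adjugate g)"
      by (rule linearI) (simp_all add: mat2_eq_iff mat2_mult_nth algebra_simps)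
    then have "bounded ((\<lambda>A. g ** A ** adjugate g) ` X)"
      using X(2) by (intro bounded_linear_image) (auto simp: linear_conv_bounded_linear)
    moreover have "(\<lambda>A. g ** A ** adjugate g) ` X \<subseteq> \<Gamma>"
      using X(1) by (auto simp: c_inv)
    ultimately have "finite ((\<lambda>A. g ** A ** adjugate g) ` X)"
      by (rule discrete_subgroup_bounded_finite[OF \<Gamma>])
    moreover have "inj_on (\<lambda>A. g ** A ** adjugate g) X"
    proof (rule inj_onI)
      fix A B assume "A \<in> X" "B \<in> X" "g ** A ** adjugate g = g ** B ** adjugate g"
      moreover have "C = c (g ** C ** adjugate g)" if "C \<in> X" for C
        using that X(1) c_inv by force
      ultimately show "A = B" by metis
    qed
    ultimately show ?thesis by (rule finite_imageD)
  qed
  show "infinite {A \<in> c ` \<Gamma>. \<exists>z\<in>E. moebius_action A z \<in> E}"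
    if E: "E \<in> sets borel" "E \<subseteq> uhp" "hyperbolic_area E = \<infinity>" for E
  proof -
    have inf: "infinite {A\<in>\<Gamma>. \<exists>z\<in>E. moebius_action (c A) z \<in> E}"
      using finite_covolume_returns_conjugate[OF \<Gamma> cov g E] by (simp add: c_def)
    have eq: "{A \<in> c ` \<Gamma>. \<exists>z\<in>E. moebius_action A z \<in> E} = c ` {A\<in>\<Gamma>. \<exists>z\<in>E. moebius_action (c A) z \<in> E}"
      by blast
    have inj: "inj_on c T" for T by (metis c_inv inj_onI)
    show ?thesis
      unfolding eq finite_image_iff[OF inj] by (rule inf)
  qed
qed

definition mat2 :: "real \<Rightarrow> real \<Rightarrow> real \<Rightarrow> real \<Rightarrow> real^2^2" where
  "mat2 a b c d = vector [vector [a, b], vector [c, d]]"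

lemma mat2_nth [simp]:
  "mat2 a b c d $ 1 $ 1 = a" "mat2 a b c d $ 1 $ 2 = b" "mat2 a b c d $ 2 $ 1 = c" "mat2 a b c d $ 2 $ 2 = d"
  by (simp_all add: mat2_def)

lemma det_mat2 [simp]: "det (mat2 a b c d) = a * d - b * c"
  by (simp add: det_2)

text \<open>A parabolic matrix with nonzero lower left entry \<open>c\<close> has the eigenvector \<open>(a -
  s, c)\<close>, where \<open>s = \<plusminus>1\<close> is its eigenvalue; this is the first column
  of \<open>g\<close>.\<close>

lemma parabolic_normal_form:
  assumes "det A = 1" "\<bar>trace A\<bar> = 2" "A \<noteq> mat 1" "A \<noteq> - mat 1"
  obtains g where "det g = 1" "(adjugate g ** A ** g) $ 2 $ 1 = 0" "\<bar>(adjugate g ** A ** g) $ 1 $ 1\<bar> = 1"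
    "(adjugate g ** A ** g) $ 1 $ 2 \<noteq> 0"
proof -
  define a b c d where abcd: "a = A$1$1" "b = A$1$2" "c = A$2$1" "d = A$2$2"
  define s where "s = (a + d) / 2"
  have dA: "a * d - b * c = 1" using assms(1) by (simp add: det_2 abcd)
  have s: "s = 1 \<or> s = -1" using assms(2) by (auto simp: trace_def sum_2 s_def abcd)
  have sd: "d = 2 * s - a" by (simp add: s_def field_simps)
  have ss: "s * s = 1" using s by auto
  show thesis
  proof (cases "c = 0")
    case True
    then have "(a - s) * (a - s) = 0" using dA sd ss by (simp add: algebra_simps)
    then have "a = s" by simp
    then have "d = s" using sd by simp
    have "b \<noteq> 0"
    proof
      assume "b = 0"
      then have "A = mat 1 \<or> A = - mat 1"
        using True \<open>a = s\<close> \<open>d = s\<close> s by (auto simp: mat2_eq_iff abcd)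
      with assms show False by blast
    qed
    have "adjugate (mat 1) = mat 1" by (simp add: mat2_eq_iff)
    then show thesis using that[of "mat 1"] True \<open>a = s\<close> s \<open>b \<noteq> 0\<close> by (auto simp: abcd)
  next
    case False
    define g where "g = mat2 (a - s) (- 1 / c) c 0"
    have dg: "det g = 1" using False by (simp add: g_def)
    have bc: "b * c = a * (2 * s - a) - s * s" using dA sd ss by simp
    have "(adjugate g ** A ** g) $ 2 $ 1 = c * ((a - s) * (d - a) + c * b * 0 + (a - s) * (a - s) - b * c)"
      by (simp add: mat2_mult_nth g_def abcd algebra_simps)
    moreover have "(adjugate g ** A ** g) $ 1 $ 1 = a + d - s"
      using False by (simp add: mat2_mult_nth g_def abcd field_simps)
    moreover have "(adjugate g ** A ** g) $ 1 $ 2 = - 1 / c"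
      using False by (simp add: mat2_mult_nth g_def abcd field_simps)
    ultimately show thesis
      using that[OF dg] sd bc s False by (auto simp: algebra_simps)
  qed
qed

text \<open>An elliptic matrix has a fixed point \<open>x0 + i y0\<close> in the upper half plane;
  \<open>g\<close> is the affine map that sends \<open>i\<close> to it.\<close>

lemma elliptic_normal_form:
  assumes "det A = 1" "\<bar>trace A\<bar> < 2"
  obtains g where "det g = 1" "(adjugate g ** A ** g) $ 2 $ 2 = (adjugate g ** A ** g) $ 1 $ 1"
    "(adjugate g ** A ** g) $ 1 $ 2 = - (adjugate g ** A ** g) $ 2 $ 1" "(adjugate g ** A ** g) $ 2 $ 1 \<noteq> 0"
proof -
  define a b c d where abcd: "a = A$1$1" "b = A$1$2" "c = A$2$1" "d = A$2$2"
  have dA: "a * d - b * c = 1" using assms(1) by (simp add: det_2 abcd)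
  have "\<bar>a + d\<bar> < 2" using assms(2) by (simp add: trace_def sum_2 abcd)
  then have "\<bar>a + d\<bar>\<^sup>2 < 2\<^sup>2" by (intro power_strict_mono) auto
  then have tr: "(a + d)\<^sup>2 < 4" by simp
  have c: "c \<noteq> 0"
  proof
    assume "c = 0"
    then have "(a + d)\<^sup>2 = (a - d)\<^sup>2 + 4" using dA by (simp add: power2_eq_square algebra_simps)
    with tr show False by simp
  qed
  define x0 where "x0 = (a - d) / (2 * c)"
  define y0 where "y0 = sqrt (4 - (a + d)\<^sup>2) / (2 * \<bar>c\<bar>)"
  define r where "r = sqrt y0"
  have y0: "y0 > 0" using tr c by (simp add: y0_def)
  have r: "r > 0" "r * r = y0" using y0 by (simp_all add: r_def)
  have cx: "2 * c * x0 = a - d" using c by (simp add: x0_def)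
  have "4 * (c * y0)\<^sup>2 = 4 - (a + d)\<^sup>2"
    using c tr by (simp add: y0_def power_mult_distrib power_divide)
  then have cy: "c * c * (y0 * y0) = 1 - (a + d) * (a + d) / 4"
    by (simp add: power2_eq_square mult.commute mult.left_commute)
  define g where "g = mat2 r (x0 / r) 0 (1 / r)"
  have dg: "det g = 1" using r by (simp add: g_def)
  have e11: "(adjugate g ** A ** g) $ 1 $ 1 = a - c * x0"
    using r(1) by (simp add: mat2_mult_nth g_def abcd field_simps)
  have e22: "(adjugate g ** A ** g) $ 2 $ 2 = d + c * x0"
    using r(1) by (simp add: mat2_mult_nth g_def abcd field_simps)
  have e21: "(adjugate g ** A ** g) $ 2 $ 1 = c * y0"
    using r(1) by (simp add: mat2_mult_nth g_def abcd field_simps flip: r(2))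
  have e12: "(adjugate g ** A ** g) $ 1 $ 2 = (b + (a - d) * x0 - c * x0 * x0) / y0"
    using r(1) by (simp add: mat2_mult_nth g_def abcd field_simps flip: r(2))
  have "c * (b + (a - d) * x0 - c * x0 * x0 + c * y0 * y0) = 0"
  proof -
    have "c * (b + (a - d) * x0 - c * x0 * x0 + c * y0 * y0)
      = b * c + (a - d) * (2 * c * x0) / 2 - (2 * c * x0) * (2 * c * x0) / 4 + c * c * (y0 * y0)"
      by (simp add: field_simps)
    also have "\<dots> = b * c + (a - d) * (a - d) / 2 - (a - d) * (a - d) / 4 + (1 - (a + d) * (a + d) / 4)"
      unfolding cx cy by (rule refl)
    also have "\<dots> = 1 + b * c - a * d" by (simp add: field_simps)
    finally show ?thesis using dA by simp
  qed
  then have "b + (a - d) * x0 - c * x0 * x0 = - c * y0 * y0" using c by (simp add: add_eq_0_iff)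
  then have e12': "(adjugate g ** A ** g) $ 1 $ 2 = - (c * y0)"
    unfolding e12 using y0 by (simp add: field_simps)
  show thesis
    by (rule that[OF dg]) (use e11 e22 e21 e12' cx c y0 in auto)
qed

text \<open>The columns of \<open>g\<close> are eigenvectors. The eigenvalue is not
  \<open>\<plusminus>1\<close> because the trace would then be \<open>\<plusminus>2\<close>.\<close>

lemma hyperbolic_normal_form:
  assumes "det A = 1" "\<bar>trace A\<bar> > 2"
  obtains g where "det g = 1" "(adjugate g ** A ** g) $ 1 $ 2 = 0" "(adjugate g ** A ** g) $ 2 $ 1 = 0"
    "\<bar>(adjugate g ** A ** g) $ 1 $ 1\<bar> \<noteq> 1"
proof -
  note result = that
  define a b c d where abcd: "a = A$1$1" "b = A$1$2" "c = A$2$1" "d = A$2$2"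
  have dA: "a * d - b * c = 1" using assms(1) by (simp add: det_2 abcd)
  have "2 < \<bar>a + d\<bar>" using assms(2) by (simp add: trace_def sum_2 abcd)
  then have "2\<^sup>2 < \<bar>a + d\<bar>\<^sup>2" by (intro power_strict_mono) auto
  then have tr: "4 < (a + d)\<^sup>2" by simp
  have diag: thesis if g: "det g = 1" "(adjugate g ** A ** g) $ 1 $ 2 = 0" "(adjugate g ** A ** g) $ 2 $ 1 = 0" for g
  proof -
    define B where "B = adjugate g ** A ** g"
    have "det B = 1" using assms g by (simp add: B_def det_mul)
    then have B1: "B$1$1 * B$2$2 = 1" using g by (simp add: det_2 B_def)
    have "trace B = trace A"
    proof -
      have "trace B = det g * trace A"
        by (simp add: trace_def sum_2 B_def mat2_mult_nth det_2 algebra_simps)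
      then show ?thesis using g by simp
    qed
    then have tB: "\<bar>B$1$1 + B$2$2\<bar> > 2" using assms(2) by (simp add: trace_def sum_2)
    have "\<bar>B$1$1\<bar> \<noteq> 1"
    proof
      assume "\<bar>B$1$1\<bar> = 1"
      then have "B$1$1 = 1 \<or> B$1$1 = -1" by linarith
      then show False using B1 tB by auto
    qed
    then show thesis using result[OF g] by (simp add: B_def)
  qed
  define D where "D = sqrt ((a + d)\<^sup>2 - 4)"
  have D: "D > 0" "D * D = (a + d) * (a + d) - 4" using tr by (simp_all add: D_def power2_eq_square)
  define l m where "l = (a + d + D) / 2" and "m = (a + d - D) / 2"
  have lm: "l + m = a + d" "l * m = 1" "l - m = D" using D by (simp_all add: l_def m_def field_simps)
  have char: "l * l = (a + d) * l - 1" "m * m = (a + d) * m - 1"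
    using lm(2) unfolding lm(1)[symmetric] by (simp_all add: algebra_simps)
  show thesis
  proof (cases "c = 0")
    case c: False
    define k where "k = c * D"
    have k: "k \<noteq> 0" using c D by (simp add: k_def)
    define g where "g = mat2 (l - d) ((m - d) / k) c (c / k)"
    show thesis
    proof (rule diag)
      show "det g = 1" using k lm(3) unfolding g_def by (simp add: field_simps) (simp add: k_def algebra_simps)
      have e: "a * (l - d) + b * c = l * (l - d)" "a * (m - d) + b * c = m * (m - d)"
        using char dA by (simp_all add: algebra_simps)
      have "(adjugate g ** A ** g) $ 2 $ 1 = - c * (a * (l - d) + b * c) + (l - d) * (c * l)"
        by (simp add: mat2_mult_nth g_def abcd algebra_simps)
      then show "(adjugate g ** A ** g) $ 2 $ 1 = 0" unfolding e by simp
      have "(adjugate g ** A ** g) $ 1 $ 2 = (c * (a * (m - d) + b * c) - (m - d) * (c * m)) / (k * k)"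
        using k by (simp add: mat2_mult_nth g_def abcd field_simps)
      then show "(adjugate g ** A ** g) $ 1 $ 2 = 0" unfolding e by simp
    qed
  next
    case c: True
    have ad: "a * d = 1" using dA c by simp
    have "d \<noteq> a"
    proof
      assume "d = a"
      then have "(a + d)\<^sup>2 = 4 * (a * d)" by (simp add: power2_eq_square)
      with tr ad show False by simp
    qed
    then have da: "d - a \<noteq> 0" by simp
    define e where "e = b / (d - a)"
    have e: "(d - a) * e = b" using da by (simp add: e_def)
    define g where "g = mat2 1 e 0 1"
    show thesis
    proof (rule diag)
      show "det g = 1" by (simp add: g_def)
      show "(adjugate g ** A ** g) $ 2 $ 1 = 0"
        using c by (simp add: mat2_mult_nth g_def abcd)
      have "(adjugate g ** A ** g) $ 1 $ 2 = b - (d - a) * e"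
        using c by (simp add: mat2_mult_nth g_def abcd algebra_simps)
      then show "(adjugate g ** A ** g) $ 1 $ 2 = 0" using e by simp
    qed
  qed
qed

lemma exists_hyperbolic:
  assumes \<Gamma>: "discrete_subgroup_PSL2R \<Gamma>" and cov: "finite_covolume \<Gamma>"
  shows "\<exists>A\<in>\<Gamma>. \<bar>trace A\<bar> > 2"
proof -
  note conj = recurrent_group_conjugate[OF \<Gamma> cov]
  have trace_conj: "trace (adjugate g ** A ** g) = trace A" if "det g = 1" for g A
  proof -
    have "trace (adjugate g ** A ** g) = det g * trace A"
      by (simp add: trace_def sum_2 mat2_mult_nth det_2 algebra_simps)
    then show ?thesis using that by simp
  qed
  interpret \<Gamma>: recurrent_group \<Gamma>
  proof -
    have "adjugate (mat 1 :: real^2^2) = mat 1" by (simp add: mat2_eq_iff)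
    then show "recurrent_group \<Gamma>" using conj[of "mat 1"] by simp
  qed
  have "infinite (\<Gamma> - {mat 1, - mat 1})" using \<Gamma>.infinite by simp
  then have "\<Gamma> - {mat 1, - mat 1} \<noteq> {}" by (intro notI) simp
  then obtain A where A: "A \<in> \<Gamma>" "A \<noteq> mat 1" "A \<noteq> - mat 1" by blast
  have dA: "det A = 1" using A \<Gamma>.det_one by blast
  consider "\<bar>trace A\<bar> < 2" | "\<bar>trace A\<bar> = 2" | "\<bar>trace A\<bar> > 2" by linarith
  then show ?thesis
  proof cases
    case 1
    from elliptic_normal_form[OF dA 1] obtain g where g: "det g = 1"
      "(adjugate g ** A ** g) $ 2 $ 2 = (adjugate g ** A ** g) $ 1 $ 1"
      "(adjugate g ** A ** g) $ 1 $ 2 = - (adjugate g ** A ** g) $ 2 $ 1" "(adjugate g ** A ** g) $ 2 $ 1 \<noteq> 0" .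
    from recurrent_group.hyperbolic_if_rotation[OF conj[OF g(1)] _ g(2-4)] A(1)
    show ?thesis using trace_conj[OF g(1)] by auto
  next
    case 2
    from parabolic_normal_form[OF dA 2 A(2,3)] obtain g where g: "det g = 1"
      "(adjugate g ** A ** g) $ 2 $ 1 = 0" "\<bar>(adjugate g ** A ** g) $ 1 $ 1\<bar> = 1"
      "(adjugate g ** A ** g) $ 1 $ 2 \<noteq> 0" .
    from recurrent_group.hyperbolic_if_translation[OF conj[OF g(1)] _ g(2-4)] A(1)
    show ?thesis using trace_conj[OF g(1)] by auto
  qed (use A in blast)
qed

text \<open>Polynomials in two variables are represented as polynomials over polynomials; the outer variable
  is \<open>y\<close>.\<close>

definition eval2 :: "complex poly poly \<Rightarrow> complex \<Rightarrow> complex \<Rightarrow> complex" where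
  "eval2 P x y = poly (poly P [:y:]) x"

lemma eval2_pCons: "eval2 (pCons a P) x y = poly a x + y * eval2 P x y"
  by (simp add: eval2_def)

lemma eval2_0 [simp]: "eval2 0 x y = 0"
  by (simp add: eval2_def)

lemma eval2_as_poly_snd: "eval2 P x y = poly (map_poly (\<lambda>p. poly p x) P) y"
  by (induction P) (simp_all add: eval2_pCons map_poly_pCons)

lemma eval2_zero_iff:
  assumes "infinite X" "\<And>x. x \<in> X \<Longrightarrow> infinite {y. eval2 P x y = 0}"
  shows "P = 0"
proof -
  have all_y: "eval2 P x y = 0" if "x \<in> X" for x y
  proof -
    have "infinite {y. poly (map_poly (\<lambda>p. poly p x) P) y = 0}"
      using assms(2)[OF that] by (simp add: eval2_as_poly_snd)
    then have "map_poly (\<lambda>p. poly p x) P = 0"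
      using poly_roots_finite by blast
    then show ?thesis by (simp add: eval2_as_poly_snd)
  qed
  have "poly P [:y:] = 0" for y
  proof (rule ccontr)
    assume "poly P [:y:] \<noteq> 0"
    then have "finite {x. poly (poly P [:y:]) x = 0}" by (rule poly_roots_finite)
    moreover have "X \<subseteq> {x. poly (poly P [:y:]) x = 0}" using all_y by (auto simp: eval2_def)
    ultimately show False using assms(1) finite_subset by blast
  qed
  then have "range (\<lambda>y. [:y:]) \<subseteq> {q. poly P q = 0}" by auto
  moreover have "infinite (range (\<lambda>y::complex. [:y:]))"
    by (subst finite_image_iff) (auto intro: injI simp: infinite_UNIV_char_0)
  ultimately have "infinite {q. poly P q = 0}" using finite_subset by blast
  then show ?thesis using poly_roots_finite by blast
qed

lemma eval2_linear_substitution: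
  "\<exists>Q. \<forall>x y. eval2 Q x y = eval2 P (\<alpha> * x + \<beta> * y) (\<gamma> * x + \<delta> * y)"
proof (induction P)
  case 0
  show ?case by (rule exI[of _ 0]) simp
next
  case (pCons a P)
  have lin: "\<exists>Q. \<forall>x y. eval2 Q x y = poly a (\<alpha> * x + \<beta> * y)"
  proof (induction a)
    case 0
    show ?case by (rule exI[of _ 0]) simp
  next
    case (pCons c p)
    then obtain Q where Q: "\<And>x y. eval2 Q x y = poly p (\<alpha> * x + \<beta> * y)" by blast
    have "eval2 ([:[:c:]:] + [:[:0, \<alpha>:], [:\<beta>:]:] * Q) x y = poly (pCons c p) (\<alpha> * x + \<beta> * y)" for x y
      using Q[of x y] by (simp add: eval2_def algebra_simps)
    then show ?case by blast
  qed
  then obtain R where R: "\<And>x y. eval2 R x y = poly a (\<alpha> * x + \<beta> * y)" by blast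
  obtain Q where Q: "\<And>x y. eval2 Q x y = eval2 P (\<alpha> * x + \<beta> * y) (\<gamma> * x + \<delta> * y)" using pCons by blast
  have "eval2 (R + [:[:0, \<gamma>:], [:\<delta>:]:] * Q) x y = eval2 (pCons a P) (\<alpha> * x + \<beta> * y) (\<gamma> * x + \<delta> * y)" for x y
    unfolding eval2_pCons R[symmetric] Q[symmetric] by (simp add: eval2_def algebra_simps)
  then show ?case by blast
qed

text \<open>Restricted to a hyperbola, a polynomial is a Laurent polynomial in the parameter.\<close>

lemma eval2_laurent:
  "\<exists>n R. \<forall>t. t \<noteq> 0 \<longrightarrow> t ^ n * eval2 P (x * t) (y / t) = poly R t"
proof (induction P)
  case 0
  show ?case by (rule exI[of _ 0], rule exI[of _ 0]) simp
next
  case (pCons a P)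
  then obtain n R where R: "\<And>t. t \<noteq> 0 \<Longrightarrow> t ^ n * eval2 P (x * t) (y / t) = poly R t" by blast
  have "t ^ Suc n * eval2 (pCons a P) (x * t) (y / t) = poly (monom 1 (Suc n) * pcompose a [:0, x:] + smult y R) t"
    if "t \<noteq> 0" for t
    using that R[OF that, symmetric] by (simp add: eval2_pCons poly_pcompose poly_monom algebra_simps)
  then show ?case by blast
qed

text \<open>Vanishing at \<open>(X k\<^sup>m, Y / k\<^sup>m)\<close> for all \<open>m\<close> implies
  vanishing on the whole hyperbola through \<open>(X, Y)\<close>. Every vertical line \<open>x =
  s\<close> with \<open>s \<noteq> 0\<close> meets infinitely many of these hyperbolas.\<close>

lemma (in recurrent_group) orbit_Zariski_dense:
  assumes h: "h \<in> G" "h$1$2 = 0" "h$2$1 = 0" and hyp: "\<bar>h$1$1\<bar> \<noteq> 1"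
    and v: "p \<noteq> 0 \<or> q \<noteq> 0"
    and zero: "\<And>A. A \<in> G \<Longrightarrow> eval2 P (of_real (p * A$1$1 + q * A$2$1)) (of_real (p * A$1$2 + q * A$2$2)) = 0"
  shows "P = 0"
proof (rule eval2_zero_iff)
  define X where "X A = p * A$1$1 + q * A$2$1" for A :: "real^2^2"
  define Y where "Y A = p * A$1$2 + q * A$2$2" for A :: "real^2^2"
  define k where "k = h$1$1"
  have kk: "k * h$2$2 = 1" using det_one'[OF h(1)] h by (simp add: k_def)
  then have k0: "k \<noteq> 0" by auto
  have inv: "h$2$2 = inverse k" using kk k0 by (simp add: field_simps)
  have hyperbola: "eval2 P (of_real (X A) * t) (of_real (Y A) / t) = 0" if A: "A \<in> G" and t: "t \<noteq> 0" for A t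
  proof -
    obtain n R where R: "\<And>t. t \<noteq> 0 \<Longrightarrow> t ^ n * eval2 P (of_real (X A) * t) (of_real (Y A) / t) = poly R t"
      using eval2_laurent by blast
    have "poly R (of_real (k ^ m)) = 0" for m
    proof -
      obtain H where H: "H \<in> G" "H$1$1 = k^m" "H$2$2 = inverse k^m" "H$1$2 = 0" "H$2$1 = 0"
        using diagonal_powers[OF h, of m] inv by (auto simp: k_def)
      define B where "B = A ** H"
      have "X B = X A * k^m" "Y B = Y A / k^m"
        using H by (simp_all add: X_def Y_def B_def mat2_mult_nth field_simps add_divide_distrib)
      moreover have "eval2 P (of_real (X B)) (of_real (Y B)) = 0"
        using zero[of B] mult_closed[OF A H(1)] by (simp add: X_def Y_def B_def)
      ultimately show ?thesis
        using R[of "of_real (k^m)"] k0 by simp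
    qed
    moreover have "infinite (range (\<lambda>m. of_real (k ^ m) :: complex))"
    proof -
      have "inj (\<lambda>m. of_real (k ^ m) :: complex)"
      proof (rule injI)
        fix m n assume "(of_real (k ^ m) :: complex) = of_real (k ^ n)"
        then have "k ^ m = k ^ n" by (simp only: of_real_eq_iff)
        then have "\<bar>k\<bar> ^ m = \<bar>k\<bar> ^ n" by (simp flip: power_abs)
        then show "m = n" using hyp k0 by (simp add: k_def power_inject_exp')
      qed
      then show ?thesis by (simp add: finite_image_iff)
    qed
    moreover have "range (\<lambda>m. of_real (k ^ m)) \<subseteq> {t. poly R t = 0}" using calculation(1) by blast
    ultimately have "infinite {t. poly R t = 0}" using finite_subset by blast
    then have "R = 0" using poly_roots_finite by blast
    then show ?thesis using R[OF t] t by simp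
  qed
  show "infinite (UNIV - {0 :: complex})" by (simp add: infinite_UNIV_char_0)
  fix s :: complex assume s: "s \<in> UNIV - {0}"
  define W where "W = (\<lambda>A. X A * Y A) ` G"
  have W: "infinite W"
    using infinite_hyperbolic_invariant[OF h hyp v] by (simp add: W_def X_def Y_def)
  have "(\<lambda>w. of_real w / s) ` (W - {0}) \<subseteq> {y. eval2 P s y = 0}"
  proof safe
    fix w assume "w \<in> W" "w \<noteq> 0"
    then obtain A where A: "A \<in> G" "w = X A * Y A" "X A \<noteq> 0" by (auto simp: W_def)
    show "eval2 P s (of_real w / s) = 0"
      using hyperbola[OF A(1), of "s / of_real (X A)"] A s by (simp add: mult.commute)
  qed
  moreover have "infinite ((\<lambda>w. of_real w / s) ` (W - {0}))"
    using W s by (subst finite_image_iff) (auto intro!: inj_onI)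
  ultimately show "infinite {y. eval2 P s y = 0}" using finite_subset by blast
qed

text \<open>The bottom rows form the orbit of \<open>(0, 1)\<close> under multiplication from the right. In
  the eigenbasis of a hyperbolic element it becomes an orbit of the conjugated group.\<close>

theorem bottom_rows_Zariski_dense:
  assumes \<Gamma>: "discrete_subgroup_PSL2R \<Gamma>" and cov: "finite_covolume \<Gamma>"
    and zero: "\<And>A. A \<in> \<Gamma> \<Longrightarrow> eval2 P (of_real (A$2$1)) (of_real (A$2$2)) = 0"
  shows "P = 0"
proof -
  obtain A where A: "A \<in> \<Gamma>" "\<bar>trace A\<bar> > 2" using exists_hyperbolic[OF \<Gamma> cov] by blast
  have dA: "det A = 1" using A \<Gamma> by (auto simp: discrete_subgroup_PSL2R_def)
  from hyperbolic_normal_form[OF dA A(2)] obtain g where g: "det g = 1"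
    "(adjugate g ** A ** g) $ 1 $ 2 = 0" "(adjugate g ** A ** g) $ 2 $ 1 = 0"
    "\<bar>(adjugate g ** A ** g) $ 1 $ 1\<bar> \<noteq> 1" .
  define G where "G = (\<lambda>A. adjugate g ** A ** g) ` \<Gamma>"
  interpret recurrent_group G
    unfolding G_def by (rule recurrent_group_conjugate[OF \<Gamma> cov g(1)])
  have hG: "adjugate g ** A ** g \<in> G" using A by (auto simp: G_def)
  have dg: "g$1$1 * g$2$2 - g$1$2 * g$2$1 = 1" using g(1) by (simp add: det_2)
  then have dgc: "(of_real (g$1$1) * of_real (g$2$2) - of_real (g$1$2) * of_real (g$2$1) :: complex) = 1"
    by (simp flip: of_real_mult of_real_diff)
  obtain Q where Q: "\<And>x y. eval2 Q x y = eval2 P (of_real (g$2$2) * x + of_real (- g$2$1) * y)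
      (of_real (- g$1$2) * x + of_real (g$1$1) * y)"
    using eval2_linear_substitution by blast
  have "Q = 0"
  proof (rule orbit_Zariski_dense[OF hG g(2-4)])
    show "g$2$1 \<noteq> 0 \<or> g$2$2 \<noteq> 0" using dg by auto
    fix B assume "B \<in> G"
    then obtain C where C: "C \<in> \<Gamma>" "B = adjugate g ** C ** g" by (auto simp: G_def)
    define x where "x = g$2$1 * B$1$1 + g$2$2 * B$2$1"
    define y where "y = g$2$1 * B$1$2 + g$2$2 * B$2$2"
    have gB: "g ** B = C ** g"
    proof -
      have "g ** B = (g ** adjugate g) ** C ** g" unfolding C by (simp add: matrix_mul_assoc)
      then show ?thesis by (simp add: adjugate_mult g)
    qed
    have "x = (g ** B)$2$1" "y = (g ** B)$2$2" by (simp_all add: x_def y_def mat2_mult_nth)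
    then have xy: "x = C$2$1 * g$1$1 + C$2$2 * g$2$1" "y = C$2$1 * g$1$2 + C$2$2 * g$2$2"
      unfolding gB by (simp_all add: mat2_mult_nth)
    have "g$2$2 * x + (- g$2$1) * y = C$2$1 * (g$1$1 * g$2$2 - g$1$2 * g$2$1)"
      "(- g$1$2) * x + g$1$1 * y = C$2$2 * (g$1$1 * g$2$2 - g$1$2 * g$2$1)"
      unfolding xy by (simp_all add: algebra_simps)
    then have "eval2 Q (of_real x) (of_real y) = eval2 P (of_real (C$2$1)) (of_real (C$2$2))"
      unfolding Q dg by (simp flip: of_real_mult of_real_add of_real_minus)
    then show "eval2 Q (of_real (g$2$1 * B$1$1 + g$2$2 * B$2$1)) (of_real (g$2$1 * B$1$2 + g$2$2 * B$2$2)) = 0"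
      using zero[OF C(1)] by (simp add: x_def y_def)
  qed
  have "eval2 P c d = 0" for c d
  proof -
    define x where "x = c * of_real (g$1$1) + d * of_real (g$2$1)"
    define y where "y = c * of_real (g$1$2) + d * of_real (g$2$2)"
    have "of_real (g$2$2) * x + of_real (- g$2$1) * y = c * (of_real (g$1$1) * of_real (g$2$2) - of_real (g$1$2) * of_real (g$2$1))"
      "of_real (- g$1$2) * x + of_real (g$1$1) * y = d * (of_real (g$1$1) * of_real (g$2$2) - of_real (g$1$2) * of_real (g$2$1))"
      by (simp_all add: x_def y_def algebra_simps)
    then show ?thesis using Q[of x y] \<open>Q = 0\<close> unfolding dgc by simp
  qed
  then show ?thesis by (intro eval2_zero_iff[of UNIV]) (simp_all add: infinite_UNIV_char_0)
qed

section \<open>Derivatives and pullbacks of meromorphic functions\<close>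

lemma mero_of_eqI: "mero_rel f g \<Longrightarrow> mero_of f = mero_of g"
  using Quotient3_rel_abs[OF Quotient3_mero] by blast

lemma eventually_cosparse_in: "\<forall>\<^sub>\<approx>z\<in>uhp. z \<in> uhp"
  using eventually_in_cosparse[OF order.refl open_uhp] .

lemma mero_rel_analytic:
  assumes "mero_rel f f" shows "\<forall>\<^sub>\<approx>z\<in>uhp. f analytic_on {z}"
  using assms by (intro meromorphic_on_imp_analytic_cosparse) (auto simp: mero_rel_def)

lemma D_mero_add: "D_mero (f + g) = D_mero f + D_mero g"
proof (transfer, goal_cases)
  case (1 f g)
  have "\<forall>\<^sub>\<approx>z\<in>uhp. deriv (\<lambda>z. f z + g z) z = deriv f z + deriv g z"
    using mero_rel_analytic[OF 1(1)] mero_rel_analytic[OF 1(2)]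
    by eventually_elim (auto intro!: deriv_add analytic_on_imp_differentiable_at)
  with 1 show ?case by (auto simp: mero_rel_def intro!: meromorphic_intros meromorphic_on_deriv)
qed

lemma D_mero_mult: "D_mero (f * g) = f * D_mero g + D_mero f * g"
proof (transfer, goal_cases)
  case (1 f g)
  have "\<forall>\<^sub>\<approx>z\<in>uhp. deriv (\<lambda>z. f z * g z) z = f z * deriv g z + deriv f z * g z"
    using mero_rel_analytic[OF 1(1)] mero_rel_analytic[OF 1(2)]
    by eventually_elim (auto intro!: deriv_mult analytic_on_imp_differentiable_at)
  with 1 show ?case by (auto simp: mero_rel_def intro!: meromorphic_intros meromorphic_on_deriv)
qed

lemma D_mero_scale: "D_mero (c *\<^sub>m f) = c *\<^sub>m D_mero f"
proof (transfer, goal_cases)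
  case (1 c f)
  have "\<forall>\<^sub>\<approx>z\<in>uhp. deriv (\<lambda>z. c * f z) z = c * deriv f z"
    using mero_rel_analytic[OF 1(1)]
    by eventually_elim (auto intro!: deriv_cmult analytic_on_imp_differentiable_at)
  with 1 show ?case by (auto simp: mero_rel_def intro!: meromorphic_intros meromorphic_on_deriv)
qed

lemma D_mero_one [simp]: "D_mero 1 = 0"
  by transfer (auto simp: mero_rel_def)

lemma D_mero_zero [simp]: "D_mero 0 = 0"
  using D_mero_scale[of 0 0] by simp

lemma scale_mult_left: "(c *\<^sub>m f) * g = c *\<^sub>m (f * g)"
  by transfer (auto simp: mero_rel_def mult.assoc intro!: meromorphic_intros)

lemma scale_mult_right: "f * (c *\<^sub>m g) = c *\<^sub>m (f * g)"
  using scale_mult_left[of c g f] by (simp add: mult.commute)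

lift_definition zvar :: mero is "\<lambda>z. z"
  by (auto simp: mero_rel_def intro!: meromorphic_intros)

lemma D_mero_zvar [simp]: "D_mero zvar = 1"
  by transfer (auto simp: mero_rel_def)

definition constm :: "complex \<Rightarrow> mero" where
  "constm c = c *\<^sub>m 1"

lemma constm_simps [simp]: "constm 0 = 0" "constm 1 = 1" "D_mero (constm c) = 0"
  by (simp_all add: constm_def D_mero_scale)

lemma scale_eq_constm: "c *\<^sub>m f = constm c * f"
  by (simp add: constm_def scale_mult_left)

lemma constm_add: "constm (a + b) = constm a + constm b"
  by (simp add: constm_def mero.scale_left_distrib)

lemma constm_mult: "constm (a * b) = constm a * constm b"
  by (simp add: constm_def scale_mult_left)

lemma constm_power: "constm (a ^ n) = constm a ^ n"
  by (induction n) (simp_all add: constm_mult)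

lemma constm_of_nat: "constm (of_nat n) = of_nat n"
  by (induction n) (simp_all add: constm_add)

text \<open>A Moebius transformation is injective and continuous, so it pulls punctured neighbourhoods back to
  punctured neighbourhoods.\<close>

lemma cosparse_moebius:
  assumes A: "det A = 1" and P: "\<forall>\<^sub>\<approx>z\<in>uhp. P z"
  shows "\<forall>\<^sub>\<approx>z\<in>uhp. P (moebius_action A z)"
  unfolding eventually_cosparse_open_eq[OF open_uhp]
proof
  fix z assume z: "z \<in> uhp"
  have "\<forall>\<^sub>F w in at (moebius_action A z). P w"
    using P z A by (simp add: eventually_cosparse_open_eq[OF open_uhp] moebius_action_in_uhp)
  moreover have "filterlim (moebius_action A) (at (moebius_action A z)) (at z)"
  proof (rule filterlim_atI)
    show "(moebius_action A \<longlongrightarrow> moebius_action A z) (at z)"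
      using moebius_action_has_field_derivative[OF A z] DERIV_isCont isCont_def by blast
    have "\<forall>\<^sub>F w in at z. w \<in> uhp - {z}"
      using z open_uhp by (intro eventually_at_in_open) auto
    then show "\<forall>\<^sub>F w in at z. moebius_action A w \<noteq> moebius_action A z"
      by eventually_elim (use inj_on_moebius_action[OF A] z in \<open>auto dest: inj_onD\<close>)
  qed
  ultimately show "\<forall>\<^sub>F w in at z. P (moebius_action A w)"
    by (rule eventually_compose_filterlim)
qed

lemma meromorphic_moebius:
  assumes A: "det A = 1" and f: "f meromorphic_on uhp"
  shows "(\<lambda>z. f (moebius_action A z)) meromorphic_on uhp"
  using f by (rule meromorphic_on_compose)
    (use A moebius_action_holomorphic in \<open>auto simp: analytic_on_open open_uhp moebius_action_in_uhp\<close>)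

text \<open>Matrices of determinant other than 1 need not preserve the upper half plane; for them the identity
  serves as a default value.\<close>

lift_definition pullback :: "real^2^2 \<Rightarrow> mero \<Rightarrow> mero" is
  "\<lambda>A f. if det A = 1 then (\<lambda>z. f (moebius_action A z)) else f"
  by (auto simp: mero_rel_def intro: meromorphic_moebius cosparse_moebius)

lemma pullback_add: "pullback A (f + g) = pullback A f + pullback A g"
  by transfer (auto simp: mero_rel_def intro!: meromorphic_moebius meromorphic_intros)

lemma pullback_mult: "pullback A (f * g) = pullback A f * pullback A g"
  by transfer (auto simp: mero_rel_def intro!: meromorphic_moebius meromorphic_intros)

lemma pullback_scale: "pullback A (c *\<^sub>m f) = c *\<^sub>m pullback A f"
  by transfer (auto simp: mero_rel_def intro!: meromorphic_moebius meromorphic_intros)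

lemma pullback_one: "pullback A 1 = 1"
  by transfer (auto simp: mero_rel_def)

lemma pullback_zero [simp]: "pullback A 0 = 0"
  by transfer (auto simp: mero_rel_def)

lemma pullback_constm: "pullback A (constm c) = constm c"
  by (simp add: constm_def pullback_scale pullback_one)

lemma pullback_sum: "pullback A (\<Sum>i\<in>I. f i) = (\<Sum>i\<in>I. pullback A (f i))"
  by (induction I rule: infinite_finite_induct) (simp_all add: pullback_add)

lemma pullback_identity: "pullback (mat 1) f = f"
  by transfer (auto simp: mero_rel_def)

lemma moebius_action_minus_one: "moebius_action (- mat 1) z = z"
  by (simp add: moebius_action_def)

lemma pullback_minus_one: "pullback (- mat 1) f = f"
  by transfer (auto simp: mero_rel_def moebius_action_minus_one)

text \<open>The automorphy factor \<open>c z + d\<close> as an element of the ring, written so that its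
  dependence on the bottom row is visible.\<close>

definition autm :: "real^2^2 \<Rightarrow> mero" where
  "autm A = constm (of_real (A$2$1)) * zvar + constm (of_real (A$2$2))"

lift_definition autm_lifted :: "real^2^2 \<Rightarrow> mero" is automorphy
  unfolding automorphy_def by (auto simp: mero_rel_def intro!: meromorphic_intros)

lemma autm_eq: "autm A = autm_lifted A"
  unfolding autm_def constm_def scale_mult_left mult_1
  by transfer (auto simp: mero_rel_def automorphy_def[abs_def] intro!: meromorphic_intros)

lemma pullback_D:
  assumes A: "det A = 1"
  shows "pullback A (D_mero f) = (autm A)\<^sup>2 * D_mero (pullback A f)"
  unfolding autm_eq power2_eq_square using A
proof (transfer, goal_cases)
  case (1 A f)
  note A = 1(1) and f = 1(2)
  have "\<forall>\<^sub>\<approx>z\<in>uhp. f analytic_on {moebius_action A z}"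
    by (rule cosparse_moebius[OF A mero_rel_analytic[OF f]])
  then have "\<forall>\<^sub>\<approx>z\<in>uhp. deriv f (moebius_action A z) =
      automorphy A z * automorphy A z * deriv (\<lambda>z. f (moebius_action A z)) z"
    using eventually_cosparse_in
  proof eventually_elim
    case (elim z)
    have "f field_differentiable at (moebius_action A z)"
      using elim(1) by (intro analytic_on_imp_differentiable_at) auto
    then have "(f has_field_derivative deriv f (moebius_action A z)) (at (moebius_action A z))"
      using field_differentiable_derivI by blast
    from DERIV_chain2[OF this moebius_action_has_field_derivative[OF A elim(2)]]
    have "deriv (\<lambda>z. f (moebius_action A z)) z = deriv f (moebius_action A z) * (1 / (automorphy A z)\<^sup>2)"
      by (rule DERIV_imp_deriv)
    then show ?case
      using automorphy_nonzero[OF A elim(2)] by (simp add: power2_eq_square)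
  qed
  moreover have "f meromorphic_on uhp" using f by (simp add: mero_rel_def)
  ultimately show ?case
    using A by (auto simp: mero_rel_def automorphy_def[abs_def] intro!: meromorphic_moebius meromorphic_intros meromorphic_on_deriv)
qed

lemma mero_of_power:
  assumes "f meromorphic_on uhp"
  shows "mero_of f ^ n = mero_of (\<lambda>z. f z ^ n)"
proof (induction n)
  case 0
  show ?case by (simp add: one_mero_def)
next
  case (Suc n)
  have "mero_of f * mero_of (\<lambda>z. f z ^ n) = mero_of (\<lambda>z. f z * f z ^ n)"
    by (rule times_mero.abs_eq) (use assms in \<open>auto simp: mero_rel_def intro!: meromorphic_intros\<close>)
  then show ?case using Suc by simp
qed

text \<open>The exponents \<open>nat k\<close> and \<open>nat (- k)\<close>, one of which is 0, express the
  transformation law for weights of either sign without inverting the automorphy factor.\<close>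

lemma modular_form_pullback:
  assumes f: "f \<in> modular_forms \<Gamma> k" and A: "A \<in> \<Gamma>" "det A = 1"
  shows "pullback A f * autm A ^ nat (- k) = autm A ^ nat k * f"
proof -
  from f obtain F where F: "f = mero_of F" "F meromorphic_on uhp"
      "\<forall>\<^sub>\<approx>z\<in>uhp. slash k A F z = F z"
    using A by (auto simp: modular_forms_def meromorphic_modular_form_def)
  have mF: "(\<lambda>z. F (moebius_action A z)) meromorphic_on uhp"
    by (rule meromorphic_moebius[OF A(2) F(2)])
  have ma: "automorphy A meromorphic_on uhp"
    unfolding automorphy_def[abs_def] by (intro meromorphic_intros)
  have p: "pullback A f = mero_of (\<lambda>z. F (moebius_action A z))"
    using F A by (simp add: pullback.abs_eq mero_rel_def)
  have a: "autm A ^ n = mero_of (\<lambda>z. automorphy A z ^ n)" for n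
    unfolding autm_eq autm_lifted_def by (simp add: mero_of_power ma)
  have "pullback A f * autm A ^ nat (- k) = mero_of (\<lambda>z. F (moebius_action A z) * automorphy A z ^ nat (- k))"
    unfolding p a by (rule times_mero.abs_eq) (use mF ma in \<open>auto simp: mero_rel_def intro!: meromorphic_intros\<close>)
  also have "\<dots> = mero_of (\<lambda>z. automorphy A z ^ nat k * F z)"
  proof (rule mero_of_eqI)
    have "\<forall>\<^sub>\<approx>z\<in>uhp. F (moebius_action A z) * automorphy A z ^ nat (- k) = automorphy A z ^ nat k * F z"
      using F(3) eventually_cosparse_in
    proof eventually_elim
      case (elim z)
      have j: "automorphy A z \<noteq> 0" by (rule automorphy_nonzero[OF A(2) elim(2)])
      show ?case
        unfolding elim(1)[symmetric] slash_def using j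
        by (cases "k \<ge> 0") (simp_all add: power_int_def field_simps)
    qed
    then show "mero_rel (\<lambda>z. F (moebius_action A z) * automorphy A z ^ nat (- k)) (\<lambda>z. automorphy A z ^ nat k * F z)"
      using mF ma F(2) by (auto simp: mero_rel_def intro!: meromorphic_intros)
  qed
  also have "\<dots> = autm A ^ nat k * f"
    unfolding F(1) a by (rule times_mero.abs_eq[symmetric]) (use F(2) ma in \<open>auto simp: mero_rel_def intro!: meromorphic_intros\<close>)
  finally show ?thesis .
qed

lemma constm_modular_form: "constm c \<in> modular_forms \<Gamma> 0"
proof -
  have "constm c = mero_of (\<lambda>z. c)"
    unfolding constm_def one_mero_def by (subst scale_mero.abs_eq) (auto simp: mero_rel_def)
  moreover have "meromorphic_modular_form \<Gamma> 0 (\<lambda>z. c)"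
    by (auto simp: meromorphic_modular_form_def slash_def meromorphic_at_cusps_def
        intro!: exI[of _ "\<lambda>_. c"] exI[of _ 1])
  ultimately show ?thesis unfolding modular_forms_def by blast
qed

lemma zero_modular_form: "0 \<in> modular_forms \<Gamma> k"
proof -
  have "meromorphic_modular_form \<Gamma> k (\<lambda>z. 0)"
    by (auto simp: meromorphic_modular_form_def slash_def meromorphic_at_cusps_def
        intro!: exI[of _ "\<lambda>_. 0"] exI[of _ 1])
  then show ?thesis unfolding modular_forms_def zero_mero_def by blast
qed

lemma modular_form_odd_zero:
  assumes "f \<in> modular_forms \<Gamma> k" "- mat 1 \<in> \<Gamma>" "odd k"
  shows "f = 0"
proof -
  have d: "det (- mat 1 :: real^2^2) = 1" by (simp add: det_2)
  have a: "autm (- mat 1) = - 1"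
  proof -
    have "constm (-1) = -1" using constm_add[of 1 "-1"] by (simp add: add_eq_0_iff)
    then show ?thesis by (simp add: autm_def)
  qed
  have "f * (-1) ^ nat (- k) = (-1) ^ nat k * f"
    using modular_form_pullback[OF assms(1,2) d] by (simp add: pullback_minus_one a)
  moreover have "odd (nat (-k)) \<and> nat k = 0 \<or> nat (-k) = 0 \<and> odd (nat k)"
    using assms(3) by (cases "k \<ge> 0") (auto simp: even_nat_iff)
  ultimately have "f = - f" by auto
  then have "f + f = 0" by (metis add.right_inverse)
  then have "2 *\<^sub>m f = 0" using mero.scale_left_distrib[of 1 1 f] by simp
  then show ?thesis by simp
qed

section \<open>Transformation polynomials and the lowering operator\<close>

text \<open>The value at \<open>(x, y)\<close> of the homogeneous polynomial of degree \<open>k\<close> whose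
  dehomogenisation is \<open>G\<close>. Storing only \<open>G\<close> turns multiplication of
  homogeneous polynomials into that of univariate ones.\<close>

definition hom_eval :: "nat \<Rightarrow> 'a::comm_ring_1 poly \<Rightarrow> 'a \<Rightarrow> 'a \<Rightarrow> 'a" where
  "hom_eval k G x y = (\<Sum>s\<le>k. coeff G s * x ^ s * y ^ (k - s))"

lemma hom_eval_pCons: "hom_eval (Suc k) (pCons a G) x y = a * y ^ Suc k + x * hom_eval k G x y"
  unfolding hom_eval_def sum.atMost_Suc_shift by (simp add: sum_distrib_left algebra_simps)

lemma hom_eval_zero [simp]: "hom_eval k 0 x y = 0"
  by (simp add: hom_eval_def)

lemma hom_eval_add: "hom_eval k (F + G) x y = hom_eval k F x y + hom_eval k G x y"
  by (simp add: hom_eval_def sum.distrib algebra_simps)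

lemma hom_eval_smult: "hom_eval k (smult a G) x y = a * hom_eval k G x y"
  by (simp add: hom_eval_def sum_distrib_left algebra_simps)

lemma hom_eval_raise:
  assumes "degree G \<le> l"
  shows "hom_eval (k + l) G x y = y ^ k * hom_eval l G x y"
proof -
  have "hom_eval (k + l) G x y = (\<Sum>s\<le>l. coeff G s * x ^ s * y ^ (k + l - s))"
    unfolding hom_eval_def
    by (rule sum.mono_neutral_right) (use assms in \<open>auto simp: coeff_eq_0\<close>)
  also have "\<dots> = (\<Sum>s\<le>l. y ^ k * (coeff G s * x ^ s * y ^ (l - s)))"
    by (rule sum.cong) (auto simp: power_add algebra_simps simp flip: Nat.add_diff_assoc)
  finally show ?thesis by (simp add: hom_eval_def sum_distrib_left)
qed

lemma hom_eval_mult: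
  assumes "degree F \<le> k" "degree G \<le> l"
  shows "hom_eval (k + l) (F * G) x y = hom_eval k F x y * hom_eval l G x y"
  using assms
proof (induction k arbitrary: F)
  case 0
  then obtain a where "F = [:a:]" using degree_eq_zeroE by blast
  then show ?case by (simp add: hom_eval_smult) (simp add: hom_eval_def)
next
  case (Suc k)
  obtain a F' where F: "F = pCons a F'" by (cases F)
  have dF: "degree F' \<le> k" using Suc.prems F by (auto split: if_splits)
  have "F * G = smult a G + pCons 0 (F' * G)" by (simp add: F)
  then have "hom_eval (Suc k + l) (F * G) x y = a * hom_eval (Suc k + l) G x y + hom_eval (Suc (k + l)) (pCons 0 (F' * G)) x y"
    by (simp add: hom_eval_add hom_eval_smult)
  also have "\<dots> = a * (y ^ Suc k * hom_eval l G x y) + x * (hom_eval k F' x y * hom_eval l G x y)"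
    unfolding hom_eval_raise[OF Suc.prems(2)] hom_eval_pCons Suc.IH[OF dF Suc.prems(2)] by simp
  also have "\<dots> = hom_eval (Suc k) F x y * hom_eval l G x y"
    unfolding F hom_eval_pCons by (simp add: algebra_simps)
  finally show ?case .
qed

lemma degree_linear_power_le: "degree ([:1, a:] ^ k) \<le> k"
proof -
  have "degree [:1, a:] * k \<le> 1 * k" by (rule mult_right_mono) simp_all
  with degree_power_le[of "[:1, a:]" k] show ?thesis by (metis mult_1 order.trans)
qed

lemma hom_eval_linear_power:
  "hom_eval k ([:1, a:] ^ k) x y = (a * x + y) ^ k"
proof (induction k)
  case 0
  show ?case by (simp add: hom_eval_def)
next
  case (Suc k)
  have "hom_eval (1 + k) ([:1, a:] * [:1, a:] ^ k) x y = hom_eval 1 [:1, a:] x y * hom_eval k ([:1, a:] ^ k) x y"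
    by (rule hom_eval_mult) (auto simp: degree_linear_power_le)
  then show ?case using Suc by (simp add: hom_eval_def add.commute)
qed

lemma D_mero_sum: "D_mero (\<Sum>i\<in>I. f i) = (\<Sum>i\<in>I. D_mero (f i))"
  by (induction I rule: infinite_finite_induct) (simp_all add: D_mero_add)

lemma D_mero_hom_eval:
  "D_mero (hom_eval k G (constm c) (constm d)) = hom_eval k (map_poly D_mero G) (constm c) (constm d)"
  by (simp add: hom_eval_def D_mero_sum D_mero_mult coeff_map_poly flip: constm_power)

text \<open>Density is a statement about complex polynomials, and here the coefficients are meromorphic
  functions. Taking the coordinates of the coefficients in a basis of the function space over the
  complex numbers reduces the second case to the first.\<close>

lemma independent_over_Zariski_dense:
  fixes G :: "nat \<Rightarrow> mero poly"
  assumes \<Gamma>: "discrete_subgroup_PSL2R \<Gamma>" and cov: "finite_covolume \<Gamma>"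
    and deg: "\<And>k. k \<le> N \<Longrightarrow> degree (G k) \<le> k"
    and zero: "\<And>A. A \<in> \<Gamma> \<Longrightarrow>
      (\<Sum>k\<le>N. hom_eval k (G k) (constm (of_real (A$2$1))) (constm (of_real (A$2$2)))) = 0"
    and k: "k \<le> N"
  shows "G k = 0"
proof (rule poly_eqI)
  fix i
  show "coeff (G k) i = coeff 0 i"
  proof (cases "i \<le> k")
    case False
    then show ?thesis using deg[OF k] by (simp add: coeff_eq_0)
  next
    case i: True
    define B where "B = mero.extend_basis {}"
    have B: "mero.independent B" "mero.span B = UNIV"
      unfolding B_def by (simp_all add: mero.independent_extend_basis mero.independent_empty)
    define rep where "rep = mero.representation B"
    have rep_add: "rep (x + y) b = rep x b + rep y b" for x y b
      using B by (simp add: rep_def mero.representation_add)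
    have rep_scale: "rep (c *\<^sub>m x) b = c * rep x b" for c x b
      using B by (simp add: rep_def mero.representation_scale)
    have rep_0: "rep 0 b = 0" for b
      using rep_scale[of 0 0 b] by simp
    have rep_sum: "rep (\<Sum>i\<in>I. f i) b = (\<Sum>i\<in>I. rep (f i) b)" for f :: "nat \<Rightarrow> mero" and I b
      by (induction I rule: infinite_finite_induct) (simp_all add: rep_add rep_0)
    have coord: "rep (coeff (G k) i) b = 0" for b
    proof -
      define P where "P = (\<Sum>k\<le>N. \<Sum>i\<le>k. monom (monom (rep (coeff (G k) i) b) i) (k - i))"
      have "P = 0"
      proof (rule bottom_rows_Zariski_dense[OF \<Gamma> cov])
        fix A assume A: "A \<in> \<Gamma>"
        let ?c = "of_real (A$2$1) :: complex" and ?d = "of_real (A$2$2) :: complex"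
        have "eval2 P ?c ?d = (\<Sum>k\<le>N. \<Sum>i\<le>k. rep (coeff (G k) i) b * ?c ^ i * ?d ^ (k - i))"
          by (simp add: P_def eval2_def poly_sum poly_monom poly_power)
        also have "\<dots> = (\<Sum>k\<le>N. \<Sum>i\<le>k. rep (coeff (G k) i * constm ?c ^ i * constm ?d ^ (k - i)) b)"
        proof (intro sum.cong refl)
          fix k i
          have "coeff (G k) i * constm ?c ^ i * constm ?d ^ (k - i) = (?c ^ i * ?d ^ (k - i)) *\<^sub>m coeff (G k) i"
            by (simp add: scale_eq_constm constm_mult constm_power algebra_simps)
          then show "rep (coeff (G k) i) b * ?c ^ i * ?d ^ (k - i) = rep (coeff (G k) i * constm ?c ^ i * constm ?d ^ (k - i)) b"
            by (simp add: rep_scale)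
        qed
        also have "\<dots> = rep (\<Sum>k\<le>N. hom_eval k (G k) (constm ?c) (constm ?d)) b"
          by (simp add: rep_sum hom_eval_def)
        finally show "eval2 P ?c ?d = 0" using zero[OF A] by (simp add: rep_0)
      qed
      then have "0 = coeff (coeff P (k - i)) i" by simp
      also have "\<dots> = (\<Sum>k'\<le>N. \<Sum>i'\<le>k'. if k' - i' = k - i \<and> i' = i then rep (coeff (G k') i') b else 0)"
        unfolding P_def coeff_sum by (intro sum.cong refl) auto
      also have "\<dots> = (\<Sum>k'\<le>N. if k' = k then rep (coeff (G k) i) b else 0)"
      proof (intro sum.cong refl)
        fix k'
        have "(\<Sum>i'\<le>k'. if k' - i' = k - i \<and> i' = i then rep (coeff (G k') i') b else 0)
           = (\<Sum>i'\<le>k'. if i' = i then (if k' - i = k - i then rep (coeff (G k') i) b else 0) else 0)"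
          by (intro sum.cong) auto
        also have "\<dots> = (if i \<le> k' then (if k' - i = k - i then rep (coeff (G k') i) b else 0) else 0)"
          by (simp add: sum.delta)
        also have "\<dots> = (if k' = k then rep (coeff (G k) i) b else 0)" using i by auto
        finally show "(\<Sum>i'\<le>k'. if k' - i' = k - i \<and> i' = i then rep (coeff (G k') i') b else 0)
           = (if k' = k then rep (coeff (G k) i) b else 0)" .
      qed
      also have "\<dots> = rep (coeff (G k) i) b" using k by simp
      finally show ?thesis by simp
    qed
    have "coeff (G k) i = (\<Sum>b | rep (coeff (G k) i) b \<noteq> 0. rep (coeff (G k) i) b *\<^sub>m b)"
      unfolding rep_def using B by (intro mero.sum_nonzero_representation_eq[symmetric]) auto
    then show ?thesis by (simp add: coord)
  qed
qed

definition transforms :: "(real^2^2) set \<Rightarrow> nat \<Rightarrow> mero \<Rightarrow> mero poly \<Rightarrow> bool" where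
  "transforms \<Gamma> k f G \<longleftrightarrow> degree G \<le> k \<and>
     (\<forall>A\<in>\<Gamma>. pullback A f = hom_eval k G (constm (of_real (A$2$1))) (constm (of_real (A$2$2))))"

lemma transforms_add: "transforms \<Gamma> k f F \<Longrightarrow> transforms \<Gamma> k g G \<Longrightarrow> transforms \<Gamma> k (f + g) (F + G)"
  by (auto simp: transforms_def pullback_add hom_eval_add intro: degree_add_le)

lemma transforms_scale: "transforms \<Gamma> k f F \<Longrightarrow> transforms \<Gamma> k (c *\<^sub>m f) (smult (constm c) F)"
  by (auto simp: transforms_def pullback_mult pullback_constm hom_eval_smult scale_eq_constm intro: order.trans[OF degree_smult_le])

lemma transforms_zero: "transforms \<Gamma> k 0 0"
  by (simp add: transforms_def)

lemma transforms_mult: "transforms \<Gamma> k f F \<Longrightarrow> transforms \<Gamma> l g G \<Longrightarrow> transforms \<Gamma> (k + l) (f * g) (F * G)"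
  by (auto simp: transforms_def pullback_mult hom_eval_mult intro: order.trans[OF degree_mult_le])

text \<open>By the chain rule, the derivative of \<open>f\<close> transforms by \<open>(c z +
  d)\<^sup>2\<close> times the derivative of the transformed function, and the bottom row is
  constant.\<close>

lemma transforms_D:
  assumes \<Gamma>: "\<And>A. A \<in> \<Gamma> \<Longrightarrow> det A = 1" and f: "transforms \<Gamma> k f F"
  shows "transforms \<Gamma> (k + 2) (D_mero f) ([:1, zvar:]\<^sup>2 * map_poly D_mero F)"
proof -
  have dF: "degree (map_poly D_mero F) \<le> k"
    using f by (auto simp: transforms_def coeff_map_poly coeff_eq_0 intro!: degree_le)
  have d2: "degree ([:1, zvar:]\<^sup>2) \<le> 2" by (rule degree_linear_power_le)
  have "pullback A (D_mero f) = hom_eval (k + 2) ([:1, zvar:]\<^sup>2 * map_poly D_mero F)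
      (constm (of_real (A$2$1))) (constm (of_real (A$2$2)))" if A: "A \<in> \<Gamma>" for A
  proof -
    let ?c = "of_real (A$2$1) :: complex" and ?d = "of_real (A$2$2) :: complex"
    have "pullback A (D_mero f) = (autm A)\<^sup>2 * D_mero (hom_eval k F (constm ?c) (constm ?d))"
      unfolding pullback_D[OF \<Gamma>[OF A]] using f A by (simp add: transforms_def)
    also have "\<dots> = hom_eval 2 ([:1, zvar:]\<^sup>2) (constm ?c) (constm ?d) * hom_eval k (map_poly D_mero F) (constm ?c) (constm ?d)"
      unfolding hom_eval_linear_power D_mero_hom_eval autm_def by (simp add: mult.commute)
    also have "\<dots> = hom_eval (2 + k) ([:1, zvar:]\<^sup>2 * map_poly D_mero F) (constm ?c) (constm ?d)"
      by (rule hom_eval_mult[OF d2 dF, symmetric])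
    finally show ?thesis by (simp add: add.commute)
  qed
  moreover have "degree ([:1, zvar:]\<^sup>2 * map_poly D_mero F) \<le> k + 2"
    using degree_mult_le[of "[:1, zvar:]\<^sup>2" "map_poly D_mero F"] dF d2 by linarith
  ultimately show ?thesis by (simp add: transforms_def)
qed

lemma transforms_modular:
  assumes "\<And>A. A \<in> \<Gamma> \<Longrightarrow> pullback A f = autm A ^ k * f"
  shows "transforms \<Gamma> k f (smult f ([:1, zvar:] ^ k))"
  unfolding transforms_def
proof (intro conjI ballI)
  show "degree (smult f ([:1, zvar:] ^ k)) \<le> k"
    by (rule order.trans[OF degree_smult_le degree_linear_power_le])
  fix A assume "A \<in> \<Gamma>"
  then show "pullback A f = hom_eval k (smult f ([:1, zvar:] ^ k)) (constm (of_real (A$2$1))) (constm (of_real (A$2$2)))"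
    using assms unfolding hom_eval_smult hom_eval_linear_power autm_def by (simp add: mult.commute)
qed

text \<open>The bottom row of the identity is \<open>(0, 1)\<close>.\<close>

lemma transforms_coeff_0:
  assumes "mat 1 \<in> \<Gamma>" "transforms \<Gamma> k f F"
  shows "coeff F 0 = f"
proof -
  have "f = hom_eval k F 0 1"
    using assms by (auto simp: transforms_def pullback_identity)
  also have "\<dots> = coeff F 0"
    unfolding hom_eval_def by (subst sum.remove[of _ 0]) (auto simp: power_0_left intro!: sum.neutral)
  finally show ?thesis by simp
qed

text \<open>In terms of the coordinates \<open>c\<close> and \<open>c z + d\<close>, instead of
  \<open>c\<close> and \<open>d\<close>, this is the coefficient of \<open>c (c z +
  d)\<^sup>k\<^sup>-\<^sup>1\<close>: the partial derivative in the direction in which \<open>c z +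
  d\<close> is fixed. It is stated as a relation because uniqueness depends on the group.\<close>

definition lowering :: "(real^2^2) set \<Rightarrow> nat \<Rightarrow> mero \<Rightarrow> mero \<Rightarrow> bool" where
  "lowering \<Gamma> k f w \<longleftrightarrow> (\<exists>F. transforms \<Gamma> k f F \<and> w = coeff F 1 - of_nat k * zvar * coeff F 0)"

lemma lowering_add: "lowering \<Gamma> k f v \<Longrightarrow> lowering \<Gamma> k g w \<Longrightarrow> lowering \<Gamma> k (f + g) (v + w)"
  unfolding lowering_def using transforms_add by (fastforce simp: algebra_simps)

lemma lowering_scale: "lowering \<Gamma> k f v \<Longrightarrow> lowering \<Gamma> k (c *\<^sub>m f) (c *\<^sub>m v)"
  unfolding lowering_def using transforms_scale by (fastforce simp: algebra_simps scale_eq_constm)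

lemma lowering_zero: "lowering \<Gamma> k 0 0"
  unfolding lowering_def by (rule exI[of _ 0]) (simp add: transforms_zero)

lemma lowering_mult:
  assumes one: "mat 1 \<in> \<Gamma>" and f: "lowering \<Gamma> k f v" and g: "lowering \<Gamma> l g w"
  shows "lowering \<Gamma> (k + l) (f * g) (v * g + f * w)"
proof -
  obtain F where F: "transforms \<Gamma> k f F" "v = coeff F 1 - of_nat k * zvar * coeff F 0"
    using f by (auto simp: lowering_def)
  obtain G where G: "transforms \<Gamma> l g G" "w = coeff G 1 - of_nat l * zvar * coeff G 0"
    using g by (auto simp: lowering_def)
  have 0: "coeff F 0 = f" "coeff G 0 = g"
    using transforms_coeff_0[OF one] F(1) G(1) by auto
  have "v * g + f * w = coeff (F * G) 1 - of_nat (k + l) * zvar * coeff (F * G) 0"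
    unfolding F(2) G(2) by (simp add: coeff_mult 0 algebra_simps)
  with transforms_mult[OF F(1) G(1)] show ?thesis unfolding lowering_def by blast
qed

text \<open>The commutation relation of \<open>sl\<^sub>2\<close>.\<close>

lemma lowering_D:
  assumes \<Gamma>: "\<And>A. A \<in> \<Gamma> \<Longrightarrow> det A = 1" and one: "mat 1 \<in> \<Gamma>" and f: "lowering \<Gamma> k f v"
  shows "lowering \<Gamma> (k + 2) (D_mero f) (D_mero v + of_nat k *\<^sub>m f)"
proof -
  obtain F where F: "transforms \<Gamma> k f F" "v = coeff F 1 - of_nat k * zvar * coeff F 0"
    using f by (auto simp: lowering_def)
  have 0: "coeff F 0 = f" using transforms_coeff_0[OF one F(1)] .
  define H where "H = [:1, zvar:]\<^sup>2 * map_poly D_mero F"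
  have sq: "[:1, zvar:]\<^sup>2 = [:1, 2 * zvar, zvar * zvar:]" by (simp add: power2_eq_square)
  have H: "coeff H 0 = D_mero f" "coeff H 1 = D_mero (coeff F 1) + 2 * zvar * D_mero f"
    unfolding H_def sq by (simp_all add: coeff_mult coeff_map_poly 0 algebra_simps)
  have "D_mero v = D_mero (coeff F 1) - (of_nat k * f + of_nat k * zvar * D_mero f)"
  proof -
    have "v + of_nat k * (zvar * f) = coeff F 1" by (simp add: F(2) 0 algebra_simps)
    then have "D_mero v + D_mero (of_nat k * (zvar * f)) = D_mero (coeff F 1)"
      by (simp flip: D_mero_add)
    moreover have "D_mero (of_nat k) = 0" by (simp flip: constm_of_nat)
    ultimately show ?thesis by (simp add: D_mero_mult algebra_simps)
  qed
  then have "D_mero v + of_nat k *\<^sub>m f = coeff H 1 - of_nat (k + 2) * zvar * coeff H 0"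
    unfolding H by (simp add: scale_eq_constm constm_of_nat algebra_simps)
  with transforms_D[OF \<Gamma> F(1)] show ?thesis unfolding lowering_def H_def by blast
qed

lemma lowering_modular:
  assumes "\<And>A. A \<in> \<Gamma> \<Longrightarrow> pullback A f = autm A ^ k * f"
  shows "lowering \<Gamma> k f 0"
proof -
  have "coeff ([:1, zvar:] ^ k) 0 = 1" "coeff ([:1, zvar:] ^ k) 1 = of_nat k * zvar"
    by (induction k) (simp_all add: coeff_mult algebra_simps)
  then have "0 = coeff (smult f ([:1, zvar:] ^ k)) 1 - of_nat k * zvar * coeff (smult f ([:1, zvar:] ^ k)) 0"
    by simp
  with transforms_modular[OF assms] show ?thesis unfolding lowering_def by blast
qed

text \<open>Directness of the grading: the coefficient of degree \<open>k\<close> in the bottom row is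
  separated from the others by density.\<close>

lemma transforms_sum_zero:
  assumes \<Gamma>: "discrete_subgroup_PSL2R \<Gamma>" and cov: "finite_covolume \<Gamma>"
    and f: "\<And>k. k \<le> N \<Longrightarrow> transforms \<Gamma> k (f k) (F k)" and sum: "(\<Sum>k\<le>N. f k) = 0" and k: "k \<le> N"
  shows "F k = 0" "f k = 0"
proof -
  show F0: "F k = 0"
  proof (rule independent_over_Zariski_dense[OF \<Gamma> cov _ _ k])
    show "degree (F k) \<le> k" if "k \<le> N" for k using f[OF that] by (simp add: transforms_def)
    fix A assume A: "A \<in> \<Gamma>"
    have "(\<Sum>k\<le>N. hom_eval k (F k) (constm (of_real (A$2$1))) (constm (of_real (A$2$2)))) = pullback A (\<Sum>k\<le>N. f k)"
      unfolding pullback_sum using f A by (intro sum.cong) (auto simp: transforms_def)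
    then show "(\<Sum>k\<le>N. hom_eval k (F k) (constm (of_real (A$2$1))) (constm (of_real (A$2$2)))) = 0"
      by (simp add: sum)
  qed
  have "mat 1 \<in> \<Gamma>" using \<Gamma> by (simp add: discrete_subgroup_PSL2R_def)
  from transforms_coeff_0[OF this f[OF k]] show "f k = 0" by (simp add: F0)
qed

lemma lowering_unique:
  assumes \<Gamma>: "discrete_subgroup_PSL2R \<Gamma>" and cov: "finite_covolume \<Gamma>"
    and "lowering \<Gamma> k f v" "lowering \<Gamma> k f w"
  shows "v = w"
proof -
  have "lowering \<Gamma> k (f + (-1) *\<^sub>m f) (v + (-1) *\<^sub>m w)"
    using assms by (intro lowering_add lowering_scale)
  then have "lowering \<Gamma> k 0 (v - w)" by simp
  then obtain F where F: "transforms \<Gamma> k 0 F" "v - w = coeff F 1 - of_nat k * zvar * coeff F 0"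
    by (auto simp: lowering_def)
  have "F = 0"
    using transforms_sum_zero(1)[OF \<Gamma> cov, of k "\<lambda>_. 0" "\<lambda>n. if n = k then F else 0" k] F(1)
    by (simp add: transforms_zero)
  then show ?thesis using F(2) by simp
qed

section \<open>Independence and bases modulo a subspace\<close>

text \<open>Subtracting the components in \<open>W\<close> turns a family that is independent modulo
  \<open>W\<close> into an independent family in the span of \<open>T\<close>.\<close>

lemma independent_modulo_bound:
  assumes W: "mero.subspace W" and ind: "independent_modulo W I b" and fin: "finite I" "finite T"
    and sub: "\<And>i. i \<in> I \<Longrightarrow> b i \<in> mero.span (T \<union> W)"
  shows "card I \<le> card T"
proof -
  have "\<exists>t w. b i = t + w \<and> t \<in> mero.span T \<and> w \<in> W" if "i \<in> I" for i
    using sub[OF that] unfolding mero.span_Un mero.span_eq_iff[THEN iffD2, OF W] by blast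
  then obtain t w where tw: "\<And>i. i \<in> I \<Longrightarrow> b i = t i + w i \<and> t i \<in> mero.span T \<and> w i \<in> W"
    by metis
  have free: "c i = 0" if "(\<Sum>i\<in>I. c i *\<^sub>m t i) = 0" "i \<in> I" for c i
  proof -
    have "(\<Sum>i\<in>I. c i *\<^sub>m b i) = (\<Sum>i\<in>I. c i *\<^sub>m t i) + (\<Sum>i\<in>I. c i *\<^sub>m w i)"
      unfolding sum.distrib[symmetric] by (intro sum.cong) (auto simp: tw mero.scale_right_distrib)
    also have "\<dots> = (\<Sum>i\<in>I. c i *\<^sub>m w i)" using that by simp
    also have "\<dots> \<in> W" using tw by (intro mero.subspace_sum[OF W] mero.subspace_scale[OF W]) auto
    finally show ?thesis using ind that(2) unfolding independent_modulo_def by blast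
  qed
  have inj: "inj_on t I"
  proof (rule inj_onI, rule ccontr)
    fix i j assume ij: "i \<in> I" "j \<in> I" "t i = t j" "i \<noteq> j"
    define c where "c k = (if k = i then 1 else if k = j then -1 else 0 :: complex)" for k
    have "(\<Sum>k\<in>I. c k *\<^sub>m t k) = (\<Sum>k\<in>{i, j}. c k *\<^sub>m t k)"
      by (rule sum.mono_neutral_right) (use ij fin in \<open>auto simp: c_def\<close>)
    also have "\<dots> = 0" using ij by (simp add: c_def)
    finally show False using free[of c i] ij by (simp add: c_def)
  qed
  have "mero.independent (t ` I)"
  proof
    assume "mero.dependent (t ` I)"
    then obtain u where u: "\<exists>v\<in>t ` I. u v \<noteq> 0" "(\<Sum>v\<in>t ` I. u v *\<^sub>m v) = 0"
      using mero.dependent_finite[of "t ` I"] fin by auto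
    have "(\<Sum>i\<in>I. u (t i) *\<^sub>m t i) = 0" using u(2) by (simp add: sum.reindex[OF inj])
    with free[of "u \<circ> t"] u(1) show False by auto
  qed
  from mero.independent_span_bound[OF fin(2) this] tw have "card (t ` I) \<le> card T" by auto
  then show ?thesis by (simp add: card_image[OF inj])
qed

lemma quotient_basis_span:
  assumes "quotient_basis V W I b" "v \<in> V"
  shows "v \<in> mero.span (b ` I \<union> W)"
proof -
  obtain c where c: "v - (\<Sum>i\<in>I. c i *\<^sub>m b i) \<in> W"
    using assms unfolding quotient_basis_def by blast
  have "(v - (\<Sum>i\<in>I. c i *\<^sub>m b i)) + (\<Sum>i\<in>I. c i *\<^sub>m b i) \<in> mero.span (b ` I \<union> W)"
    using c by (intro mero.span_add mero.span_sum mero.span_scale) (auto intro: mero.span_base)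
  then show ?thesis by simp
qed

lemma quotient_basis_card_unique:
  assumes W: "mero.subspace W" and b: "quotient_basis V W I b" and b': "quotient_basis V W I' b'"
  shows "card I = card I'"
proof -
  have le: "card K \<le> card L" if K: "quotient_basis V W K p" and L: "quotient_basis V W L q"
    for K p and L q
  proof -
    have "card K \<le> card (q ` L)"
      by (rule independent_modulo_bound[OF W, of _ p])
         (use K L quotient_basis_span[OF L] in \<open>auto simp: quotient_basis_def\<close>)
    also have "\<dots> \<le> card L" using L by (intro card_image_le) (simp add: quotient_basis_def)
    finally show ?thesis .
  qed
  from le[OF b b'] le[OF b' b] show ?thesis by simp
qed

lemma quotient_dim_eqI:
  assumes W: "mero.subspace W" and b: "quotient_basis V W {..<n} b"
  shows "quotient_dim V W = n"
proof -
  have "(SOME n. \<exists>b. quotient_basis V W {..<n} b) = n"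
    by (rule some_equality) (use b quotient_basis_card_unique[OF W b] in force)+
  then show ?thesis using b unfolding quotient_dim_def by auto
qed

lemma independent_modulo_extend:
  assumes W: "mero.subspace W" and ind: "independent_modulo W {..<n} b"
    and v: "\<And>c. v - (\<Sum>i<n. c i *\<^sub>m b i) \<notin> W"
  shows "independent_modulo W {..<Suc n} (b(n := v))"
  unfolding independent_modulo_def
proof (intro allI impI)
  fix c assume "(\<Sum>i<Suc n. c i *\<^sub>m (b(n := v)) i) \<in> W"
  then have c: "(\<Sum>i<n. c i *\<^sub>m b i) + c n *\<^sub>m v \<in> W" by simp
  have cn: "c n = 0"
  proof (rule ccontr)
    assume nz: "c n \<noteq> 0"
    have "(1 / c n) *\<^sub>m ((\<Sum>i<n. c i *\<^sub>m b i) + c n *\<^sub>m v) \<in> W"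
      by (rule mero.subspace_scale[OF W c])
    also have "(1 / c n) *\<^sub>m ((\<Sum>i<n. c i *\<^sub>m b i) + c n *\<^sub>m v) = v - (\<Sum>i<n. (- c i / c n) *\<^sub>m b i)"
      using nz by (simp add: mero.scale_right_distrib mero.scale_sum_right sum_negf[symmetric] del: sum_negf)
    finally show False using v[of "\<lambda>i. - c i / c n"] by contradiction
  qed
  with c ind have "\<forall>i<n. c i = 0" unfolding independent_modulo_def by auto
  with cn show "\<forall>i\<in>{..<Suc n}. c i = 0" by (auto simp: less_Suc_eq)
qed

text \<open>A vector outside the span modulo \<open>W\<close> would extend the family.\<close>

lemma maximal_independent_modulo_basis:
  assumes W: "mero.subspace W" and ind: "independent_modulo W {..<n} b" and bV: "b ` {..<n} \<subseteq> V"
    and max: "\<And>b'. b' ` {..<Suc n} \<subseteq> V \<Longrightarrow> \<not> independent_modulo W {..<Suc n} b'"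
  shows "quotient_basis V W {..<n} b"
  unfolding quotient_basis_def
proof (intro conjI ballI ind bV)
  fix v assume v: "v \<in> V"
  show "\<exists>c. v - (\<Sum>i<n. c i *\<^sub>m b i) \<in> W"
  proof (rule ccontr)
    assume "\<nexists>c. v - (\<Sum>i<n. c i *\<^sub>m b i) \<in> W"
    then have "independent_modulo W {..<Suc n} (b(n := v))"
      by (intro independent_modulo_extend[OF W ind]) blast
    moreover have "(b(n := v)) ` {..<Suc n} \<subseteq> V" using v bV by (auto simp: less_Suc_eq)
    ultimately show False using max by blast
  qed
qed simp

lemma quotient_basis_exists:
  assumes W: "mero.subspace W" and T: "finite T" "V \<subseteq> mero.span (T \<union> W)"
  obtains n b where "quotient_basis V W {..<n::nat} b"
proof -
  define P where "P n \<longleftrightarrow> (\<exists>b. independent_modulo W {..<n} b \<and> b ` {..<n} \<subseteq> V)" for n :: nat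
  have bound: "n \<le> card T" if "P n" for n
    using that T independent_modulo_bound[OF W, of "{..<n}" _ T] unfolding P_def by fastforce
  have "P 0" by (auto simp: P_def independent_modulo_def)
  then have P: "P (GREATEST n. P n)" using bound by (rule GreatestI_nat)
  have nP: "\<not> P (Suc (GREATEST n. P n))"
    using Greatest_le_nat[of P "Suc (GREATEST n. P n)" "card T"] bound by auto
  obtain b where b: "independent_modulo W {..<(GREATEST n. P n)} b" "b ` {..<(GREATEST n. P n)} \<subseteq> V"
    using P unfolding P_def by blast
  have "quotient_basis V W {..<(GREATEST n. P n)} b"
    by (rule maximal_independent_modulo_basis[OF W b]) (use nP in \<open>unfold P_def, blast\<close>)
  then show thesis by (rule that)
qed

text \<open>Finite-dimensionality of the quotient guarantees that \<open>quotient_dim\<close> is not its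
  default value.\<close>

lemma independent_modulo_quotient_dim_basis:
  assumes W: "mero.subspace W" and T: "finite T" "V \<subseteq> mero.span (T \<union> W)"
    and n: "n = quotient_dim V W" and ind: "independent_modulo W {..<n} b" and bV: "b ` {..<n} \<subseteq> V"
  shows "quotient_basis V W {..<n} b"
proof -
  obtain m p where p: "quotient_basis V W {..<m::nat} p" by (rule quotient_basis_exists[OF W T])
  have m: "m = n" using quotient_dim_eqI[OF W p] n by simp
  have "\<not> independent_modulo W {..<Suc n} b'" if b': "b' ` {..<Suc n} \<subseteq> V" for b'
  proof
    assume "independent_modulo W {..<Suc n} b'"
    then have "card {..<Suc n} \<le> card (p ` {..<m})"
      by (rule independent_modulo_bound[OF W]) (use b' quotient_basis_span[OF p] in auto)
    also have "\<dots> \<le> card {..<m}" by (rule card_image_le) simp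
    finally show False using m by simp
  qed
  then show ?thesis by (rule maximal_independent_modulo_basis[OF W ind bV])
qed

section \<open>The weight grading of the differential closure\<close>

lemma span_graded:
  fixes V :: "nat \<Rightarrow> mero set"
  assumes V: "\<And>k. mero.subspace (V k)" and x: "x \<in> mero.span (\<Union>k. V k)"
  shows "\<exists>N g. (\<forall>k. g k \<in> V k) \<and> (\<forall>k>N. g k = 0) \<and> x = (\<Sum>k\<le>N. g k)"
proof -
  define P where "P x N g \<longleftrightarrow> (\<forall>k. g k \<in> V k) \<and> (\<forall>k>N. g k = 0) \<and> x = (\<Sum>k\<le>N. g k)" for x and N :: nat and g
  have raise: "P x N' g" if "P x N g" "N \<le> N'" for x N N' g
  proof -
    have "(\<Sum>k\<le>N'. g k) = (\<Sum>k\<le>N. g k)"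
      by (rule sum.mono_neutral_right) (use that in \<open>auto simp: P_def\<close>)
    then show ?thesis using that by (auto simp: P_def)
  qed
  have "mero.subspace {x. \<exists>N g. P x N g}"
  proof (rule mero.subspaceI)
    show "0 \<in> {x. \<exists>N g. P x N g}"
      using mero.subspace_0[OF V] by (auto simp: P_def intro!: exI[of _ "\<lambda>_. 0"])
    fix x y assume "x \<in> {x. \<exists>N g. P x N g}" "y \<in> {x. \<exists>N g. P x N g}"
    then obtain N g N' g' where "P x N g" "P y N' g'" by blast
    then have "P x (max N N') g" "P y (max N N') g'" by (auto intro: raise)
    then have "P (x + y) (max N N') (\<lambda>k. g k + g' k)"
      using mero.subspace_add[OF V] by (auto simp: P_def sum.distrib)
    then show "x + y \<in> {x. \<exists>N g. P x N g}" by blast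
  next
    fix c x assume "x \<in> {x. \<exists>N g. P x N g}"
    then obtain N g where "P x N g" by blast
    then have "P (c *\<^sub>m x) N (\<lambda>k. c *\<^sub>m g k)"
      using mero.subspace_scale[OF V] by (auto simp: P_def mero.scale_sum_right)
    then show "c *\<^sub>m x \<in> {x. \<exists>N g. P x N g}" by blast
  qed
  moreover have "(\<Union>k. V k) \<subseteq> {x. \<exists>N g. P x N g}"
  proof
    fix v assume "v \<in> (\<Union>k. V k)"
    then obtain m where "v \<in> V m" by blast
    then have "P v m (\<lambda>k. if k = m then v else 0)"
      using mero.subspace_0[OF V] by (auto simp: P_def)
    then show "v \<in> {x. \<exists>N g. P x N g}" by blast
  qed
  ultimately have "mero.span (\<Union>k. V k) \<subseteq> {x. \<exists>N g. P x N g}"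
    by (intro mero.span_minimal)
  then show ?thesis using x unfolding P_def by blast
qed

lemma mult_in_span:
  assumes x: "x \<in> mero.span A" and y: "y \<in> mero.span B"
    and AB: "\<And>a b. a \<in> A \<Longrightarrow> b \<in> B \<Longrightarrow> a * b \<in> mero.span C"
  shows "x * y \<in> mero.span C"
proof -
  have 1: "a * y \<in> mero.span C" if a: "a \<in> A" for a
    using y
  proof (induction rule: mero.span_induct_alt)
    case base
    show ?case by (simp add: mero.span_zero)
  next
    case (step c b y)
    then show ?case
      by (auto simp: distrib_left scale_mult_right intro!: mero.span_add mero.span_scale AB a)
  qed
  show ?thesis
    using x
  proof (induction rule: mero.span_induct_alt)
    case base
    show ?case by (simp add: mero.span_zero)
  next
    case (step c a x)
    then show ?case
      by (auto simp: distrib_right scale_mult_left intro!: mero.span_add mero.span_scale 1)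
  qed
qed

lemma scalar_in_constants: "constm c \<in> constants"
  by (auto simp: constants_def constm_def)

lemma constantsE: "f \<in> constants \<Longrightarrow> (\<And>c. f = constm c \<Longrightarrow> thesis) \<Longrightarrow> thesis"
  by (auto simp: constants_def constm_def)

lemma subring_generated_algebra:
  "subring_mero (generated_algebra S)" "constants \<subseteq> generated_algebra S" "S \<subseteq> generated_algebra S"
proof -
  have "subring_mero (generated_algebra S) \<and> constants \<subseteq> generated_algebra S"
    unfolding generated_algebra_def by (rule hull_in) (auto simp: subring_mero_def)
  then show "subring_mero (generated_algebra S)" "constants \<subseteq> generated_algebra S" by auto
  show "S \<subseteq> generated_algebra S" unfolding generated_algebra_def by (rule hull_subset)
qed

lemma subring_mero_closed:
  assumes "subring_mero R"
  shows "0 \<in> R" "1 \<in> R" "f \<in> R \<Longrightarrow> - f \<in> R" "f \<in> R \<Longrightarrow> g \<in> R \<Longrightarrow> f + g \<in> R" "f \<in> R \<Longrightarrow> g \<in> R \<Longrightarrow> f * g \<in> R"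
proof -
  show 1: "1 \<in> R" using assms by (simp add: subring_mero_def)
  then have "1 - 1 \<in> R" using assms unfolding subring_mero_def by blast
  then show 0: "0 \<in> R" by simp
  have minus: "- f \<in> R" if "f \<in> R" for f
  proof -
    have "0 - f \<in> R" using assms 0 that unfolding subring_mero_def by blast
    then show ?thesis by simp
  qed
  then show "f \<in> R \<Longrightarrow> - f \<in> R" .
  show "f + g \<in> R" if "f \<in> R" "g \<in> R"
  proof -
    have "f - (- g) \<in> R" using assms minus that unfolding subring_mero_def by blast
    then show ?thesis by simp
  qed
  show "f \<in> R \<Longrightarrow> g \<in> R \<Longrightarrow> f * g \<in> R" using assms unfolding subring_mero_def by blast
qed

lemma generated_algebra_minimal:
  "S \<subseteq> R \<Longrightarrow> subring_mero R \<Longrightarrow> constants \<subseteq> R \<Longrightarrow> generated_algebra S \<subseteq> R"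
  unfolding generated_algebra_def by (rule hull_minimal) auto

text \<open>Sums and products of generators with a record of their weight. Every modular form in the generated
  algebra is of this kind, but this already depends on the directness of the grading.\<close>

inductive generated_form :: "(real^2^2) set \<Rightarrow> mero set \<Rightarrow> nat \<Rightarrow> mero \<Rightarrow> bool" for \<Gamma> S where
  const: "generated_form \<Gamma> S 0 (constm c)"
| gen: "g \<in> S \<Longrightarrow> g \<in> modular_forms \<Gamma> (int k) \<Longrightarrow> k > 0 \<Longrightarrow> generated_form \<Gamma> S k g"
| zero: "generated_form \<Gamma> S k 0"
| add: "generated_form \<Gamma> S k f \<Longrightarrow> generated_form \<Gamma> S k g \<Longrightarrow> generated_form \<Gamma> S k (f + g)"
| mult: "generated_form \<Gamma> S k f \<Longrightarrow> generated_form \<Gamma> S l g \<Longrightarrow> generated_form \<Gamma> S (k + l) (f * g)"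

lemma generated_form_subspace: "mero.subspace {f. generated_form \<Gamma> S k f}"
proof (rule mero.subspaceI)
  fix c f assume "f \<in> {f. generated_form \<Gamma> S k f}"
  then have "generated_form \<Gamma> S (0 + k) (constm c * f)" by (intro generated_form.mult generated_form.const) simp
  then show "c *\<^sub>m f \<in> {f. generated_form \<Gamma> S k f}" by (simp add: scale_eq_constm)
qed (auto intro: generated_form.intros)

locale modular_algebra =
  fixes \<Gamma> :: "(real^2^2) set" and S :: "mero set"
  assumes discrete: "discrete_subgroup_PSL2R \<Gamma>" and covolume: "finite_covolume \<Gamma>"
    and generators_modular: "\<And>g. g \<in> S \<Longrightarrow> \<exists>k>0. g \<in> modular_forms \<Gamma> k"
begin

abbreviation "M \<equiv> generated_algebra S"
abbreviation "CW \<equiv> closure_weight_part \<Gamma> M"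
abbreviation "J \<equiv> closure_positive_ideal \<Gamma> M"
abbreviation "J2 \<equiv> ideal_square J"

lemma det_one: "A \<in> \<Gamma> \<Longrightarrow> det A = 1"
  and one_in: "mat 1 \<in> \<Gamma>" and minus_one_in: "- mat 1 \<in> \<Gamma>"
  using discrete by (auto simp: discrete_subgroup_PSL2R_def)

lemma algebra_decomposition:
  assumes "f \<in> M"
  obtains N g where "\<And>k. generated_form \<Gamma> S k (g k)" "f = (\<Sum>k\<le>N. g k)" "\<And>k. k > N \<Longrightarrow> g k = 0"
proof -
  define X where "X = mero.span (\<Union>k. {f. generated_form \<Gamma> S k f})"
  have "M \<subseteq> X"
  proof (rule generated_algebra_minimal)
    show "S \<subseteq> X"
    proof
      fix g assume g: "g \<in> S"
      then obtain k where "k > 0" "g \<in> modular_forms \<Gamma> k" using generators_modular by blast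
      then have "generated_form \<Gamma> S (nat k) g" using g by (intro generated_form.gen) auto
      then show "g \<in> X" unfolding X_def by (intro mero.span_base) blast
    qed
    have const: "constm c \<in> X" for c
      unfolding X_def by (intro mero.span_base) (auto intro: generated_form.const)
    then show "constants \<subseteq> X" by (auto elim: constantsE)
    have mult: "x * y \<in> X" if "x \<in> X" "y \<in> X" for x y
      using that unfolding X_def
      by (rule mult_in_span) (auto intro!: mero.span_base intro: generated_form.mult)
    show "subring_mero X"
      unfolding subring_mero_def using const[of 1] mult by (auto simp: X_def intro: mero.span_diff)
  qed
  with assms have "f \<in> X" by blast
  from span_graded[OF generated_form_subspace this[unfolded X_def]] that show thesis by blast
qed

lemma CW_zero: "0 \<in> CW k"
  unfolding closure_weight_part_def
  by (auto intro!: closure_homogeneous.base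
      simp: weight_part_def zero_modular_form subring_mero_closed[OF subring_generated_algebra(1)])

lemma CW_add: "f \<in> CW k \<Longrightarrow> g \<in> CW k \<Longrightarrow> f + g \<in> CW k"
  by (auto simp: closure_weight_part_def intro: closure_homogeneous.add)

lemma CW_mult: "f \<in> CW k \<Longrightarrow> g \<in> CW l \<Longrightarrow> f * g \<in> CW (k + l)"
  by (auto simp: closure_weight_part_def intro: closure_homogeneous.mult)

lemma CW_D: "f \<in> CW k \<Longrightarrow> D_mero f \<in> CW (k + 2)"
  by (auto simp: closure_weight_part_def intro: closure_homogeneous.D)

lemma CW_const: "constm c \<in> CW 0"
proof -
  have "constm c \<in> weight_part \<Gamma> M 0"
    using subring_generated_algebra(2)[of S] scalar_in_constants[of c] constm_modular_form[of c \<Gamma>]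
    unfolding weight_part_def by blast
  then show ?thesis unfolding closure_weight_part_def by (auto intro: closure_homogeneous.base)
qed

lemma CW_scale: "f \<in> CW k \<Longrightarrow> c *\<^sub>m f \<in> CW k"
  using CW_mult[OF CW_const, of f k c] by (simp add: scale_eq_constm)

lemma subspace_CW: "mero.subspace (CW k)"
  by (intro mero.subspaceI CW_zero CW_add CW_scale)

lemma subspace_J2: "mero.subspace J2"
  unfolding ideal_square_def by (rule mero.subspace_span)

lemma CW_subset_J: "k > 0 \<Longrightarrow> CW k \<subseteq> J"
  unfolding closure_positive_ideal_def by (auto intro!: mero.span_base)

lemma J_mult: "f \<in> J \<Longrightarrow> g \<in> J \<Longrightarrow> f * g \<in> J2"
  unfolding ideal_square_def by (auto intro!: mero.span_base)

lemma D_J: "f \<in> J \<Longrightarrow> D_mero f \<in> J"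
  unfolding closure_positive_ideal_def
proof (induction rule: mero.span_induct_alt)
  case base
  show ?case by (simp add: mero.span_zero)
next
  case (step c x y)
  then obtain k where "k > 0" "x \<in> CW k" by auto
  then have "D_mero x \<in> (\<Union>k\<in>{0<..}. CW k)" using CW_D[of x k] by auto
  then show ?case
    using step unfolding D_mero_add D_mero_scale
    by (intro mero.span_add mero.span_scale) (auto intro: mero.span_base)
qed

lemma D_J2: "f \<in> J2 \<Longrightarrow> D_mero f \<in> J2"
  unfolding ideal_square_def
proof (induction rule: mero.span_induct_alt)
  case base
  show ?case by (simp add: mero.span_zero)
next
  case (step c x y)
  then obtain a b where ab: "x = a * b" "a \<in> J" "b \<in> J" by auto
  have prod: "f * g \<in> mero.span {f * g |f g. f \<in> J \<and> g \<in> J}" if "f \<in> J" "g \<in> J" for f g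
    using that by (intro mero.span_base) blast
  have "D_mero x \<in> mero.span {f * g |f g. f \<in> J \<and> g \<in> J}"
    unfolding ab(1) D_mero_mult by (intro mero.span_add prod D_J ab(2,3))
  then show ?case
    using step unfolding D_mero_add D_mero_scale by (intro mero.span_add mero.span_scale)
qed

definition derivatives :: "nat \<Rightarrow> mero set" where
  "derivatives k = {(D_mero ^^ n) g | g n l. g \<in> S \<and> g \<in> modular_forms \<Gamma> (int l) \<and> l > 0 \<and> l + 2 * n = k}"

lemma D_derivatives: "f \<in> derivatives k \<Longrightarrow> D_mero f \<in> derivatives (k + 2)"
proof -
  assume "f \<in> derivatives k"
  then obtain g n l where "f = (D_mero ^^ n) g" "g \<in> S" "g \<in> modular_forms \<Gamma> (int l)" "l > 0" "l + 2 * n = k"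
    unfolding derivatives_def by blast
  then have "D_mero f = (D_mero ^^ Suc n) g \<and> g \<in> S \<and> g \<in> modular_forms \<Gamma> (int l) \<and> l > 0 \<and> l + 2 * Suc n = k + 2"
    by simp
  then show ?thesis unfolding derivatives_def by blast
qed

lemma D_span_derivatives:
  "f \<in> mero.span (derivatives k \<union> J2) \<Longrightarrow> D_mero f \<in> mero.span (derivatives (k + 2) \<union> J2)"
proof (induction rule: mero.span_induct_alt)
  case base
  show ?case by (simp add: mero.span_zero)
next
  case (step c x y)
  then have "D_mero x \<in> derivatives (k + 2) \<union> J2" using D_derivatives D_J2 by auto
  then show ?case
    using step unfolding D_mero_add D_mero_scale
    by (intro mero.span_add mero.span_scale) (auto intro: mero.span_base)
qed

text \<open>A product of two forms of positive weight is decomposable, so in positive weight only the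
  generators themselves survive modulo \<open>J2\<close>.\<close>

lemma generated_form_facts:
  assumes "generated_form \<Gamma> S k f"
  shows "f \<in> CW (int k) \<and> (\<forall>A\<in>\<Gamma>. pullback A f = autm A ^ k * f) \<and> (k = 0 \<longrightarrow> f \<in> constants) \<and>
    (k > 0 \<longrightarrow> f \<in> mero.span (S \<inter> modular_forms \<Gamma> (int k) \<union> J2))"
  using assms
proof induction
  case (const c)
  show ?case by (simp add: CW_const pullback_constm scalar_in_constants)
next
  case (gen g k)
  have "g \<in> CW (int k)"
    using gen subring_generated_algebra(3)[of S]
    by (auto simp: closure_weight_part_def weight_part_def intro!: closure_homogeneous.base)
  moreover have "pullback A g = autm A ^ k * g" if "A \<in> \<Gamma>" for A
    using modular_form_pullback[OF gen(2) that det_one[OF that]] by simp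
  ultimately show ?case using gen by (auto intro: mero.span_base)
next
  case (zero k)
  show ?case using scalar_in_constants[of 0] by (simp add: CW_zero mero.span_zero)
next
  case (add k f g)
  have "f + g \<in> constants" if "f \<in> constants" "g \<in> constants"
    using that scalar_in_constants by (metis constantsE constm_add)
  then show ?case using add by (auto simp: pullback_add algebra_simps intro: CW_add mero.span_add)
next
  case (mult k f l g)
  have cm: "constm c * x \<in> mero.span T" if "x \<in> mero.span T" for c x T
    using mero.span_scale[OF that, of c] by (simp add: scale_eq_constm)
  have "f * g \<in> constants" if "k + l = 0"
    using that mult scalar_in_constants by (metis constantsE constm_mult add_is_0)
  moreover have "f * g \<in> mero.span (S \<inter> modular_forms \<Gamma> (int (k + l)) \<union> J2)" if pos: "k + l > 0"
  proof -
    consider "k = 0" "l > 0" | "l = 0" "k > 0" | "k > 0" "l > 0" using pos by linarith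
    then show ?thesis
    proof cases
      case 1
      then show ?thesis using mult cm by (auto elim!: constantsE)
    next
      case 2
      then show ?thesis using mult cm by (auto elim!: constantsE simp: mult.commute)
    next
      case 3
      then have "f \<in> J" "g \<in> J" using mult CW_subset_J[of "int k"] CW_subset_J[of "int l"] by auto
      then show ?thesis by (intro mero.span_base) (auto intro: J_mult)
    qed
  qed
  ultimately show ?case
    using mult CW_mult[of f "int k" g "int l"] by (simp add: pullback_mult power_add algebra_simps)
qed

lemma graded_zero:
  assumes "\<And>n. n \<le> N \<Longrightarrow> \<exists>F. transforms \<Gamma> n (h n) F" "(\<Sum>n\<le>N. h n) = 0" "n \<le> N"
  shows "h n = 0"
proof -
  obtain F where "\<And>n. n \<le> N \<Longrightarrow> transforms \<Gamma> n (h n) (F n)" using assms(1) by metis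
  from transforms_sum_zero(2)[OF discrete covolume this assms(2,3)] show ?thesis .
qed

text \<open>If \<open>f\<close> has weight \<open>- m < 0\<close>, then multiplying its decomposition
  \<open>\<Sum>n. g n\<close> by \<open>(c z + d)\<^sup>m\<close> after pulling back gives \<open>f
  = \<Sum>n. g n (c z + d)\<^sup>n\<^sup>+\<^sup>m\<close>. The left side has degree 0 in the bottom
  row and all terms on the right have positive degree.\<close>

lemma negative_weight_zero:
  assumes "f \<in> weight_part \<Gamma> M k" "k < 0"
  shows "f = 0"
proof -
  have fM: "f \<in> M" and fk: "f \<in> modular_forms \<Gamma> k" using assms by (auto simp: weight_part_def)
  obtain N g where g: "\<And>n. generated_form \<Gamma> S n (g n)" "f = (\<Sum>n\<le>N. g n)"
    using algebra_decomposition[OF fM] by metis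
  define m where "m = nat (- k)"
  have m: "m > 0" using assms by (simp add: m_def)
  \<comment> \<open>the summand in degree 0 is the only one that contains \<open>f\<close>; all others start in
    degree \<open>m > 0\<close>\<close>
  define G where "G n = (if n < m then 0 else smult (g (n - m)) ([:1, zvar:] ^ n)) + (if n = 0 then [:- f:] else 0)" for n
  have "G 0 = 0"
  proof (rule independent_over_Zariski_dense[OF discrete covolume])
    show "degree (G n) \<le> n" for n
      unfolding G_def by (auto intro!: degree_add_le order.trans[OF degree_smult_le degree_linear_power_le])
    fix A assume A: "A \<in> \<Gamma>"
    let ?c = "constm (of_real (A$2$1))" and ?d = "constm (of_real (A$2$2))"
    have "(\<Sum>n\<le>N + m. hom_eval n (G n) ?c ?d)
      = (\<Sum>n\<le>N + m. if n < m then 0 else g (n - m) * autm A ^ n) + (\<Sum>n\<le>N + m. if n = 0 then - f else 0)"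
      unfolding sum.distrib[symmetric]
      by (intro sum.cong refl)
         (auto simp: G_def hom_eval_add hom_eval_smult hom_eval_linear_power autm_def mult.commute hom_eval_def[of 0])
    also have "(\<Sum>n\<le>N + m. if n = 0 then - f else 0) = - f" by simp
    also have "(\<Sum>n\<le>N + m. if n < m then 0 else g (n - m) * autm A ^ n) = (\<Sum>n=0+m..N+m. g (n - m) * autm A ^ n)"
      by (rule sum.mono_neutral_cong_right) auto
    also have "\<dots> = (\<Sum>n\<le>N. g n * autm A ^ (n + m))"
      unfolding sum.shift_bounds_cl_nat_ivl by (simp add: atMost_atLeast0)
    also have "\<dots> = pullback A f * autm A ^ m"
      unfolding g(2) pullback_sum sum_distrib_right
      using generated_form_facts[OF g(1)] A by (intro sum.cong) (auto simp: power_add)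
    also have "\<dots> = f"
      using modular_form_pullback[OF fk A det_one[OF A]] assms(2) by (simp add: m_def)
    finally show "(\<Sum>n\<le>N + m. hom_eval n (G n) ?c ?d) = 0" by simp
  qed simp
  then show ?thesis using m by (simp add: G_def)
qed

lemma weight_part_generated:
  assumes "f \<in> weight_part \<Gamma> M (int k)"
  shows "generated_form \<Gamma> S k f"
proof -
  have fM: "f \<in> M" and fk: "f \<in> modular_forms \<Gamma> (int k)" using assms by (auto simp: weight_part_def)
  obtain N g where g: "\<And>n. generated_form \<Gamma> S n (g n)" "f = (\<Sum>n\<le>N. g n)" "\<And>n. n > N \<Longrightarrow> g n = 0"
    using algebra_decomposition[OF fM] by metis
  have f: "pullback A f = autm A ^ k * f" if "A \<in> \<Gamma>" for A
    using modular_form_pullback[OF fk that det_one[OF that]] by simp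
  define h where "h n = g n + (if n = k then (-1) *\<^sub>m f else 0)" for n
  have "h k = 0"
  proof (rule graded_zero)
    show "\<exists>F. transforms \<Gamma> n (h n) F" for n
    proof -
      have "transforms \<Gamma> n (g n) (smult (g n) ([:1, zvar:] ^ n))"
        using generated_form_facts[OF g(1)] by (intro transforms_modular) blast
      moreover have "\<exists>F. transforms \<Gamma> n (if n = k then (-1) *\<^sub>m f else 0) F"
      proof (cases "n = k")
        case True
        have "transforms \<Gamma> k f (smult f ([:1, zvar:] ^ k))" by (rule transforms_modular[OF f])
        from transforms_scale[OF this, of "-1"] True show ?thesis by auto
      next
        case False
        then show ?thesis using transforms_zero by auto
      qed
      ultimately show ?thesis unfolding h_def using transforms_add by blast
    qed
    have "(\<Sum>n\<le>N + k. g n) = (\<Sum>n\<le>N. g n)"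
      by (rule sum.mono_neutral_right) (use g(3) in auto)
    then show "(\<Sum>n\<le>N + k. h n) = 0" by (simp add: h_def sum.distrib g(2))
  qed simp
  then have "f = g k" by (simp add: h_def)
  then show ?thesis using g(1) by simp
qed

text \<open>The properties of a form of weight \<open>k\<close> that have to be carried through the induction
  over the differential closure together. The last one says that \<open>\<delta>\<close> exists on
  \<open>f\<close>, preserves the closure and vanishes up to weight 2; the vanishing in weight 2 is
  what lets \<open>\<delta>\<close> respect \<open>J2\<close>.\<close>

definition closure_facts :: "int \<Rightarrow> mero \<Rightarrow> bool" where
  "closure_facts k f \<longleftrightarrow> f \<in> CW k \<and> (k < 0 \<or> odd k \<longrightarrow> f = 0) \<and> (k = 0 \<longrightarrow> f \<in> constants) \<and>
    (k > 0 \<longrightarrow> f \<in> mero.span (derivatives (nat k) \<union> J2)) \<and>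
    (\<exists>w. lowering \<Gamma> (nat k) f w \<and> w \<in> CW (k - 2) \<and> (k \<le> 2 \<longrightarrow> w = 0))"

lemma closure_facts_zero: "closure_facts k 0"
  unfolding closure_facts_def using lowering_zero CW_zero scalar_in_constants[of 0]
  by (auto simp: mero.span_zero intro!: exI[of _ 0])

lemma closure_facts_scale:
  assumes "closure_facts k f" shows "closure_facts k (c *\<^sub>m f)"
proof -
  obtain w where w: "lowering \<Gamma> (nat k) f w" "w \<in> CW (k - 2)" "k \<le> 2 \<longrightarrow> w = 0"
    using assms unfolding closure_facts_def by blast
  have "lowering \<Gamma> (nat k) (c *\<^sub>m f) (c *\<^sub>m w) \<and> c *\<^sub>m w \<in> CW (k - 2) \<and> (k \<le> 2 \<longrightarrow> c *\<^sub>m w = 0)"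
    using w by (auto intro: lowering_scale CW_scale)
  moreover have "c *\<^sub>m f \<in> constants" if "f \<in> constants"
    using that scalar_in_constants by (metis constantsE constm_mult scale_eq_constm)
  ultimately show ?thesis
    using assms unfolding closure_facts_def by (auto intro: CW_scale mero.span_scale)
qed

lemma closure_facts_add:
  assumes "closure_facts k f" "closure_facts k g" shows "closure_facts k (f + g)"
proof -
  obtain v where v: "lowering \<Gamma> (nat k) f v" "v \<in> CW (k - 2)" "k \<le> 2 \<longrightarrow> v = 0"
    using assms unfolding closure_facts_def by blast
  obtain w where w: "lowering \<Gamma> (nat k) g w" "w \<in> CW (k - 2)" "k \<le> 2 \<longrightarrow> w = 0"
    using assms unfolding closure_facts_def by blast
  have "lowering \<Gamma> (nat k) (f + g) (v + w) \<and> v + w \<in> CW (k - 2) \<and> (k \<le> 2 \<longrightarrow> v + w = 0)"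
    using v w by (auto intro: lowering_add CW_add)
  moreover have "f + g \<in> constants" if "f \<in> constants" "g \<in> constants"
    using that scalar_in_constants by (metis constantsE constm_add)
  moreover have "f \<in> CW k" "g \<in> CW k" "k < 0 \<or> odd k \<longrightarrow> f = 0" "k < 0 \<or> odd k \<longrightarrow> g = 0"
      "k = 0 \<longrightarrow> f \<in> constants" "k = 0 \<longrightarrow> g \<in> constants"
      "k > 0 \<longrightarrow> f \<in> mero.span (derivatives (nat k) \<union> J2)" "k > 0 \<longrightarrow> g \<in> mero.span (derivatives (nat k) \<union> J2)"
    using assms unfolding closure_facts_def by blast+
  ultimately show ?thesis
    unfolding closure_facts_def by (simp add: CW_add mero.span_add) blast
qed

text \<open>A product of two nonconstant, nonzero forms has factors of positive even weight, so its weight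
  exceeds 2.\<close>

lemma closure_facts_mult:
  assumes f: "closure_facts k f" and g: "closure_facts l g" shows "closure_facts (k + l) (f * g)"
proof -
  consider "f = 0 \<or> g = 0" | "k = 0" | "l = 0" | "k > 0" "l > 0" "even k" "even l"
    using f g unfolding closure_facts_def by (metis linorder_neqE_linordered_idom)
  then show ?thesis
  proof cases
    case 1
    then show ?thesis using closure_facts_zero by auto
  next
    case 2
    then obtain c where "f = constm c" using f by (auto simp: closure_facts_def elim: constantsE)
    then show ?thesis using closure_facts_scale[OF g, of c] 2 by (simp add: scale_eq_constm)
  next
    case 3
    then obtain c where "g = constm c" using g by (auto simp: closure_facts_def elim: constantsE)
    then show ?thesis using closure_facts_scale[OF f, of c] 3 by (simp add: scale_eq_constm mult.commute)
  next
    case 4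
    obtain v where v: "lowering \<Gamma> (nat k) f v" "v \<in> CW (k - 2)"
      using f unfolding closure_facts_def by blast
    obtain w where w: "lowering \<Gamma> (nat l) g w" "w \<in> CW (l - 2)"
      using g unfolding closure_facts_def by blast
    have fg: "f \<in> CW k" "g \<in> CW l" using f g by (auto simp: closure_facts_def)
    have "lowering \<Gamma> (nat k + nat l) (f * g) (v * g + f * w)"
      by (rule lowering_mult[OF one_in v(1) w(1)])
    then have low: "lowering \<Gamma> (nat (k + l)) (f * g) (v * g + f * w)"
      using 4 by (simp add: nat_add_distrib)
    have "v * g \<in> CW (k + l - 2)" "f * w \<in> CW (k + l - 2)"
      using CW_mult[OF v(2) fg(2)] CW_mult[OF fg(1) w(2)] by (simp_all add: algebra_simps)
    then have "v * g + f * w \<in> CW (k + l - 2)" by (rule CW_add)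
    moreover have "f * g \<in> J2" using fg 4 CW_subset_J by (intro J_mult) auto
    moreover have "k + l > 2" using 4 by (auto elim!: evenE)
    ultimately show ?thesis
      using low CW_mult[OF fg] 4 unfolding closure_facts_def by (auto intro: mero.span_base)
  qed
qed

lemma closure_facts_D:
  assumes f: "closure_facts k f" shows "closure_facts (k + 2) (D_mero f)"
proof -
  consider "f = 0" | "k = 0" | "k > 0" "even k"
    using f unfolding closure_facts_def by (metis linorder_neqE_linordered_idom)
  then show ?thesis
  proof cases
    case 1
    then show ?thesis using closure_facts_zero by simp
  next
    case 2
    then have "D_mero f = 0" using f by (auto simp: closure_facts_def elim: constantsE)
    then show ?thesis using closure_facts_zero by simp
  next
    case 3
    obtain w where w: "lowering \<Gamma> (nat k) f w" "w \<in> CW (k - 2)"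
      using f unfolding closure_facts_def by blast
    have fk: "f \<in> CW k" "f \<in> mero.span (derivatives (nat k) \<union> J2)"
      using f 3 by (auto simp: closure_facts_def)
    have n: "nat (k + 2) = nat k + 2" using 3 by simp
    have "lowering \<Gamma> (nat (k + 2)) (D_mero f) (D_mero w + of_nat (nat k) *\<^sub>m f)"
      unfolding n by (rule lowering_D[OF det_one one_in w(1)])
    moreover have "D_mero w + of_nat (nat k) *\<^sub>m f \<in> CW (k + 2 - 2)"
      using CW_D[OF w(2)] CW_scale[OF fk(1)] by (auto intro: CW_add)
    ultimately show ?thesis
      using CW_D[OF fk(1)] D_span_derivatives[OF fk(2)] 3 unfolding closure_facts_def n by auto
  qed
qed

text \<open>Holds for modular forms by the decomposition of the algebra, and passes to sums, products and
  derivatives.\<close>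

lemma closure_facts:
  assumes "f \<in> CW k" shows "closure_facts k f"
proof -
  have "closure_homogeneous \<Gamma> M k f" using assms by (simp add: closure_weight_part_def)
  then show ?thesis
  proof induction
    case (base f k)
    then have fk: "f \<in> CW k" by (auto simp: closure_weight_part_def intro: closure_homogeneous.base)
    have mf: "f \<in> modular_forms \<Gamma> k" using base by (simp add: weight_part_def)
    show ?case
    proof (cases "k < 0 \<or> odd k")
      case True
      then have "f = 0"
        using negative_weight_zero[OF base] modular_form_odd_zero[OF mf minus_one_in] by blast
      then show ?thesis using closure_facts_zero by simp
    next
      case False
      then have k: "k = int (nat k)" by simp
      have "generated_form \<Gamma> S (nat k) f" using base k weight_part_generated by metis
      from generated_form_facts[OF this]
      have facts: "\<forall>A\<in>\<Gamma>. pullback A f = autm A ^ nat k * f" "nat k = 0 \<longrightarrow> f \<in> constants"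
        "nat k > 0 \<longrightarrow> f \<in> mero.span (S \<inter> modular_forms \<Gamma> (int (nat k)) \<union> J2)" by auto
      have "S \<inter> modular_forms \<Gamma> (int (nat k)) \<subseteq> derivatives (nat k)" if "nat k > 0"
      proof
        fix g assume "g \<in> S \<inter> modular_forms \<Gamma> (int (nat k))"
        with that show "g \<in> derivatives (nat k)"
          unfolding derivatives_def by (intro CollectI exI[of _ g] exI[of _ 0] exI[of _ "nat k"]) simp
      qed
      then have span: "f \<in> mero.span (derivatives (nat k) \<union> J2)" if "nat k > 0"
        using that facts(3) mero.span_mono[of "S \<inter> modular_forms \<Gamma> (int (nat k)) \<union> J2" "derivatives (nat k) \<union> J2"]
        by blast
      have "lowering \<Gamma> (nat k) f 0" using facts(1) by (intro lowering_modular) blast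
      then show ?thesis using False facts(2) span fk CW_zero unfolding closure_facts_def by auto
    qed
  qed (auto intro: closure_facts_add closure_facts_mult closure_facts_D)
qed

end

section \<open>Decomposable forms and derivatives of modular forms\<close>

context modular_algebra
begin

lemma CW_transforms: "f \<in> CW (int n) \<Longrightarrow> \<exists>F. transforms \<Gamma> n f F"
  using closure_facts[of f "int n"] unfolding closure_facts_def lowering_def by auto

lemma CW_decomposition_unique:
  assumes g: "\<And>n. g n \<in> CW (int n)" "\<And>n. n > N \<Longrightarrow> g n = 0"
    and h: "\<And>n. h n \<in> CW (int n)" "\<And>n. n > N' \<Longrightarrow> h n = 0"
    and eq: "(\<Sum>n\<le>N. g n) = (\<Sum>n\<le>N'. h n)"
  shows "g n = h n"
proof -
  have *: "(\<Sum>n\<le>N + N' + n. g n) = (\<Sum>n\<le>N. g n)" "(\<Sum>n\<le>N + N' + n. h n) = (\<Sum>n\<le>N'. h n)" for n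
    by (rule sum.mono_neutral_right; use g h in auto)+
  have "g n - h n = 0"
  proof (rule graded_zero)
    show "\<exists>F. transforms \<Gamma> n (g n - h n) F" for n
      by (intro CW_transforms mero.subspace_diff[OF subspace_CW] g h)
    show "(\<Sum>n\<le>N + N' + n. g n - h n) = 0" by (simp add: sum_subtractf * eq)
  qed simp
  then show ?thesis by simp
qed

lemma J_decomposition:
  assumes "f \<in> J"
  obtains N g where "\<And>n. g n \<in> CW (int n)" "g 0 = 0" "\<And>n. n > N \<Longrightarrow> g n = 0" "f = (\<Sum>n\<le>N. g n)"
proof -
  define V where "V n = (if n = 0 then {0} else CW (int n))" for n :: nat
  have "CW k \<subseteq> V (nat k)" if "k > 0" for k using that by (simp add: V_def)
  then have "(\<Union>k\<in>{0<..}. CW k) \<subseteq> (\<Union>n. V n)" by blast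
  then have f: "f \<in> mero.span (\<Union>n. V n)"
    using assms mero.span_mono unfolding closure_positive_ideal_def by blast
  have "mero.subspace (V n)" for n
    unfolding V_def using subspace_CW mero.subspace_single_0 by simp
  from span_graded[OF this f] obtain N g where g: "\<forall>n. g n \<in> V n" "\<forall>n>N. g n = 0" "f = (\<Sum>n\<le>N. g n)" by blast
  have "g n \<in> CW (int n)" for n using g(1)[rule_format, of n] CW_zero by (auto simp: V_def split: if_splits)
  moreover have "g 0 = 0" using g(1)[rule_format, of 0] by (simp add: V_def)
  ultimately show thesis using that g(2,3) by blast
qed

lemma J_CW_zero: "f \<in> J \<Longrightarrow> f \<in> CW 0 \<Longrightarrow> f = 0"
proof -
  assume f: "f \<in> J" "f \<in> CW 0"
  obtain g N where g: "\<And>n. g n \<in> CW (int n)" "g 0 = 0" "\<And>n. n > N \<Longrightarrow> g n = 0" "f = (\<Sum>n\<le>N. g n)"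
    using J_decomposition[OF f(1)] by metis
  define h where "h n = (if n = 0 then f else 0)" for n :: nat
  have "g 0 = h 0"
    by (rule CW_decomposition_unique[of g N h 0]) (use g f(2) CW_zero in \<open>auto simp: h_def\<close>)
  then show ?thesis by (simp add: g(2) h_def)
qed

lemma J_CW_nonpos: "f \<in> J \<Longrightarrow> f \<in> CW k \<Longrightarrow> k \<le> 0 \<Longrightarrow> f = 0"
  using J_CW_zero closure_facts[of f k] unfolding closure_facts_def by (cases "k = 0") auto

text \<open>The weight \<open>n\<close> part of \<open>J2\<close>.\<close>

definition decomposables :: "nat \<Rightarrow> mero set" where
  "decomposables n = mero.span {f * g | f g a b. f \<in> CW a \<and> g \<in> CW b \<and> a > 0 \<and> b > 0 \<and> a + b = int n}"

lemma decomposables_subset: "decomposables n \<subseteq> CW (int n) \<inter> J2"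
proof -
  have "{f * g | f g a b. f \<in> CW a \<and> g \<in> CW b \<and> a > 0 \<and> b > 0 \<and> a + b = int n} \<subseteq> CW (int n) \<inter> J2"
  proof safe
    fix f g a b assume *: "f \<in> CW a" "g \<in> CW b" "a > 0" "b > 0" "a + b = int n"
    show "f * g \<in> CW (int n)" using CW_mult[OF *(1,2)] *(5) by simp
    show "f * g \<in> J2" using * CW_subset_J by (intro J_mult) auto
  qed
  then show ?thesis unfolding decomposables_def
    by (intro mero.span_minimal mero.subspace_inter subspace_CW subspace_J2)
qed

lemma J2_decomposition:
  assumes "x \<in> J2"
  obtains N y where "\<And>n. y n \<in> decomposables n" "\<And>n. n > N \<Longrightarrow> y n = 0" "x = (\<Sum>n\<le>N. y n)"
proof -
  have "f * g \<in> mero.span (\<Union>n. decomposables n)" if "f \<in> J" "g \<in> J" for f g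
    using that unfolding closure_positive_ideal_def
  proof (rule mult_in_span)
    fix a b assume "a \<in> (\<Union>k\<in>{0<..}. CW k)" "b \<in> (\<Union>k\<in>{0<..}. CW k)"
    then obtain k l where kl: "k > 0" "l > 0" "a \<in> CW k" "b \<in> CW l" by auto
    then have "k + l = int (nat (k + l))" by simp
    with kl have "a * b \<in> decomposables (nat (k + l))"
      unfolding decomposables_def by (intro mero.span_base) blast
    then show "a * b \<in> mero.span (\<Union>n. decomposables n)" by (intro mero.span_base) blast
  qed
  then have "{f * g |f g. f \<in> J \<and> g \<in> J} \<subseteq> mero.span (\<Union>n. decomposables n)" by blast
  then have "x \<in> mero.span (\<Union>n. decomposables n)"
    using assms mero.span_minimal[OF _ mero.subspace_span] unfolding ideal_square_def by blast
  moreover have "mero.subspace (decomposables n)" for n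
    unfolding decomposables_def by (rule mero.subspace_span)
  ultimately obtain N y where "\<forall>n. y n \<in> decomposables n" "\<forall>n>N. y n = 0" "x = (\<Sum>n\<le>N. y n)"
    using span_graded by blast
  then show thesis by (intro that[of y N]) auto
qed

text \<open>\<open>J2\<close> is spanned by products of homogeneous elements, hence is a graded subspace.\<close>

lemma J2_graded:
  assumes y: "\<And>n. y n \<in> CW (int n)" "\<And>n. n > N \<Longrightarrow> y n = 0" and x: "(\<Sum>n\<le>N. y n) \<in> J2"
  shows "y n \<in> decomposables n"
proof -
  obtain N' z where z: "\<And>n. z n \<in> decomposables n" "\<And>n. n > N' \<Longrightarrow> z n = 0" "(\<Sum>n\<le>N. y n) = (\<Sum>n\<le>N'. z n)"
    using J2_decomposition[OF x] by metis
  have "y n = z n"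
  proof (rule CW_decomposition_unique[of y N z N'])
    show "z n \<in> CW (int n)" for n using z(1) decomposables_subset by blast
  qed (use y z in auto)
  then show ?thesis using z(1) by simp
qed

lemma J2_homogeneous:
  assumes "x \<in> J2" "x \<in> CW (int k)" shows "x \<in> decomposables k"
proof -
  define y where "y n = (if n = k then x else 0)" for n
  have "y k \<in> decomposables k"
    by (rule J2_graded[of y k]) (use assms CW_zero in \<open>auto simp: y_def\<close>)
  then show ?thesis by (simp add: y_def)
qed

text \<open>By the product rule, \<open>\<delta>\<close> maps \<open>f g\<close> to \<open>\<delta>(f) g + f
  \<delta>(g)\<close>. Lowering a factor of weight greater than 2 leaves it in \<open>J\<close>, and
  factors of weight at most 2 are killed.\<close>

lemma lowering_decomposables:
  assumes "x \<in> decomposables k"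
  shows "\<exists>w\<in>J2. lowering \<Gamma> k x w"
  using assms unfolding decomposables_def
proof (induction rule: mero.span_induct_alt)
  case base
  show ?case using lowering_zero mero.subspace_0[OF subspace_J2] by blast
next
  case (step c p x)
  then obtain f g a b where fg: "p = f * g" "f \<in> CW a" "g \<in> CW b" "a > 0" "b > 0" "a + b = int k"
    by blast
  obtain v where v: "lowering \<Gamma> (nat a) f v" "v \<in> CW (a - 2)" "a \<le> 2 \<longrightarrow> v = 0"
    using closure_facts[OF fg(2)] unfolding closure_facts_def by blast
  obtain w where w: "lowering \<Gamma> (nat b) g w" "w \<in> CW (b - 2)" "b \<le> 2 \<longrightarrow> w = 0"
    using closure_facts[OF fg(3)] unfolding closure_facts_def by blast
  have fgJ: "f \<in> J" "g \<in> J" using fg CW_subset_J by auto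
  have "v * g \<in> J2"
  proof (cases "a \<le> 2")
    case True
    then show ?thesis using v(3) mero.subspace_0[OF subspace_J2] by simp
  next
    case False
    then show ?thesis using v(2) CW_subset_J[of "a - 2"] fgJ by (intro J_mult) auto
  qed
  moreover have "f * w \<in> J2"
  proof (cases "b \<le> 2")
    case True
    then show ?thesis using w(3) mero.subspace_0[OF subspace_J2] by simp
  next
    case False
    then show ?thesis using w(2) CW_subset_J[of "b - 2"] fgJ by (intro J_mult) auto
  qed
  ultimately have in_J2: "v * g + f * w \<in> J2" by (rule mero.subspace_add[OF subspace_J2])
  have "nat a + nat b = k" using fg by linarith
  then have low: "lowering \<Gamma> k p (v * g + f * w)"
    using lowering_mult[OF one_in v(1) w(1)] fg(1) by simp
  from step obtain u where u: "u \<in> J2" "lowering \<Gamma> k x u" by blast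
  have "lowering \<Gamma> k (c *\<^sub>m p + x) (c *\<^sub>m (v * g + f * w) + u)"
    by (intro lowering_add lowering_scale low u)
  moreover have "c *\<^sub>m (v * g + f * w) + u \<in> J2"
    by (intro mero.subspace_add[OF subspace_J2] mero.subspace_scale[OF subspace_J2] in_J2 u)
  ultimately show ?case by blast
qed

lemma lowering_in_J2:
  assumes "x \<in> J2" "x \<in> CW (int k)" "lowering \<Gamma> k x w"
  shows "w \<in> J2"
  using lowering_decomposables[OF J2_homogeneous[OF assms(1,2)]]
    lowering_unique[OF discrete covolume assms(3)] by blast

lemma CW_D_iter: "f \<in> CW k \<Longrightarrow> (D_mero ^^ n) f \<in> CW (k + 2 * int n)"
proof (induction n)
  case (Suc n)
  then show ?case using CW_D[of "(D_mero ^^ n) f" "k + 2 * int n"] by (simp add: algebra_simps)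
qed simp

lemma D_iter_J2: "f \<in> J2 \<Longrightarrow> (D_mero ^^ n) f \<in> J2"
  by (induction n) (simp_all add: D_J2)

lemma D_iter_linear: "(D_mero ^^ n) (f + g) = (D_mero ^^ n) f + (D_mero ^^ n) g"
  "(D_mero ^^ n) (c *\<^sub>m f) = c *\<^sub>m (D_mero ^^ n) f"
  by (induction n) (simp_all add: D_mero_add D_mero_scale)

lemma D_iter_sum: "(D_mero ^^ n) (\<Sum>i\<in>I. h i) = (\<Sum>i\<in>I. (D_mero ^^ n) (h i))"
proof (induction I rule: infinite_finite_induct)
  case (insert x F)
  then show ?case by (simp add: D_iter_linear)
qed (use D_iter_linear(2)[of n 0 0] in simp_all)

text \<open>\<open>\<delta> D\<^sup>n f = n (l + n - 1) D\<^sup>n\<^sup>-\<^sup>1 f\<close>, by summing the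
  weights \<open>l, l + 2, \<dots>, l + 2 (n - 1)\<close> that the commutation relation contributes.
  For \<open>n = 0\<close> the truncated subtractions are multiplied by 0.\<close>

lemma lowering_D_iter:
  assumes "\<And>A. A \<in> \<Gamma> \<Longrightarrow> pullback A f = autm A ^ l * f"
  shows "lowering \<Gamma> (l + 2 * n) ((D_mero ^^ n) f) (of_nat (n * (l + n - 1)) *\<^sub>m (D_mero ^^ (n - 1)) f)"
proof (induction n)
  case 0
  show ?case using lowering_modular[OF assms] by simp
next
  case (Suc n)
  have "D_mero (of_nat (n * (l + n - 1)) *\<^sub>m (D_mero ^^ (n - 1)) f) = of_nat (n * (l + n - 1)) *\<^sub>m (D_mero ^^ n) f"
    by (cases n) (simp_all add: D_mero_scale)
  moreover have "n * (l + n - 1) + (l + 2 * n) = Suc n * (l + n)"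
    by (cases n) (simp_all add: algebra_simps)
  ultimately have "D_mero (of_nat (n * (l + n - 1)) *\<^sub>m (D_mero ^^ (n - 1)) f) + of_nat (l + 2 * n) *\<^sub>m (D_mero ^^ n) f
      = of_nat (Suc n * (l + n)) *\<^sub>m (D_mero ^^ n) f"
    by (simp only: mero.scale_left_distrib[symmetric] of_nat_add[symmetric])
  with lowering_D[OF det_one one_in Suc] show ?case by simp
qed

lemma lowering_sum:
  "(\<And>i. i \<in> I \<Longrightarrow> lowering \<Gamma> k (g i) (w i)) \<Longrightarrow> lowering \<Gamma> k (\<Sum>i\<in>I. g i) (\<Sum>i\<in>I. w i)"
  by (induction I rule: infinite_finite_induct) (auto simp: lowering_zero intro: lowering_add)

text \<open>Induction over the weight \<open>2 n\<close>: applying \<open>\<delta>\<close> removes the terms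
  with \<open>L i = 2 n\<close> and multiplies every other coefficient by a nonzero integer.\<close>

lemma derivatives_independent:
  fixes f :: "nat \<Rightarrow> mero" and L :: "nat \<Rightarrow> nat"
  assumes f: "\<And>i. i < \<epsilon> \<Longrightarrow> f i \<in> weight_part \<Gamma> M (int (L i))"
    and L: "\<And>i. i < \<epsilon> \<Longrightarrow> L i > 0 \<and> even (L i)"
    and ind: "independent_modulo J2 {..<\<epsilon>} f"
    and x: "(\<Sum>i | i < \<epsilon> \<and> L i \<le> 2 * n. c i *\<^sub>m (D_mero ^^ ((2 * n - L i) div 2)) (f i)) \<in> J2"
    and i: "i < \<epsilon>" "L i \<le> 2 * n"
  shows "c i = 0"
  using x i
proof (induction n arbitrary: c i)
  case 0
  then show ?case using L[of i] by simp
next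
  case (Suc n)
  define K where "K = {i. i < \<epsilon> \<and> L i \<le> 2 * Suc n}"
  define K' where "K' = {i. i < \<epsilon> \<and> L i \<le> 2 * n}"
  define m where "m i = (2 * Suc n - L i) div 2" for i
  have fin: "finite K" by (simp add: K_def)
  have K'K: "K' \<subseteq> K" by (auto simp: K_def K'_def)
  have Lm: "L i + 2 * m i = 2 * Suc n" if "i \<in> K" for i
    using that L[of i] by (auto simp: K_def m_def elim!: evenE)
  have m0: "m i = 0" if "i \<in> K - K'" for i
    using that Lm[of i] by (auto simp: K_def K'_def)
  have m1: "m i > 0" "m i - 1 = (2 * n - L i) div 2" if "i \<in> K'" for i
    using that Lm[of i] K'K by (auto simp: K'_def)
  have pb: "pullback A (f i) = autm A ^ L i * f i" if "i < \<epsilon>" "A \<in> \<Gamma>" for i A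
  proof -
    have "f i \<in> modular_forms \<Gamma> (int (L i))" using f[OF that(1)] by (simp add: weight_part_def)
    from modular_form_pullback[OF this that(2) det_one[OF that(2)]] show ?thesis by simp
  qed
  have fCW: "f i \<in> CW (int (L i))" if "i < \<epsilon>" for i
    using f[OF that] by (auto simp: closure_weight_part_def intro: closure_homogeneous.base)
  define x where "x = (\<Sum>i\<in>K. c i *\<^sub>m (D_mero ^^ m i) (f i))"
  have x: "x \<in> J2" using Suc.prems(1) by (simp add: x_def K_def m_def)
  have "(D_mero ^^ m i) (f i) \<in> CW (int (2 * Suc n))" if "i \<in> K" for i
  proof -
    have "int (L i) + 2 * int (m i) = int (2 * Suc n)" using Lm[OF that] by linarith
    then show ?thesis using CW_D_iter[OF fCW, of i "m i"] that by (simp add: K_def)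
  qed
  then have xCW: "x \<in> CW (int (2 * Suc n))"
    unfolding x_def by (intro mero.subspace_sum[OF subspace_CW] CW_scale)
  define e where "e i = (of_nat (m i * (L i + m i - 1)) :: complex)" for i
  have "lowering \<Gamma> (2 * Suc n) ((D_mero ^^ m i) (f i)) (e i *\<^sub>m (D_mero ^^ (m i - 1)) (f i))" if "i \<in> K" for i
    using lowering_D_iter[of "f i" "L i" "m i"] pb that Lm[OF that] unfolding e_def by (auto simp: K_def)
  then have "lowering \<Gamma> (2 * Suc n) x (\<Sum>i\<in>K. c i *\<^sub>m e i *\<^sub>m (D_mero ^^ (m i - 1)) (f i))"
    unfolding x_def by (intro lowering_sum lowering_scale)
  from lowering_in_J2[OF x xCW this]
  have "(\<Sum>i\<in>K. c i *\<^sub>m e i *\<^sub>m (D_mero ^^ (m i - 1)) (f i)) \<in> J2" .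
  also have "(\<Sum>i\<in>K. c i *\<^sub>m e i *\<^sub>m (D_mero ^^ (m i - 1)) (f i))
     = (\<Sum>i\<in>K'. (c i * e i) *\<^sub>m (D_mero ^^ ((2 * n - L i) div 2)) (f i))"
  proof (rule sum.mono_neutral_cong_right[OF fin K'K])
    show "\<forall>i\<in>K - K'. c i *\<^sub>m e i *\<^sub>m (D_mero ^^ (m i - 1)) (f i) = 0" by (simp add: m0 e_def)
  qed (simp only: m1(2) mero.scale_scale)
  finally have low: "(\<Sum>i | i < \<epsilon> \<and> L i \<le> 2 * n. (c i * e i) *\<^sub>m (D_mero ^^ ((2 * n - L i) div 2)) (f i)) \<in> J2"
    by (simp add: K'_def)
  have c': "c j = 0" if "j \<in> K'" for j
  proof -
    have j: "j < \<epsilon>" "L j \<le> 2 * n" using that by (auto simp: K'_def)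
    have "c j * e j = 0" by (rule Suc.IH[OF low j])
    moreover have "m j * (L j + m j - 1) \<noteq> 0" using m1(1)[OF that] L[OF j(1)] by simp
    then have "e j \<noteq> 0" unfolding e_def by (simp del: of_nat_mult)
    ultimately show ?thesis by simp
  qed
  \<comment> \<open>after \<open>c'\<close> the relation involves only the \<open>f i\<close> of weight exactly
    \<open>2 * Suc n\<close>, undifferentiated\<close>
  define c2 where "c2 i = (if i \<in> K - K' then c i else 0)" for i
  have "(\<Sum>i<\<epsilon>. c2 i *\<^sub>m f i) = x"
    unfolding x_def
    by (rule sum.mono_neutral_cong_right) (auto simp: c2_def c' m0 K_def)
  then have "\<forall>i<\<epsilon>. c2 i = 0"
    using x ind unfolding independent_modulo_def by auto
  then show ?case
    using Suc.prems(2,3) c'[of i] by (cases "i \<in> K'") (auto simp: c2_def K_def)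
qed

text \<open>Modulo \<open>J2\<close> every form is a combination of derivatives of generators. A generator of
  weight \<open>l\<close> is a combination of the \<open>f i\<close>; since \<open>J2\<close> is
  graded, only those of weight \<open>l\<close> are needed, and differentiating \<open>n\<close>
  times gives derivatives of the right order.\<close>

lemma derivatives_span:
  fixes f :: "nat \<Rightarrow> mero" and L :: "nat \<Rightarrow> nat"
  assumes f: "\<And>i. i < \<epsilon> \<Longrightarrow> f i \<in> weight_part \<Gamma> M (int (L i))"
    and basis: "\<And>g. g \<in> positive_ideal \<Gamma> M \<Longrightarrow> \<exists>c. g - (\<Sum>i<\<epsilon>. c i *\<^sub>m f i) \<in> J2"
    and v: "v \<in> CW (int k)" "k > 0"
  shows "\<exists>c. v - (\<Sum>i | i < \<epsilon> \<and> L i \<le> k. c i *\<^sub>m (D_mero ^^ ((k - L i) div 2)) (f i)) \<in> J2"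
proof -
  define K where "K = {i. i < \<epsilon> \<and> L i \<le> k}"
  define b where "b i = (D_mero ^^ ((k - L i) div 2)) (f i)" for i
  define V where "V = {v. \<exists>c. v - (\<Sum>i\<in>K. c i *\<^sub>m b i) \<in> J2}"
  have fin: "finite K" by (simp add: K_def)
  have sub: "mero.subspace V"
  proof (rule mero.subspaceI)
    show "0 \<in> V" using mero.subspace_0[OF subspace_J2] by (auto simp: V_def intro!: exI[of _ "\<lambda>_. 0"])
    fix x y assume "x \<in> V" "y \<in> V"
    then obtain c d where cd: "x - (\<Sum>i\<in>K. c i *\<^sub>m b i) \<in> J2" "y - (\<Sum>i\<in>K. d i *\<^sub>m b i) \<in> J2"
      by (auto simp: V_def)
    from mero.subspace_add[OF subspace_J2 this]
    have "(x + y) - (\<Sum>i\<in>K. (c i + d i) *\<^sub>m b i) \<in> J2"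
      by (simp add: mero.scale_left_distrib sum.distrib algebra_simps)
    then show "x + y \<in> V" unfolding V_def mem_Collect_eq by (rule exI[of _ "\<lambda>i. c i + d i"])
  next
    fix a x assume "x \<in> V"
    then obtain c where "x - (\<Sum>i\<in>K. c i *\<^sub>m b i) \<in> J2" by (auto simp: V_def)
    from mero.subspace_scale[OF subspace_J2 this, of a]
    have "a *\<^sub>m x - (\<Sum>i\<in>K. (a * c i) *\<^sub>m b i) \<in> J2"
      by (simp add: mero.scale_right_diff_distrib mero.scale_sum_right)
    then show "a *\<^sub>m x \<in> V" unfolding V_def mem_Collect_eq by (rule exI[of _ "\<lambda>i. a * c i"])
  qed
  have "J2 \<subseteq> V" by (auto simp: V_def intro!: exI[of _ "\<lambda>_. 0"])
  moreover have "derivatives k \<subseteq> V"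
  proof
    fix x assume "x \<in> derivatives k"
    then obtain g n l where g: "x = (D_mero ^^ n) g" "g \<in> S" "g \<in> modular_forms \<Gamma> (int l)" "l > 0" "l + 2 * n = k"
      unfolding derivatives_def by blast
    have gw: "g \<in> weight_part \<Gamma> M (int l)"
      using g(2,3) subring_generated_algebra(3)[of S] by (auto simp: weight_part_def)
    have "g \<in> (\<Union>k\<in>{0<..}. weight_part \<Gamma> M k)" using gw g(4) by (intro UN_I[of "int l"]) simp_all
    then have "g \<in> positive_ideal \<Gamma> M"
      unfolding positive_ideal_def by (rule mero.span_base)
    from basis[OF this] obtain c where c: "g - (\<Sum>i<\<epsilon>. c i *\<^sub>m f i) \<in> J2" by blast
    \<comment> \<open>the component of weight \<open>r\<close> of \<open>g - (\<Sum>i<\<epsilon>. c i *\<^sub>m f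
      i)\<close>\<close>
    define y where "y r = (if r = l then g else 0) - (\<Sum>i | i \<in> {..<\<epsilon>} \<and> L i = r. c i *\<^sub>m f i)" for r
    define N where "N = l + (\<Sum>i<\<epsilon>. L i)"
    have LN: "L i \<le> N" if "i < \<epsilon>" for i
      using member_le_sum[of i "{..<\<epsilon>}" L] that by (simp add: N_def)
    have hom: "h \<in> CW q" if "h \<in> weight_part \<Gamma> M q" for h q
      using that by (auto simp: closure_weight_part_def intro: closure_homogeneous.base)
    have yCW: "y r \<in> CW (int r)" for r
    proof -
      have "(if r = l then g else 0) \<in> CW (int r)" using hom[OF gw] CW_zero by auto
      moreover have "(\<Sum>i | i \<in> {..<\<epsilon>} \<and> L i = r. c i *\<^sub>m f i) \<in> CW (int r)"
        using hom[OF f] by (intro mero.subspace_sum[OF subspace_CW] CW_scale) auto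
      ultimately show ?thesis unfolding y_def by (rule mero.subspace_diff[OF subspace_CW])
    qed
    have y0: "y r = 0" if "r > N" for r
    proof -
      have "r \<noteq> l" using that by (simp add: N_def)
      moreover have empty: "{i. i \<in> {..<\<epsilon>} \<and> L i = r} = {}" using LN that by fastforce
      ultimately show ?thesis unfolding y_def empty by simp
    qed
    have "(\<Sum>r\<le>N. y r) = (\<Sum>r\<le>N. if r = l then g else 0) - (\<Sum>r\<le>N. \<Sum>i | i \<in> {..<\<epsilon>} \<and> L i = r. c i *\<^sub>m f i)"
      unfolding y_def by (rule sum_subtractf)
    also have "(\<Sum>r\<le>N. \<Sum>i | i \<in> {..<\<epsilon>} \<and> L i = r. c i *\<^sub>m f i) = (\<Sum>i<\<epsilon>. c i *\<^sub>m f i)"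
      by (rule sum.group) (use LN in auto)
    also have "(\<Sum>r\<le>N. if r = l then g else 0) = g" by (simp add: N_def)
    finally have "(\<Sum>r\<le>N. y r) \<in> J2" using c by simp
    from J2_graded[OF yCW y0 this, of l] have "y l \<in> J2" using decomposables_subset by blast
    then have "(D_mero ^^ n) (y l) \<in> J2" by (rule D_iter_J2)
    moreover have "(D_mero ^^ n) (y l) = x - (\<Sum>i | i \<in> {..<\<epsilon>} \<and> L i = l. c i *\<^sub>m (D_mero ^^ n) (f i))"
    proof -
      have "y l + (\<Sum>i | i \<in> {..<\<epsilon>} \<and> L i = l. c i *\<^sub>m f i) = g" by (simp add: y_def)
      then have "(D_mero ^^ n) (y l) + (D_mero ^^ n) (\<Sum>i | i \<in> {..<\<epsilon>} \<and> L i = l. c i *\<^sub>m f i) = x"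
        unfolding g(1) D_iter_linear(1)[symmetric] by simp
      then show ?thesis by (simp add: D_iter_sum D_iter_linear(2) algebra_simps)
    qed
    moreover have "(\<Sum>i | i \<in> {..<\<epsilon>} \<and> L i = l. c i *\<^sub>m (D_mero ^^ n) (f i)) = (\<Sum>i\<in>K. (if L i = l then c i else 0) *\<^sub>m b i)"
      by (rule sum.mono_neutral_cong_left) (use g(5) in \<open>auto simp: K_def b_def\<close>)
    ultimately show "x \<in> V" unfolding V_def mem_Collect_eq
      by (intro exI[of _ "\<lambda>i. if L i = l then c i else 0"]) simp
  qed
  ultimately have "mero.span (derivatives k \<union> J2) \<subseteq> V" by (intro mero.span_minimal sub) blast
  moreover have "v \<in> mero.span (derivatives k \<union> J2)"
    using closure_facts[OF v(1)] v(2) unfolding closure_facts_def by simp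
  ultimately show ?thesis unfolding V_def K_def b_def by blast
qed

end

section \<open>Structure of the indecomposable forms\<close>

context modular_algebra
begin

lemma J2_subset_J: "J2 \<subseteq> J"
proof -
  have "f * g \<in> J" if "f \<in> J" "g \<in> J" for f g
    using that unfolding closure_positive_ideal_def
  proof (rule mult_in_span)
    fix a b assume "a \<in> (\<Union>k\<in>{0<..}. CW k)" "b \<in> (\<Union>k\<in>{0<..}. CW k)"
    then obtain k l where kl: "k > 0" "l > 0" "a \<in> CW k" "b \<in> CW l" by auto
    then have "a * b \<in> (\<Union>k\<in>{0<..}. CW k)" using CW_mult[of a k b l] by (intro UN_I[of "k + l"]) auto
    then show "a * b \<in> mero.span (\<Union>k\<in>{0<..}. CW k)" by (rule mero.span_base)
  qed
  moreover have "mero.subspace J" unfolding closure_positive_ideal_def by (rule mero.subspace_span)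
  ultimately show ?thesis unfolding ideal_square_def by (intro mero.span_minimal) auto
qed

lemma differential_closure_closed:
  "subring_mero (differential_closure M)" "f \<in> differential_closure M \<Longrightarrow> D_mero f \<in> differential_closure M"
  "M \<subseteq> differential_closure M"
proof -
  have "subring_mero (differential_closure M) \<and> D_mero ` differential_closure M \<subseteq> differential_closure M"
    unfolding differential_closure_def
  proof (rule hull_in, intro conjI)
    fix T :: "mero set set" assume T: "\<forall>R\<in>T. subring_mero R \<and> D_mero ` R \<subseteq> R"
    then show "subring_mero (\<Inter>T)" by (auto simp: subring_mero_def)
    show "D_mero ` \<Inter>T \<subseteq> \<Inter>T" using T by blast
  qed
  then show "subring_mero (differential_closure M)" "f \<in> differential_closure M \<Longrightarrow> D_mero f \<in> differential_closure M" by auto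
  show "M \<subseteq> differential_closure M" unfolding differential_closure_def by (rule hull_subset)
qed

lemma CW_subset_differential_closure: "CW k \<subseteq> differential_closure M"
proof
  fix f assume "f \<in> CW k"
  then have "closure_homogeneous \<Gamma> M k f" by (simp add: closure_weight_part_def)
  then show "f \<in> differential_closure M"
  proof induction
    case (base f k)
    then show ?case using differential_closure_closed(3) by (auto simp: weight_part_def)
  qed (auto intro: subring_mero_closed[OF differential_closure_closed(1)] differential_closure_closed(2))
qed

lemma differential_closure_split:
  assumes "f \<in> differential_closure M"
  shows "\<exists>c j. f = constm c + j \<and> j \<in> J"
proof -
  define X where "X = mero.span (\<Union>n. CW (int n))"
  have "differential_closure M \<subseteq> X"
    unfolding differential_closure_def
  proof (rule hull_minimal)
    show "M \<subseteq> X"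
    proof
      fix f assume "f \<in> M"
      then obtain N g where g: "\<And>k. generated_form \<Gamma> S k (g k)" "f = (\<Sum>k\<le>N. g k)"
        using algebra_decomposition by metis
      have "g k \<in> X" for k
        unfolding X_def using generated_form_facts[OF g(1)[of k]] by (intro mero.span_base) blast
      then show "f \<in> X" unfolding g(2) X_def by (intro mero.span_sum)
    qed
    have mult: "x * y \<in> X" if "x \<in> X" "y \<in> X" for x y
      using that unfolding X_def
    proof (rule mult_in_span)
      fix a b assume "a \<in> (\<Union>n. CW (int n))" "b \<in> (\<Union>n. CW (int n))"
      then obtain k l where "a \<in> CW (int k)" "b \<in> CW (int l)" by auto
      then have "a * b \<in> CW (int (k + l))" using CW_mult by simp
      then show "a * b \<in> mero.span (\<Union>n. CW (int n))" by (intro mero.span_base) blast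
    qed
    have one: "1 \<in> X"
      unfolding X_def using CW_const[of 1] by (intro mero.span_base UN_I[of 0]) simp_all
    have "D_mero x \<in> X" if "x \<in> X" for x
      using that unfolding X_def
    proof (induction rule: mero.span_induct_alt)
      case base
      show ?case by (simp add: mero.span_zero)
    next
      case (step c a x)
      then obtain k where "a \<in> CW (int k)" by auto
      then have "D_mero a \<in> CW (int (k + 2))" using CW_D[of a "int k"] by (simp add: add.commute)
      then have "D_mero a \<in> mero.span (\<Union>n. CW (int n))" by (intro mero.span_base) blast
      then show ?case using step unfolding D_mero_add D_mero_scale by (intro mero.span_add mero.span_scale)
    qed
    then show "subring_mero X \<and> D_mero ` X \<subseteq> X"
      unfolding subring_mero_def using mult one by (auto simp: X_def intro: mero.span_diff)
  qed
  with assms have "f \<in> mero.span (\<Union>n. CW (int n))" unfolding X_def by blast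
  from span_graded[OF subspace_CW this] obtain N g where g: "\<forall>n. g n \<in> CW (int n)" "f = (\<Sum>n\<le>N. g n)" by blast
  have "g 0 \<in> constants" using closure_facts[of "g 0" 0] g(1)[rule_format, of 0] by (simp add: closure_facts_def)
  then obtain c where c: "g 0 = constm c" by (rule constantsE)
  have "(\<Sum>n\<in>{..N} - {0}. g n) \<in> J"
    unfolding closure_positive_ideal_def using g(1)
    by (intro mero.span_sum mero.span_base UN_I[of "int _"]) auto
  moreover have "f = constm c + (\<Sum>n\<in>{..N} - {0}. g n)"
    unfolding g(2) c[symmetric] by (rule sum.remove) auto
  ultimately show ?thesis by blast
qed

text \<open>Removing the constant terms of finitely many algebra generators leaves elements of
  \<open>J\<close> that span \<open>J\<close> modulo \<open>J2\<close>.\<close>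

lemma infinitely_many_indecomposables_not_finitely_generated:
  assumes b: "\<And>n. b n \<in> J" and ind: "\<And>n. independent_modulo J2 {..<n::nat} b"
    and hom: "\<And>n. b n \<in> CW (k n)"
  shows "\<not> finitely_generated_algebra (differential_closure M)"
proof
  assume "finitely_generated_algebra (differential_closure M)"
  then obtain T where T: "finite T" "differential_closure M = generated_algebra T"
    unfolding finitely_generated_algebra_def by blast
  have "\<exists>c j. t = constm c + j \<and> j \<in> J" if "t \<in> T" for t
    using that differential_closure_split subring_generated_algebra(3)[of T] unfolding T(2)[symmetric] by blast
  then obtain c j where cj: "\<And>t. t \<in> T \<Longrightarrow> t = constm (c t) + j t \<and> j t \<in> J" by metis
  define Y where "Y = mero.span (j ` T \<union> J2)"
  \<comment> \<open>constants plus the span of the \<open>j t\<close> modulo \<open>J2\<close>: a subring, since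
    products of two elements of \<open>Y\<close> lie in \<open>J2\<close>\<close>
  define Q where "Q = {constm a + x | a x. x \<in> Y}"
  have subJ: "mero.subspace J" unfolding closure_positive_ideal_def by (rule mero.subspace_span)
  have YJ: "Y \<subseteq> J" unfolding Y_def using cj J2_subset_J by (intro mero.span_minimal subJ) auto
  have "generated_algebra T \<subseteq> Q"
  proof (rule generated_algebra_minimal)
    show "T \<subseteq> Q"
    proof
      fix t assume t: "t \<in> T"
      have "j t \<in> Y" unfolding Y_def using t by (intro mero.span_base) blast
      then show "t \<in> Q" unfolding Q_def using cj[OF t] by blast
    qed
    show const: "constants \<subseteq> Q"
    proof
      fix f assume "f \<in> constants"
      then obtain a where "f = constm a + 0" by (auto elim: constantsE)
      then show "f \<in> Q" unfolding Q_def using mero.span_zero[of "j ` T \<union> J2"] Y_def by blast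
    qed
    show "subring_mero Q"
      unfolding subring_mero_def
    proof (intro conjI ballI)
      show "1 \<in> Q" using const scalar_in_constants[of 1] by auto
      fix f g assume "f \<in> Q" "g \<in> Q"
      then obtain a x a' x' where fg: "f = constm a + x" "g = constm a' + x'" "x \<in> Y" "x' \<in> Y"
        by (auto simp: Q_def)
      have "constm a = constm (a - a') + constm a'" by (simp flip: constm_add)
      then have "f - g = constm (a - a') + (x - x')" unfolding fg by simp
      moreover have "x - x' \<in> Y" using fg unfolding Y_def by (intro mero.span_diff)
      ultimately show "f - g \<in> Q" unfolding Q_def by blast
      have "x * x' \<in> Y" unfolding Y_def using fg YJ by (intro mero.span_base UnI2 J_mult) auto
      then have "a *\<^sub>m x' + a' *\<^sub>m x + x * x' \<in> Y"
        using fg unfolding Y_def by (intro mero.span_add mero.span_scale)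
      moreover have "f * g = constm (a * a') + (a *\<^sub>m x' + a' *\<^sub>m x + x * x')"
        unfolding fg constm_mult scale_eq_constm by (simp add: algebra_simps)
      ultimately show "f * g \<in> Q" unfolding Q_def by blast
    qed
  qed
  then have CQ: "CW i \<subseteq> Q" for i using CW_subset_differential_closure T(2) by blast
  have bY: "b n \<in> Y" for n
  proof -
    have "b n \<in> Q" using CQ hom[of n] by blast
    then obtain a x where ax: "b n = constm a + x" "x \<in> Y" unfolding Q_def by blast
    have "constm a = b n - x" using ax by simp
    then have "constm a \<in> J" using b ax(2) YJ mero.subspace_diff[OF subJ] by auto
    then have "constm a = 0" using J_CW_zero CW_const by blast
    then show ?thesis using ax by simp
  qed
  have "card {..<Suc (card T)} \<le> card (j ` T)"
    by (rule independent_modulo_bound[OF subspace_J2 ind]) (use T bY in \<open>auto simp: Y_def\<close>)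
  also have "\<dots> \<le> card T" using T by (intro card_image_le)
  finally show False by simp
qed

text \<open>A form of least positive weight cannot be a sum of products of forms of smaller positive weight.\<close>

lemma positive_part_not_decomposable:
  assumes "M \<noteq> constants"
  shows "\<exists>k. k > 0 \<and> \<not> CW (int k) \<subseteq> J2"
proof -
  have "\<not> S \<subseteq> constants"
  proof
    assume S: "S \<subseteq> constants"
    have "subring_mero constants"
      unfolding subring_mero_def
    proof (intro conjI ballI)
      show "1 \<in> constants" using scalar_in_constants[of 1] by simp
      fix f g assume "f \<in> constants" "g \<in> constants"
      then obtain a c where ac: "f = constm a" "g = constm c" by (auto elim!: constantsE)
      have "constm a = constm (a - c) + constm c" by (simp flip: constm_add)
      then have "f - g = constm (a - c)" unfolding ac by simp
      then show "f - g \<in> constants" using scalar_in_constants by simp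
      show "f * g \<in> constants" unfolding ac constm_mult[symmetric] by (rule scalar_in_constants)
    qed
    then have "M \<subseteq> constants" using generated_algebra_minimal[OF S] by blast
    with assms subring_generated_algebra(2)[of S] show False by blast
  qed
  then obtain g where g: "g \<in> S" "g \<notin> constants" by blast
  then obtain k where k: "k > 0" "g \<in> modular_forms \<Gamma> k" using generators_modular by blast
  have "g \<in> CW (int (nat k))"
    using g k subring_generated_algebra(3)[of S]
    by (auto simp: closure_weight_part_def weight_part_def intro!: closure_homogeneous.base)
  moreover have "g \<noteq> 0" using g(2) scalar_in_constants[of 0] by auto
  moreover have "nat k > 0" using k by simp
  ultimately have ex: "\<exists>n. n > 0 \<and> (\<exists>x\<in>CW (int n). x \<noteq> 0)" by blast
  define n where "n = (LEAST n. n > 0 \<and> (\<exists>x\<in>CW (int n). x \<noteq> 0))"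
  have n: "n > 0" "\<exists>x\<in>CW (int n). x \<noteq> 0" using LeastI_ex[OF ex] by (simp_all add: n_def)
  have least: "x = 0" if "x \<in> CW (int m)" "m > 0" "m < n" for x m
    using not_less_Least[of m "\<lambda>n. n > 0 \<and> (\<exists>x\<in>CW (int n). x \<noteq> 0)"] that by (auto simp: n_def)
  have "\<not> CW (int n) \<subseteq> J2"
  proof
    assume sub: "CW (int n) \<subseteq> J2"
    obtain x where x: "x \<in> CW (int n)" "x \<noteq> 0" using n by blast
    have "{f * g | f g a b. f \<in> CW a \<and> g \<in> CW b \<and> a > 0 \<and> b > 0 \<and> a + b = int n} \<subseteq> {0}"
    proof safe
      fix f g a b assume *: "f \<in> CW a" "g \<in> CW b" "a > 0" "b > 0" "a + b = int n"
      have "f = 0" using least[of f "nat a"] * by simp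
      then show "f * g = 0" by simp
    qed
    then have "decomposables n \<subseteq> {0}"
      unfolding decomposables_def by (intro mero.span_minimal mero.subspace_single_0)
    then show False using J2_homogeneous x sub by blast
  qed
  then show ?thesis using n by blast
qed

text \<open>In particular the quotient by decomposable forms is finite-dimensional if \<open>S\<close> is
  finite.\<close>

lemma positive_ideal_span: "positive_ideal \<Gamma> M \<subseteq> mero.span (S \<union> J2)"
  unfolding positive_ideal_def
proof (intro mero.span_minimal mero.subspace_span UN_least subsetI)
  fix k f assume k: "k \<in> {0<..}" and f: "f \<in> weight_part \<Gamma> M k"
  have "generated_form \<Gamma> S (nat k) f" using weight_part_generated[of f "nat k"] k f by simp
  from generated_form_facts[OF this] k
  have "f \<in> mero.span (S \<inter> modular_forms \<Gamma> (int (nat k)) \<union> J2)" by auto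
  moreover have "mero.span (S \<inter> modular_forms \<Gamma> (int (nat k)) \<union> J2) \<subseteq> mero.span (S \<union> J2)"
    by (rule mero.span_mono) blast
  ultimately show "f \<in> mero.span (S \<union> J2)" by blast
qed

lemma positive_ideal_subset_J: "positive_ideal \<Gamma> M \<subseteq> J"
  unfolding positive_ideal_def closure_positive_ideal_def
  by (intro mero.span_mono UN_mono) (auto simp: closure_weight_part_def intro: closure_homogeneous.base)

text \<open>The weights \<open>l i\<close> are necessarily positive and even, because the \<open>f i\<close>
  are nonzero elements of \<open>J\<close>. With the weights as natural numbers \<open>L i\<close>,
  independence is \<open>derivatives_independent\<close> and spanning is
  \<open>derivatives_span\<close>; in nonpositive weight both the space and the index set are
  trivial.\<close>

theorem indecomposable_forms_structure:
  fixes f :: "nat \<Rightarrow> mero" and l :: "nat \<Rightarrow> int"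
  assumes S: "finite S" and nonconst: "M \<noteq> constants"
    and \<epsilon>: "\<epsilon> = quotient_dim (positive_ideal \<Gamma> M) (positive_ideal \<Gamma> M \<inter> J2)"
    and f: "\<forall>i<\<epsilon>. f i \<in> positive_ideal \<Gamma> M \<inter> weight_part \<Gamma> M (l i)"
    and ind: "independent_modulo J2 {..<\<epsilon>} f"
  shows "\<And>k::int. even k \<Longrightarrow>
            quotient_basis (J \<inter> CW k) (J2 \<inter> CW k)
              {i. i < \<epsilon> \<and> l i \<le> k} (\<lambda>i. (D_mero ^^ nat ((k - l i) div 2)) (f i))" (is "\<And>k. _ \<Longrightarrow> ?basis k")
    and "\<And>k::int. even k \<Longrightarrow> \<forall>i<\<epsilon>. l i \<le> k \<Longrightarrow> quotient_dim (J \<inter> CW k) (J2 \<inter> CW k) = \<epsilon>"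
    and "\<not> finitely_generated_algebra (differential_closure M)"
proof -
  let ?I = "positive_ideal \<Gamma> M"
  have subI: "mero.subspace (?I \<inter> J2)"
    unfolding positive_ideal_def by (intro mero.subspace_inter mero.subspace_span subspace_J2)
  have fin: "?I \<subseteq> mero.span (S \<union> (?I \<inter> J2))"
  proof
    fix x assume x: "x \<in> ?I"
    have SI: "S \<subseteq> ?I"
    proof
      fix g assume g: "g \<in> S"
      then obtain k where "k > 0" "g \<in> modular_forms \<Gamma> k" using generators_modular by blast
      then have "g \<in> (\<Union>k\<in>{0<..}. weight_part \<Gamma> M k)"
        using g subring_generated_algebra(3)[of S] by (auto simp: weight_part_def)
      then show "g \<in> ?I" unfolding positive_ideal_def by (rule mero.span_base)
    qed
    obtain s j where sj: "x = s + j" "s \<in> mero.span S" "j \<in> J2"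
      using x positive_ideal_span unfolding mero.span_Un mero.span_eq_iff[THEN iffD2, OF subspace_J2] by blast
    have subspI: "mero.subspace ?I" unfolding positive_ideal_def by (rule mero.subspace_span)
    have "s \<in> ?I" using sj(2) mero.span_minimal[OF SI subspI] by blast
    then have "j \<in> ?I" using x sj(1) mero.subspace_diff[OF subspI, of x s] by simp
    then have "j \<in> ?I \<inter> J2" using sj(3) by blast
    moreover have "s \<in> mero.span (S \<union> (?I \<inter> J2))"
      using sj(2) mero.span_mono[of S "S \<union> (?I \<inter> J2)"] by blast
    ultimately show "x \<in> mero.span (S \<union> (?I \<inter> J2))"
      unfolding sj(1) by (intro mero.span_add mero.span_base[of j]) auto
  qed
  have qb: "quotient_basis ?I (?I \<inter> J2) {..<\<epsilon>} f"
    by (rule independent_modulo_quotient_dim_basis[OF subI S fin \<epsilon>])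
       (use ind f in \<open>auto simp: independent_modulo_def\<close>)
  have basis: "\<exists>c. g - (\<Sum>i<\<epsilon>. c i *\<^sub>m f i) \<in> J2" if "g \<in> ?I" for g
    using qb that unfolding quotient_basis_def by blast
  have nz: "f i \<noteq> 0" if i: "i < \<epsilon>" for i
  proof
    assume "f i = 0"
    then have "(\<Sum>j<\<epsilon>. (if j = i then 1 else 0) *\<^sub>m f j) = 0"
      by (intro sum.neutral) auto
    then have "(\<Sum>j<\<epsilon>. (if j = i then 1 else 0) *\<^sub>m f j) \<in> J2"
      using mero.subspace_0[OF subspace_J2] by simp
    then have "\<forall>j\<in>{..<\<epsilon>}. (if j = i then 1 else 0 :: complex) = 0"
      using ind[unfolded independent_modulo_def, rule_format, of "\<lambda>j. if j = i then 1 else 0"] by blast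
    from this[rule_format, of i] i show False by simp
  qed
  have fCW: "f i \<in> CW (l i)" if "i < \<epsilon>" for i
    using f that by (auto simp: closure_weight_part_def intro: closure_homogeneous.base)
  have fJ: "f i \<in> J" if "i < \<epsilon>" for i using f that positive_ideal_subset_J by blast
  have lpos: "l i > 0" if "i < \<epsilon>" for i
    using J_CW_nonpos[OF fJ fCW] nz that by (meson not_less)
  have leven: "even (l i)" if "i < \<epsilon>" for i
    using closure_facts[OF fCW[OF that]] nz[OF that] unfolding closure_facts_def by blast
  define L where "L i = nat (l i)" for i
  have L: "int (L i) = l i" if "i < \<epsilon>" for i using lpos[OF that] by (simp add: L_def)
  have fL: "f i \<in> weight_part \<Gamma> M (int (L i))" if "i < \<epsilon>" for i using f L[OF that] that by simp
  have Lpos: "L i > 0 \<and> even (L i)" if "i < \<epsilon>" for i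
    using lpos[OF that] leven[OF that] L[OF that] by (metis even_of_nat of_nat_0_less_iff)
  show basis_k: "?basis k" if k: "even k" for k
  proof (cases "k > 0")
    case False
    then have empty: "{i. i < \<epsilon> \<and> l i \<le> k} = {}" using lpos by force
    have "v = 0" if "v \<in> J \<inter> CW k" for v using that J_CW_nonpos False by auto
    then show ?thesis
      unfolding empty quotient_basis_def independent_modulo_def
      using CW_zero mero.subspace_0[OF subspace_J2] by auto
  next
    case True
    define n where "n = nat k div 2"
    have kn: "k = int (2 * n)" using True k by (auto simp: n_def even_nat_iff)
    define K where "K = {i. i < \<epsilon> \<and> L i \<le> 2 * n}"
    have K_eq: "{i. i < \<epsilon> \<and> l i \<le> k} = K"
      unfolding K_def kn using L by (metis of_nat_le_iff)
    define b where "b i = (D_mero ^^ ((2 * n - L i) div 2)) (f i)" for i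
    have b_eq: "(D_mero ^^ nat ((k - l i) div 2)) (f i) = b i" if "i \<in> K" for i
    proof -
      have i: "i < \<epsilon>" "L i \<le> 2 * n" using that by (auto simp: K_def)
      have "k - l i = int (2 * n - L i)" unfolding kn L[OF i(1), symmetric] using i(2) by simp
      then have "nat ((k - l i) div 2) = (2 * n - L i) div 2" by (simp add: nat_div_distrib)
      then show ?thesis by (simp add: b_def)
    qed
    have bCW: "b i \<in> CW k" if "i \<in> K" for i
    proof -
      have i: "i < \<epsilon>" "L i \<le> 2 * n" using that by (auto simp: K_def)
      have "L i + 2 * ((2 * n - L i) div 2) = 2 * n" using i Lpos[OF i(1)] by (auto elim!: evenE)
      then have "l i + 2 * int ((2 * n - L i) div 2) = k" unfolding kn L[OF i(1), symmetric] by linarith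
      then show ?thesis using CW_D_iter[OF fCW[OF i(1)], of "(2 * n - L i) div 2"] by (simp add: b_def)
    qed
    have "quotient_basis (J \<inter> CW k) (J2 \<inter> CW k) K b"
      unfolding quotient_basis_def
    proof (intro conjI ballI)
      show "finite K" by (simp add: K_def)
      show "b ` K \<subseteq> J \<inter> CW k" using bCW CW_subset_J[OF True] by blast
      show "independent_modulo (J2 \<inter> CW k) K b"
        unfolding independent_modulo_def
      proof (intro allI impI ballI)
        fix c i assume c: "(\<Sum>i\<in>K. c i *\<^sub>m b i) \<in> J2 \<inter> CW k" and i: "i \<in> K"
        from derivatives_independent[OF fL Lpos ind, where n = n and c = c and i = i] c i
        show "c i = 0" by (simp add: K_def b_def)
      qed
      fix v assume v: "v \<in> J \<inter> CW k"
      have "\<exists>c. v - (\<Sum>i\<in>K. c i *\<^sub>m b i) \<in> J2"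
        using derivatives_span[OF fL basis, of v "2 * n"] v True unfolding kn K_def b_def by auto
      then obtain c where c: "v - (\<Sum>i\<in>K. c i *\<^sub>m b i) \<in> J2" by blast
      moreover have "v - (\<Sum>i\<in>K. c i *\<^sub>m b i) \<in> CW k"
        using v bCW by (intro mero.subspace_diff[OF subspace_CW] mero.subspace_sum[OF subspace_CW] CW_scale) auto
      ultimately show "\<exists>c. v - (\<Sum>i\<in>K. c i *\<^sub>m b i) \<in> J2 \<inter> CW k" by blast
    qed
    then show ?thesis
      unfolding K_eq quotient_basis_def independent_modulo_def
      by (simp add: b_eq cong: sum.cong image_cong_simp)
  qed
  show "quotient_dim (J \<inter> CW k) (J2 \<inter> CW k) = \<epsilon>" if "even k" "\<forall>i<\<epsilon>. l i \<le> k" for k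
  proof (rule quotient_dim_eqI)
    show "mero.subspace (J2 \<inter> CW k)" by (intro mero.subspace_inter subspace_J2 subspace_CW)
    have "{i. i < \<epsilon> \<and> l i \<le> k} = {..<\<epsilon>}" using that(2) by auto
    then show "quotient_basis (J \<inter> CW k) (J2 \<inter> CW k) {..<\<epsilon>} (\<lambda>i. (D_mero ^^ nat ((k - l i) div 2)) (f i))"
      using basis_k[OF that(1)] by simp
  qed
  have "\<epsilon> > 0"
  proof (rule ccontr)
    assume "\<not> \<epsilon> > 0"
    then have \<epsilon>0: "\<epsilon> = 0" by simp
    obtain k where k: "k > 0" "\<not> CW (int k) \<subseteq> J2" using positive_part_not_decomposable[OF nonconst] by blast
    have "v \<in> J2" if "v \<in> CW (int k)" for v
      using derivatives_span[OF fL basis that k(1)] \<epsilon>0 by simp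
    with k show False by blast
  qed
  \<comment> \<open>the derivatives of a single \<open>f 0\<close> have different weights and none is decomposable\<close>
  define h where "h n = (D_mero ^^ n) (f 0)" for n
  have hCW: "h n \<in> CW (int (L 0 + 2 * n))" for n
    using CW_D_iter[OF fCW[OF \<open>\<epsilon> > 0\<close>], of n] L[OF \<open>\<epsilon> > 0\<close>] by (simp add: h_def)
  have hJ: "h n \<in> J" for n
    using hCW[of n] CW_subset_J[of "int (L 0 + 2 * n)"] Lpos[OF \<open>\<epsilon> > 0\<close>] by auto
  have h_indecomposable: "c = 0" if "c *\<^sub>m h n \<in> J2" for c n
  proof -
    obtain r where r: "L 0 = 2 * r" using Lpos[OF \<open>\<epsilon> > 0\<close>] by (auto elim: evenE)
    have "(\<Sum>i | i < \<epsilon> \<and> L i \<le> 2 * (r + n). (if i = 0 then c else 0) *\<^sub>m (D_mero ^^ ((2 * (r + n) - L i) div 2)) (f i)) = c *\<^sub>m h n"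
    proof -
      have "(\<Sum>i | i < \<epsilon> \<and> L i \<le> 2 * (r + n). (if i = 0 then c else 0) *\<^sub>m (D_mero ^^ ((2 * (r + n) - L i) div 2)) (f i))
        = (\<Sum>i\<in>{0}. (if i = 0 then c else 0) *\<^sub>m (D_mero ^^ ((2 * (r + n) - L i) div 2)) (f i))"
        by (rule sum.mono_neutral_right) (use \<open>\<epsilon> > 0\<close> r in auto)
      then show ?thesis using r by (simp add: h_def)
    qed
    then have in_J2: "(\<Sum>i | i < \<epsilon> \<and> L i \<le> 2 * (r + n). (if i = 0 then c else 0) *\<^sub>m (D_mero ^^ ((2 * (r + n) - L i) div 2)) (f i)) \<in> J2"
      using that by simp
    from derivatives_independent[OF fL Lpos ind in_J2, where i = 0] \<open>\<epsilon> > 0\<close> r show ?thesis by simp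
  qed
  have h_ind: "independent_modulo J2 {..<n} h" for n
    unfolding independent_modulo_def
  proof (intro allI impI ballI)
    fix c i assume c: "(\<Sum>i<n. c i *\<^sub>m h i) \<in> J2" and i: "i \<in> {..<n}"
    define N where "N = L 0 + 2 * n"
    define y where "y r = (\<Sum>i | i \<in> {..<n} \<and> L 0 + 2 * i = r. c i *\<^sub>m h i)" for r
    have "(\<Sum>r\<le>N. y r) = (\<Sum>i<n. c i *\<^sub>m h i)"
      unfolding y_def by (rule sum.group) (auto simp: N_def)
    with c have sumJ2: "(\<Sum>r\<le>N. y r) \<in> J2" by simp
    have "y (L 0 + 2 * i) \<in> decomposables (L 0 + 2 * i)"
    proof (rule J2_graded[OF _ _ sumJ2])
      show "y r \<in> CW (int r)" for r
        unfolding y_def using hCW by (intro mero.subspace_sum[OF subspace_CW] CW_scale) auto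
      show "y r = 0" if "r > N" for r
      proof -
        have empty: "{i. i \<in> {..<n} \<and> L 0 + 2 * i = r} = {}" using that by (auto simp: N_def)
        show ?thesis unfolding y_def empty by simp
      qed
    qed
    moreover have "{j. j \<in> {..<n} \<and> L 0 + 2 * j = L 0 + 2 * i} = {i}" using i by auto
    then have "y (L 0 + 2 * i) = c i *\<^sub>m h i" unfolding y_def by simp
    ultimately have "c i *\<^sub>m h i \<in> J2" using decomposables_subset by auto
    then show "c i = 0" by (rule h_indecomposable)
  qed
  show "\<not> finitely_generated_algebra (differential_closure M)"
    by (rule infinitely_many_indecomposables_not_finitely_generated[OF hJ h_ind hCW])
qed

end

theorem theorem7:
  fixes \<Gamma> :: "(real^2^2) set" and S M J J2 :: "mero set"
    and \<epsilon> :: nat and f :: "nat \<Rightarrow> mero" and l :: "nat \<Rightarrow> int"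
  assumes "discrete_subgroup_PSL2R \<Gamma>" and "finite_covolume \<Gamma>"
    and "finite S" and "\<forall>g\<in>S. \<exists>k>0. g \<in> modular_forms \<Gamma> k"
    and "M = generated_algebra S" and "M \<noteq> constants"
    and "J = closure_positive_ideal \<Gamma> M" and "J2 = ideal_square J"
    and "\<epsilon> = quotient_dim (positive_ideal \<Gamma> M) (positive_ideal \<Gamma> M \<inter> J2)"
    and "\<forall>i<\<epsilon>. f i \<in> positive_ideal \<Gamma> M \<inter> weight_part \<Gamma> M (l i)"
    and "independent_modulo J2 {..<\<epsilon>} f"
  shows "(\<forall>k::int. even k \<longrightarrow>
            quotient_basis (J \<inter> closure_weight_part \<Gamma> M k) (J2 \<inter> closure_weight_part \<Gamma> M k)
              {i. i < \<epsilon> \<and> l i \<le> k} (\<lambda>i. (D_mero ^^ nat ((k - l i) div 2)) (f i))) \<and>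
         (\<forall>k::int. even k \<and> (\<forall>i<\<epsilon>. l i \<le> k) \<longrightarrow>
            quotient_dim (J \<inter> closure_weight_part \<Gamma> M k) (J2 \<inter> closure_weight_part \<Gamma> M k) = \<epsilon>) \<and>
         \<not> finitely_generated_algebra (differential_closure M)"
proof -
  interpret modular_algebra \<Gamma> S
    by unfold_locales (use assms in auto)
  note M = assms(5) and J = assms(7)[unfolded assms(5)] and J2 = assms(8)[unfolded assms(7), unfolded assms(5)]
  note result = indecomposable_forms_structure[OF assms(3) assms(6)[unfolded M] assms(9)[unfolded M J2] assms(10)[unfolded M] assms(11)[unfolded J2]]
  show ?thesis unfolding M J2 J using result by blast
qed

end
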